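(* Let $p$ be a prime, let $G\leqslant F_1\times F_2$ be a full subdirect product of non-abelian free groups $F_1,F_2$, and let $N_1:=G\cap F_1$. Then the following are equivalent: (i) $G$ is $p$-conjugacy separable; (ii) $F_1/N_1$ is a residually finite $p$-group.
   Context: A group $G$ is $p$-conjugacy separable if for any two non-conjugate elements $x,y\in G$ there is a homomorphism $\varphi$ from $G$ to a finite $p$-group $M$ such that $\varphi(x)$ and $\varphi(y)$ are not conjugate in $M$. A $p$-group is a (possibly infinite) periodic group in which every element has order a power of $p$. A "residually finite $p$-group" means a $p$-group which is residually finite. In $F_1\times F_2$ one identifies $F_1$ with $F_1\times\{1\}$ and $F_2$ with $\{1\}\times F_2$. A subgroup $G\leqslant F_1\times F_2$ is a subdirect product if both coordinate projections map $G$ onto $F_1$ and $F_2$ respectively; it is a full subdirect product if in addition $G\cap F_i\neq\{1\}$ for $i=1,2$. For a subdirect product, $G\cap F_i\lhd F_i$. *)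

theory Defs
  imports "HOL-Algebra.Algebra"
begin

section \<open>Free groups\<close>

text \<open>A letter \<open>(s, True)\<close> stands for \<open>s\<close> and \<open>(s, False)\<close> for the formal inverse of \<open>s\<close>.\<close>

definition letter_val :: "('a, 'b) monoid_scheme \<Rightarrow> 'a \<times> bool \<Rightarrow> 'a" where
  "letter_val F l = (if snd l then fst l else inv\<^bsub>F\<^esub> (fst l))"

definition word_val :: "('a, 'b) monoid_scheme \<Rightarrow> ('a \<times> bool) list \<Rightarrow> 'a" where
  "word_val F w = foldr (\<lambda>l g. letter_val F l \<otimes>\<^bsub>F\<^esub> g) w \<one>\<^bsub>F\<^esub>"

definition reduced_words :: "'a set \<Rightarrow> ('a \<times> bool) list set" where
  "reduced_words S =
     {w \<in> lists (S \<times> UNIV). successively (\<lambda>k l. \<not> (fst k = fst l \<and> snd k \<noteq> snd l)) w}"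

text \<open>\<open>S\<close> freely generates \<open>F\<close>: each element of \<open>F\<close> is the value of exactly one reduced word
  over \<open>S\<close> and its inverses. The rank is arbitrary, possibly infinite.\<close>

definition free_basis :: "('a, 'b) monoid_scheme \<Rightarrow> 'a set \<Rightarrow> bool" where
  "free_basis F S \<longleftrightarrow>
     S \<subseteq> carrier F \<and> bij_betw (word_val F) (reduced_words S) (carrier F)"

definition free_group :: "('a, 'b) monoid_scheme \<Rightarrow> bool" where
  "free_group F \<longleftrightarrow> group F \<and> (\<exists>S. free_basis F S)"


section \<open>Conjugacy separability and residual finiteness\<close>

definition conjugate :: "('a, 'b) monoid_scheme \<Rightarrow> 'a \<Rightarrow> 'a \<Rightarrow> bool" where
  "conjugate G x y \<longleftrightarrow> (\<exists>g \<in> carrier G. y = g \<otimes>\<^bsub>G\<^esub> x \<otimes>\<^bsub>G\<^esub> inv\<^bsub>G\<^esub> g)"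

text \<open>Elements of infinite order are excluded for \<open>p > 0\<close>, since \<^term>\<open>group.ord G x\<close> is \<open>0\<close> for them.\<close>

definition p_group :: "nat \<Rightarrow> ('a, 'b) monoid_scheme \<Rightarrow> bool" where
  "p_group p G \<longleftrightarrow> group G \<and> (\<forall>x \<in> carrier G. \<exists>n. group.ord G x = p ^ n)"

text \<open>A definition cannot quantify over types. In the next two definitions the finite target
  groups have carriers in \<^typ>\<open>nat\<close>; this loses nothing, as every finite group is isomorphic to one of these.\<close>

definition p_conjugacy_separable :: "nat \<Rightarrow> ('a, 'b) monoid_scheme \<Rightarrow> bool" where
  "p_conjugacy_separable p G \<longleftrightarrow>
     (\<forall>x \<in> carrier G. \<forall>y \<in> carrier G. \<not> conjugate G x y \<longrightarrow>
        (\<exists>(M :: nat monoid) \<phi>. p_group p M \<and> finite (carrier M) \<and> \<phi> \<in> hom G M \<and>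
           \<not> conjugate M (\<phi> x) (\<phi> y)))"

definition residually_finite :: "('a, 'b) monoid_scheme \<Rightarrow> bool" where
  "residually_finite G \<longleftrightarrow>
     (\<forall>x \<in> carrier G. x \<noteq> \<one>\<^bsub>G\<^esub> \<longrightarrow>
        (\<exists>(M :: nat monoid) \<phi>. group M \<and> finite (carrier M) \<and> \<phi> \<in> hom G M \<and> \<phi> x \<noteq> \<one>\<^bsub>M\<^esub>))"


section \<open>Subdirect products\<close>

text \<open>The intersections of \<open>G\<close> with the two factors are taken as subsets of \<open>F\<^sub>1\<close> and \<open>F\<^sub>2\<close>,
  through the identification of \<open>F\<^sub>1\<close> with \<open>F\<^sub>1 \<times> {1}\<close> and of \<open>F\<^sub>2\<close> with \<open>{1} \<times> F\<^sub>2\<close>.\<close>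

definition inter_fst ::
  "('a, 'c) monoid_scheme \<Rightarrow> ('b, 'd) monoid_scheme \<Rightarrow> ('a \<times> 'b) set \<Rightarrow> 'a set" where
  "inter_fst F\<^sub>1 F\<^sub>2 G = {x \<in> carrier F\<^sub>1. (x, \<one>\<^bsub>F\<^sub>2\<^esub>) \<in> G}"

definition inter_snd ::
  "('a, 'c) monoid_scheme \<Rightarrow> ('b, 'd) monoid_scheme \<Rightarrow> ('a \<times> 'b) set \<Rightarrow> 'b set" where
  "inter_snd F\<^sub>1 F\<^sub>2 G = {y \<in> carrier F\<^sub>2. (\<one>\<^bsub>F\<^sub>1\<^esub>, y) \<in> G}"

definition subdirect_product ::
  "('a, 'c) monoid_scheme \<Rightarrow> ('b, 'd) monoid_scheme \<Rightarrow> ('a \<times> 'b) set \<Rightarrow> bool" where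
  "subdirect_product F\<^sub>1 F\<^sub>2 G \<longleftrightarrow>
     subgroup G (F\<^sub>1 \<times>\<times> F\<^sub>2) \<and> fst ` G = carrier F\<^sub>1 \<and> snd ` G = carrier F\<^sub>2"

definition full_subdirect_product ::
  "('a, 'c) monoid_scheme \<Rightarrow> ('b, 'd) monoid_scheme \<Rightarrow> ('a \<times> 'b) set \<Rightarrow> bool" where
  "full_subdirect_product F\<^sub>1 F\<^sub>2 G \<longleftrightarrow>
     subdirect_product F\<^sub>1 F\<^sub>2 G \<and>
     inter_fst F\<^sub>1 F\<^sub>2 G \<noteq> {\<one>\<^bsub>F\<^sub>1\<^esub>} \<and> inter_snd F\<^sub>1 F\<^sub>2 G \<noteq> {\<one>\<^bsub>F\<^sub>2\<^esub>}"

end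

(* Put Q = F1/N1 = F2/N2, so that G is the fibre product of F1 and F2 over Q.

   The heart of the matter is a statement about one free group F: given x, y in F and a normal
   subgroup L of p-power index, some finite p-quotient of F has the property that every g which
   conjugates x to y there is congruent modulo L to a true conjugator of x to y. To see this, take
   x = u^a and y = v^b with u, v cyclically reduced and not proper powers, and shrink L until u and
   v trace simple loops in the Cayley graph of F/L. If g x g^-1 and y agree in a large finite
   quotient of F/[L,L], then a common power of them has the same class in the homology of this
   graph, so both loops use the same edges; hence v is a rotation of u and a = b.

   If Q is a residually finite p-group, non-conjugate elements of G whose components are conjugate
   in F1 and F2 differ by an obstruction in Q that avoids a finite set, because centralizers in
   free groups are cyclic and Q is periodic; so the obstruction persists in a finite p-quotient.
   Conversely, let w in G lie over q in Q and choose c, d over q^m that generate their own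
   centralizers. Then (c, d) and (c, w2 d w2^-1) are conjugate in G only if q lies in the group
   generated by q^m. For m = 0 this yields residual finiteness, and for m prime to p, when the two
   elements are conjugate in every finite p-quotient, it forces q to have p-power order. *)

theory Submission
  imports Defs
begin

text \<open>Conjugacy separability of the two factors is not enough: it yields conjugators h1 and h2
  in the factors, but the pair (h1, h2) need not lie in G. The separation statement therefore
  controls the conjugator and not only conjugacy: h1 and h2 stay close to the components of a pair
  in G, which confines the failure of (h1, h2) to lie in G to a prescribed subgroup of p-power
  index.

  Homology can decide conjugacy because nothing cancels. A simple loop labelled by a cyclically
  reduced word never crosses an edge in both directions, so the signed count of its passages through
  an edge that it uses is nonzero. The count is bounded by the length of the path, so it survives
  modulo a power of p that exceeds the lengths involved; the finite p-quotients arise in this way.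
  The rank may be infinite, hence only the finitely many generators occurring in the words are
  counted. The same counting shows that free groups are residually finite p-groups, and this in turn
  provides the subgroups modulo which the loops are simple.\<close>

context group
begin

section \<open>Cosets and normal subgroups of an arbitrary group\<close>

lemma inv_mult_cancel [simp]:
  assumes "x \<in> carrier G" "y \<in> carrier G"
  shows "inv x \<otimes> (x \<otimes> y) = y" and "x \<otimes> (inv x \<otimes> y) = y"
  using assms by (simp_all flip: m_assoc)

lemma mem_rcos_iff:
  assumes "subgroup H G" "x \<in> carrier G" "y \<in> carrier G"
  shows "x \<in> H #> y \<longleftrightarrow> x \<otimes> inv y \<in> H"
  using subgroup.rcos_module[OF assms(1) is_group assms(3,2)] .

lemma rcos_eq_iff:
  assumes "subgroup H G" "x \<in> carrier G" "y \<in> carrier G"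
  shows "H #> x = H #> y \<longleftrightarrow> x \<otimes> inv y \<in> H"
  using mem_rcos_iff[OF assms] repr_independence[OF _ assms(3,1)] rcos_self[OF assms(2,1)]
  by auto

text \<open>Most finite-index claims below go through this criterion: \<open>f\<close> only has to
  tell different cosets apart, and then a chosen preimage of \<open>f x\<close> recovers the coset
  of \<open>x\<close>.\<close>

lemma finite_rcosets_if_finite_image:
  assumes H: "subgroup H G" and fin: "finite (f ` carrier G)"
    and f: "\<And>x y. \<lbrakk>x \<in> carrier G; y \<in> carrier G; f x = f y\<rbrakk> \<Longrightarrow> x \<otimes> inv y \<in> H"
  shows "finite (rcosets H)"
proof -
  have "H #> x = H #> inv_into (carrier G) f (f x)" if "x \<in> carrier G" for x
  proof -
    let ?y = "inv_into (carrier G) f (f x)"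
    have y: "?y \<in> carrier G" "f ?y = f x"
      using that by (auto simp: inv_into_into f_inv_into_f)
    then have "x \<otimes> inv ?y \<in> H" using f that by metis
    then have "x \<in> H #> ?y"
      using y that H by (simp add: mem_rcos_iff)
    then show ?thesis using repr_independence[OF _ y(1) H] by blast
  qed
  then have "rcosets H \<subseteq> (\<lambda>c. H #> inv_into (carrier G) f c) ` f ` carrier G"
    unfolding RCOSETS_def by fastforce
  then show ?thesis using fin finite_surj by blast
qed

lemma normal_conj_mem:
  assumes "N \<lhd> G" "x \<in> carrier G" "n \<in> N"
  shows "x \<otimes> n \<otimes> inv x \<in> N" and "inv x \<otimes> n \<otimes> x \<in> N"
  using assms by (metis inv_closed inv_inv normal_inv_iff)+

lemma normal_mult_inv_commute:
  assumes "L \<lhd> G" "x \<in> carrier G" "y \<in> carrier G"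
  shows "x \<otimes> inv y \<in> L \<longleftrightarrow> inv y \<otimes> x \<in> L"
proof
  assume "x \<otimes> inv y \<in> L"
  then show "inv y \<otimes> x \<in> L" using normal_conj_mem(2)[OF assms(1,3)] assms by (fastforce simp: m_assoc)
next
  assume "inv y \<otimes> x \<in> L"
  then show "x \<otimes> inv y \<in> L" using normal_conj_mem(1)[OF assms(1,3)] assms by (fastforce simp: m_assoc)
qed

lemma mem_rcos_translate:
  assumes "L \<lhd> G" and [simp]: "g \<in> carrier G" "x \<in> carrier G" "y \<in> carrier G"
  shows "g \<otimes> x \<in> L #> (g \<otimes> y) \<longleftrightarrow> inv y \<otimes> x \<in> L"
proof -
  have "g \<otimes> x \<in> L #> (g \<otimes> y) \<longleftrightarrow> (g \<otimes> x) \<otimes> inv (g \<otimes> y) \<in> L"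
    using assms by (intro mem_rcos_iff normal_imp_subgroup) auto
  also have "\<dots> \<longleftrightarrow> inv y \<otimes> x \<in> L"
    using normal_mult_inv_commute[OF assms(1), of "g \<otimes> x" "g \<otimes> y"]
    by (simp add: inv_mult_group m_assoc)
  finally show ?thesis .
qed

lemma normal_congruent_pow:
  assumes N: "N \<lhd> G" and [simp]: "x \<in> carrier G" "y \<in> carrier G" and xy: "inv x \<otimes> y \<in> N"
  shows "inv (x [^] (n::nat)) \<otimes> y [^] n \<in> N"
proof (induction n)
  case 0
  then show ?case using N by (simp add: normal_imp_subgroup subgroup.one_closed)
next
  case (Suc n)
  have "inv x \<otimes> (inv (x [^] n) \<otimes> y [^] n) \<otimes> x \<otimes> (inv x \<otimes> y) \<in> N"
    using subgroup.m_closed[OF normal_imp_subgroup[OF N] normal_conj_mem(2)[OF N _ Suc] xy] by simp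
  then show ?case by (simp add: inv_mult_group m_assoc)
qed

lemma conj_pow:
  assumes "g \<in> carrier G" "x \<in> carrier G"
  shows "(g \<otimes> x \<otimes> inv g) [^] (n::nat) = g \<otimes> x [^] n \<otimes> inv g"
  using assms by (induction n) (simp_all add: m_assoc)

end

section \<open>Normal subgroups with finite \<open>p\<close>-power quotient\<close>

text \<open>For prime \<open>p\<close> this says that the quotient by \<open>L\<close> is a finite
  p-group, without forming the quotient; the exponent condition is easy to pass to subgroups,
  preimages and intersections.\<close>

definition pnormal :: "nat \<Rightarrow> ('a, 'b) monoid_scheme \<Rightarrow> 'a set \<Rightarrow> bool" where
  "pnormal p G L \<longleftrightarrow> L \<lhd> G \<and> finite (rcosets\<^bsub>G\<^esub> L) \<and>
     (\<forall>g \<in> carrier G. \<exists>n::nat. g [^]\<^bsub>G\<^esub> (p ^ n) \<in> L)"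

context group
begin

lemma pnormal_imp_normal: "pnormal p G L \<Longrightarrow> L \<lhd> G"
  and pnormal_imp_subgroup: "pnormal p G L \<Longrightarrow> subgroup L G"
  by (simp_all add: pnormal_def normal_imp_subgroup)

lemma pow_dvd_mem:
  assumes "subgroup L G" "g \<in> carrier G" "g [^] (m::nat) \<in> L" "m dvd n"
  shows "g [^] n \<in> L"
proof -
  obtain k where "n = m * k" using assms(4) by auto
  moreover have "(g [^] m) [^] k \<in> L"
    using assms(1,3) by (induction k) (simp_all add: subgroup.one_closed subgroup.m_closed)
  ultimately show ?thesis using assms(2) by (simp add: nat_pow_pow)
qed

lemma pnormal_pow_ge:
  assumes "pnormal p G L" "g \<in> carrier G"
  obtains n0 where "\<And>n. n \<ge> n0 \<Longrightarrow> g [^] (p ^ n) \<in> L"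
proof -
  obtain n0 :: nat where "g [^] (p ^ n0) \<in> L" using assms by (auto simp: pnormal_def)
  then show ?thesis using that pow_dvd_mem[OF pnormal_imp_subgroup] assms le_imp_power_dvd by blast
qed

lemma pnormal_carrier: "pnormal p G (carrier G)"
proof -
  have "carrier G \<lhd> G" by (simp add: normal_inv_iff subgroup_self)
  moreover have "finite (rcosets (carrier G))"
    by (rule finite_rcosets_if_finite_image[where f="\<lambda>_. ()"]) (auto simp: subgroup_self)
  ultimately show ?thesis by (auto simp: pnormal_def)
qed

lemma pnormal_Int:
  assumes "pnormal p G K" "pnormal p G L"
  shows "pnormal p G (K \<inter> L)"
proof -
  have KL: "subgroup K G" "subgroup L G" using assms pnormal_imp_subgroup by auto
  then have KL': "subgroup (K \<inter> L) G" by (simp add: subgroups_Inter_pair)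
  then have "K \<inter> L \<lhd> G"
    using assms by (auto simp: normal_inv_iff pnormal_def)
  moreover have "finite (rcosets (K \<inter> L))"
  proof (rule finite_rcosets_if_finite_image[OF KL', of "\<lambda>x. (K #> x, L #> x)"])
    have "(\<lambda>x. (K #> x, L #> x)) ` carrier G \<subseteq> (rcosets K) \<times> (rcosets L)"
      by (auto simp: RCOSETS_def)
    then show "finite ((\<lambda>x. (K #> x, L #> x)) ` carrier G)"
      using assms by (meson finite_SigmaI finite_subset pnormal_def)
  qed (use KL rcos_eq_iff in auto)
  moreover have "\<exists>n::nat. g [^] (p ^ n) \<in> K \<inter> L" if g: "g \<in> carrier G" for g
  proof -
    obtain k l where "\<And>n. n \<ge> k \<Longrightarrow> g [^] (p ^ n) \<in> K" "\<And>n. n \<ge> l \<Longrightarrow> g [^] (p ^ n) \<in> L"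
      using pnormal_pow_ge assms g by metis
    then have "g [^] (p ^ (max k l)) \<in> K \<inter> L" by simp
    then show ?thesis by blast
  qed
  ultimately show ?thesis by (simp add: pnormal_def)
qed

text \<open>One p-power quotient can thus meet finitely many separation demands at once. The factor
  \<open>carrier G\<close> gives the empty family its proper value.\<close>

lemma pnormal_INT:
  assumes "finite I" "\<And>i. i \<in> I \<Longrightarrow> pnormal p G (L i)"
  shows "pnormal p G (carrier G \<inter> (\<Inter>i \<in> I. L i))"
  using assms
proof (induction I)
  case (insert j I)
  then have "pnormal p G (L j \<inter> (carrier G \<inter> (\<Inter>i \<in> I. L i)))"
    by (simp add: pnormal_Int)
  then show ?case by (simp add: Int_left_commute Int_assoc)
qed (simp add: pnormal_carrier)

lemma pnormal_pow_ge2: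
  assumes "pnormal p G L" "pnormal p G K" "g \<in> carrier G" "h \<in> carrier G"
  obtains N where "\<And>n. n \<ge> N \<Longrightarrow> g [^] (p ^ n) \<in> L" "\<And>n. n \<ge> N \<Longrightarrow> h [^] (p ^ n) \<in> K"
proof -
  obtain k l where "\<And>n. n \<ge> k \<Longrightarrow> g [^] (p ^ n) \<in> L" "\<And>n. n \<ge> l \<Longrightarrow> h [^] (p ^ n) \<in> K"
    using pnormal_pow_ge assms by metis
  then show ?thesis using that[of "max k l"] by simp
qed

end

section \<open>Words in a free group\<close>

definition linv :: "'a \<times> bool \<Rightarrow> 'a \<times> bool" where
  "linv l = (fst l, \<not> snd l)"

definition winv :: "('a \<times> bool) list \<Rightarrow> ('a \<times> bool) list" where
  "winv w = rev (map linv w)"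

abbreviation reduced :: "('a \<times> bool) list \<Rightarrow> bool" where
  "reduced \<equiv> successively (\<lambda>k l. l \<noteq> linv k)"

lemma linv_linv [simp]: "linv (linv l) = l"
  and fst_linv [simp]: "fst (linv l) = fst l"
  and snd_linv [simp]: "snd (linv l) = (\<not> snd l)"
  and linv_neq [simp]: "linv l \<noteq> l" "l \<noteq> linv l"
  and linv_eq_iff [simp]: "linv k = linv l \<longleftrightarrow> k = l"
  by (auto simp: linv_def prod_eq_iff)

lemma linv_swap: "k = linv l \<longleftrightarrow> l = linv k"
  by auto

lemma linv_mem_iff [simp]: "linv l \<in> A \<times> UNIV \<longleftrightarrow> l \<in> A \<times> UNIV"
  by (simp add: linv_def mem_Times_iff)

lemma winv_simps [simp]:
  "winv [] = []" "winv (u @ v) = winv v @ winv u" "winv (winv u) = u" "length (winv u) = length u"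
  "winv u = [] \<longleftrightarrow> u = []" "winv (l # u) = winv u @ [linv l]"
  by (simp_all add: winv_def rev_map comp_def)

lemma hd_winv: "u \<noteq> [] \<Longrightarrow> hd (winv u) = linv (last u)"
  and last_winv: "u \<noteq> [] \<Longrightarrow> last (winv u) = linv (hd u)"
  by (simp_all add: winv_def hd_rev last_rev last_map hd_map)

lemma winv_mem [simp]: "winv u \<in> lists (A \<times> UNIV) \<longleftrightarrow> u \<in> lists (A \<times> UNIV)"
  unfolding in_lists_conv_set winv_def set_rev set_map
  by (simp only: ball_simps linv_mem_iff)

lemma reduced_winv [simp]: "reduced (winv u) \<longleftrightarrow> reduced u"
  unfolding winv_def successively_rev successively_map
  by (rule successively_cong) auto

lemma reduced_words_eq: "reduced_words A = {w \<in> lists (A \<times> UNIV). reduced w}"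
proof -
  have "(\<lambda>k l. \<not> (fst k = fst l \<and> snd k \<noteq> snd l)) = (\<lambda>(k::'a \<times> bool) l. l \<noteq> linv k)"
    by (auto simp: fun_eq_iff linv_def prod_eq_iff)
  then show ?thesis by (simp only: reduced_words_def)
qed

lemma not_successivelyE:
  assumes "\<not> successively P w"
  obtains u k l v where "w = u @ k # l # v" "\<not> P k l"
proof -
  obtain i where i: "Suc i < length w" "\<not> P (w ! i) (w ! Suc i)"
    using assms by (auto simp: successively_conv_nth)
  then have "w = take i w @ w ! i # w ! Suc i # drop (Suc (Suc i)) w"
    by (simp add: Cons_nth_drop_Suc)
  then show ?thesis using that i(2) by metis
qed

locale based_free_group = group F for F :: "('a, 'b) monoid_scheme" (structure) +
  fixes S :: "'a set"
  assumes basis: "free_basis F S"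
begin

abbreviation words :: "('a \<times> bool) list set" where "words \<equiv> lists (S \<times> UNIV)"
abbreviation val :: "('a \<times> bool) list \<Rightarrow> 'a" where "val \<equiv> word_val F"
abbreviation lval :: "'a \<times> bool \<Rightarrow> 'a" where "lval \<equiv> letter_val F"

lemma lval_closed [simp]: "l \<in> S \<times> UNIV \<Longrightarrow> lval l \<in> carrier F"
  using basis by (auto simp: free_basis_def letter_val_def)

lemma lval_linv: "l \<in> S \<times> UNIV \<Longrightarrow> lval (linv l) = inv (lval l)"
  using basis by (auto simp: free_basis_def letter_val_def)

lemma val_Nil [simp]: "val [] = \<one>"
  and val_Cons [simp]: "val (l # w) = lval l \<otimes> val w"
  by (simp_all add: word_val_def)

lemma val_closed [simp]: "w \<in> words \<Longrightarrow> val w \<in> carrier F"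
  by (induction w) auto

lemma val_append: "u \<in> words \<Longrightarrow> v \<in> words \<Longrightarrow> val (u @ v) = val u \<otimes> val v"
  by (induction u) (auto simp: m_assoc)

lemma val_winv: "u \<in> words \<Longrightarrow> val (winv u) = inv (val u)"
  by (induction u) (auto simp: val_append lval_linv inv_mult_group)

lemma val_replicate: "u \<in> words \<Longrightarrow> val (concat (replicate n u)) = val u [^] n"
proof (induction n)
  case (Suc n)
  then have "concat (replicate n u) \<in> words" by (induction n) auto
  then show ?case using Suc nat_pow_Suc2[of "val u" n] by (simp add: val_append)
qed simp

text \<open>Deleting adjacent inverse letters shortens the word, so the process stops. The invariant
  \<Phi> is carried along so that one induction serves both the length argument of
  \<open>shortest_imp_reduced\<close> and every function on words that ignores such
  deletions.\<close>

lemma free_reduction: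
  assumes \<Phi>: "\<And>u l v. \<lbrakk>u \<in> words; l \<in> S \<times> UNIV; v \<in> words\<rbrakk> \<Longrightarrow> \<Phi> (u @ l # linv l # v) = \<Phi> (u @ v)"
    and "w \<in> words"
  shows "\<exists>r \<in> words. reduced r \<and> val r = val w \<and> \<Phi> r = \<Phi> w \<and> (r = w \<or> length r < length w)"
  using \<open>w \<in> words\<close>
proof (induction "length w" arbitrary: w rule: less_induct)
  case less
  show ?case
  proof (cases "reduced w")
    case False
    obtain u k l v where "w = u @ k # l # v" "\<not> l \<noteq> linv k"
      by (rule not_successivelyE[OF False])
    then have w: "w = u @ k # linv k # v" by simp
    then have uv: "u \<in> words" "k \<in> S \<times> UNIV" "v \<in> words" using less.prems by auto
    then have "u @ v \<in> words" "length (u @ v) < length w" by (simp_all add: w)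
    then obtain r where "r \<in> words" "reduced r" "val r = val (u @ v)" "\<Phi> r = \<Phi> (u @ v)"
      "r = u @ v \<or> length r < length (u @ v)"
      using less.hyps by meson
    moreover have "val w = val (u @ v)"
    proof -
      have "val w = val u \<otimes> (lval k \<otimes> (inv (lval k) \<otimes> val v))"
        using uv less.prems unfolding w by (simp add: val_append lval_linv)
      then show ?thesis using uv by (simp add: val_append)
    qed
    moreover have "\<Phi> w = \<Phi> (u @ v)" unfolding w using uv by (rule \<Phi>)
    ultimately show ?thesis by (intro bexI[of _ r]) (auto simp: w)
  qed (use less.prems in blast)
qed

lemma reduced_eqI: "\<lbrakk>u \<in> words; v \<in> words; reduced u; reduced v; val u = val v\<rbrakk> \<Longrightarrow> u = v"
  using basis by (auto simp: free_basis_def bij_betw_def reduced_words_eq dest: inj_onD)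

lemma ex_reduced:
  assumes "x \<in> carrier F"
  obtains w where "w \<in> words" "reduced w" "val w = x"
proof -
  have "x \<in> val ` {w \<in> words. reduced w}"
    using assms basis by (simp add: free_basis_def bij_betw_def reduced_words_eq)
  then show ?thesis using that by blast
qed

text \<open>Both words reduce to the same word, since a value has only one reduced form. This plays
  the part of the universal property: a function on words that ignores cancelling pairs descends to
  \<open>F\<close>.\<close>

lemma val_eq_imp_invariant_eq:
  assumes \<Phi>: "\<And>u l v. \<lbrakk>u \<in> words; l \<in> S \<times> UNIV; v \<in> words\<rbrakk> \<Longrightarrow> \<Phi> (u @ l # linv l # v) = \<Phi> (u @ v)"
    and "u \<in> words" "v \<in> words" "val u = val v"
  shows "\<Phi> u = \<Phi> v"
proof -
  obtain r where r: "r \<in> words" "reduced r" "val r = val u" "\<Phi> r = \<Phi> u"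
    using free_reduction[of \<Phi>, OF \<Phi> \<open>u \<in> words\<close>] by blast
  obtain s where s: "s \<in> words" "reduced s" "val s = val v" "\<Phi> s = \<Phi> v"
    using free_reduction[of \<Phi>, OF \<Phi> \<open>v \<in> words\<close>] by blast
  have "r = s" using r s assms(4) by (intro reduced_eqI) simp_all
  then show ?thesis using r s by simp
qed

text \<open>An unreduced \<open>v\<close> would reduce to a strictly shorter word, yet that word is
  \<open>u\<close>.\<close>

lemma shortest_imp_reduced:
  assumes "u \<in> words" "reduced u" "v \<in> words" "val v = val u" "length v \<le> length u"
  shows "v = u"
proof -
  obtain r where "r \<in> words" "reduced r" "val r = val v" "r = v \<or> length r < length v"
    using free_reduction[of "\<lambda>_. ()" v] assms(3) by auto
  moreover from this have "r = u" using assms by (intro reduced_eqI) simp_all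
  ultimately show ?thesis using assms(5) by auto
qed

subsection \<open>Commuting elements\<close>

text \<open>If \<open>g @ w\<close> has no cancellation, it is the reduced form of
  \<open>w @ g\<close>, a word of equal length, so the two agree. If it has, then \<open>g\<close>
  ends in the inverse of the first letter of \<open>w\<close>, and since \<open>w\<close> is
  cyclically reduced, \<open>g\<close> does not cancel against \<open>winv w\<close>.\<close>

lemma commute_imp_words_commute:
  assumes g: "g \<in> words" "reduced g" and w: "w \<in> words" "w \<noteq> []" "reduced (w @ w)"
    and comm: "val g \<otimes> val w = val w \<otimes> val g"
  shows "g @ w = w @ g \<or> g @ winv w = winv w @ g"
proof -
  have *: "g @ w' = w' @ g"
    if w': "w' \<in> words" "reduced (g @ w')" "val g \<otimes> val w' = val w' \<otimes> val g" for w'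
    using shortest_imp_reduced[of "g @ w'" "w' @ g"] that g by (simp add: val_append)
  show ?thesis
  proof (cases "reduced (g @ w)")
    case True
    then show ?thesis using * w comm by blast
  next
    case False
    have red: "reduced w" "hd w \<noteq> linv (last w)"
      using w by (auto simp: successively_append_iff)
    then have "g \<noteq> []" "hd w = linv (last g)"
      using False g by (auto simp: successively_append_iff)
    then have "hd (winv w) \<noteq> linv (last g)"
      using red w by (metis hd_winv linv_linv)
    then have "reduced (g @ winv w)"
      using red(1) g(2) by (subst successively_append_iff) simp
    moreover have "val g \<otimes> val (winv w) = val (winv w) \<otimes> val g"
    proof -
      have c: "val g \<in> carrier F" "val w \<in> carrier F" using g w by auto
      then have "inv (val w) \<otimes> (val g \<otimes> val w) \<otimes> inv (val w)
        = inv (val w) \<otimes> (val w \<otimes> val g) \<otimes> inv (val w)" using comm by simp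
      then show ?thesis using c w by (simp add: val_winv m_assoc)
    qed
    ultimately show ?thesis using * w by simp
  qed
qed

end

definition primitive :: "'c list \<Rightarrow> bool" where
  "primitive u \<longleftrightarrow> u \<noteq> [] \<and> (\<forall>z n. u = concat (replicate n z) \<longrightarrow> n = 1)"

lemma primitive_commute:
  assumes "primitive u" "g @ u = u @ g"
  shows "\<exists>m. g = concat (replicate m u)"
proof -
  obtain m n z where "concat (replicate m z) = g" "concat (replicate n z) = u"
    using comm_append_are_replicate[OF assms(2)] by blast
  moreover from this have "n = 1" using assms(1) by (auto simp: primitive_def)
  ultimately show ?thesis by auto
qed

lemma winv_replicate: "winv (concat (replicate n u)) = concat (replicate n (winv u))"
proof (induction n)
  case (Suc n)
  have "concat (replicate n (winv u)) @ winv u = concat (replicate (n + 1) (winv u))"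
    by (subst replicate_add) simp
  then show ?case using Suc by simp
qed simp

lemma primitive_winv:
  assumes "primitive u" shows "primitive (winv u)"
  unfolding primitive_def
proof (intro conjI allI impI)
  fix z n assume "winv u = concat (replicate n z)"
  then have "u = concat (replicate n (winv z))" using winv_replicate by (metis winv_simps(3))
  then show "n = 1" using assms by (auto simp: primitive_def)
qed (use assms in \<open>simp add: primitive_def\<close>)

lemma ex_primitive_root:
  assumes "w \<noteq> []"
  obtains u n where "primitive u" "n > 0" "w = concat (replicate n u)"
proof -
  have "\<exists>u n. primitive u \<and> n > 0 \<and> w = concat (replicate n u)"
    using assms
  proof (induction "length w" arbitrary: w rule: less_induct)
    case less
    show ?case
    proof (cases "primitive w")
      case True
      then show ?thesis by (intro exI[of _ w] exI[of _ 1]) simp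
    next
      case False
      then obtain z n where z: "w = concat (replicate n z)" "n \<noteq> 1"
        using less.prems by (auto simp: primitive_def)
      then have nz: "n \<noteq> 0" "z \<noteq> []" using less.prems by auto
      then have "length z < length w" using z by (auto simp: length_concat sum_list_replicate)
      then obtain u m where u: "primitive u" "m > 0" "z = concat (replicate m u)"
        using less.hyps nz by blast
      have "concat (replicate n (concat (replicate m u))) = concat (replicate (n * m) u)"
        by (induction n) (simp_all add: replicate_add)
      then show ?thesis using u z nz by (intro exI[of _ u] exI[of _ "n * m"]) auto
    qed
  qed
  then show ?thesis using that by blast
qed

context based_free_group
begin

text \<open>Commuting words are powers of a common word, here of \<open>u\<close> or of
  \<open>winv u\<close> by primitivity; the second case accounts for the negative exponents.\<close>

lemma centralizer_primitive:
  assumes u: "u \<in> words" "primitive u" "reduced (u @ u)"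
    and g: "g \<in> carrier F" "g \<otimes> val u = val u \<otimes> g"
  obtains k :: int where "g = val u [^] k"
proof -
  obtain w where w: "w \<in> words" "reduced w" "val w = g" using ex_reduced g by metis
  then consider "w @ u = u @ w" | "w @ winv u = winv u @ w"
    using commute_imp_words_commute[of w u] u g by (auto simp: primitive_def)
  then show thesis
  proof cases
    case 1
    then obtain m where "w = concat (replicate m u)" using primitive_commute u by blast
    then have "g = val u [^] int m" using u w by (simp add: val_replicate int_pow_int)
    then show ?thesis by (rule that)
  next
    case 2
    then obtain m where "w = concat (replicate m (winv u))"
      using primitive_commute primitive_winv u by blast
    then have "g = val u [^] (- int m)"
      using u w by (auto simp: val_replicate val_winv int_pow_neg int_pow_int nat_pow_inv)
    then show ?thesis by (rule that)
  qed
qed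

lemma reduced_conjE:
  assumes "reduced w" "\<not> reduced (w @ w)"
  obtains l v where "w = l # v @ [linv l]" "v \<noteq> []" "reduced v"
proof -
  have w: "w \<noteq> []" "hd w = linv (last w)"
    using assms by (auto simp: successively_append_iff)
  obtain l v' where wl: "w = l # v'" using w by (cases w) auto
  with w have "v' \<noteq> []" by auto
  then obtain v k where "v' = v @ [k]" by (metis rev_exhaust)
  then have "w = l # v @ [linv l]" using wl w by simp
  then show ?thesis using that[of l v] assms(1)
    by (cases "v = []") (auto simp: successively_append_iff successively_Cons)
qed

lemma val_conj_word:
  assumes "l # v @ [linv l] \<in> words"
  shows "val (l # v @ [linv l]) = lval l \<otimes> val v \<otimes> inv (lval l)"
  using assms by (simp add: val_append lval_linv m_assoc)

lemma ex_cyclically_reduced: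
  assumes "x \<in> carrier F"
  obtains g w where "g \<in> carrier F" "w \<in> words" "reduced (w @ w)" "x = g \<otimes> val w \<otimes> inv g"
proof -
  have "\<exists>g w'. g \<in> carrier F \<and> w' \<in> words \<and> reduced (w' @ w') \<and> val w = g \<otimes> val w' \<otimes> inv g"
    if "w \<in> words" "reduced w" for w
    using that
  proof (induction "length w" arbitrary: w rule: less_induct)
    case less
    show ?case
    proof (cases "reduced (w @ w)")
      case True
      then show ?thesis using less.prems by (intro exI[of _ \<one>] exI[of _ w]) simp
    next
      case False
      then obtain l v where wv: "w = l # v @ [linv l]" and rv: "reduced v"
        using reduced_conjE less.prems by metis
      have v: "v \<in> words" "l \<in> S \<times> UNIV" using less.prems by (auto simp: wv)
      then obtain g w' where g: "g \<in> carrier F" "w' \<in> words" "reduced (w' @ w')"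
        "val v = g \<otimes> val w' \<otimes> inv g"
        using less.hyps[of v] wv rv by auto
      have "val w = lval l \<otimes> val v \<otimes> inv (lval l)"
        using less.prems unfolding wv by (intro val_conj_word) simp
      also have "\<dots> = (lval l \<otimes> g) \<otimes> val w' \<otimes> inv (lval l \<otimes> g)"
        using g v by (simp add: m_assoc inv_mult_group)
      finally show ?thesis using g v
        by (intro exI[of _ "lval l \<otimes> g"] exI[of _ w']) simp
    qed
  qed
  moreover obtain w where "w \<in> words" "reduced w" "val w = x" using ex_reduced[OF assms] .
  ultimately show ?thesis using that by blast
qed

end

section \<open>Periodic words\<close>

text \<open>For nonempty \<open>u\<close> this is the prefix of length \<open>n\<close> of the
  infinite word u u u ...; the values of these prefixes are the vertices visited by a path along
  powers of \<open>u\<close>.\<close>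

definition per :: "'c list \<Rightarrow> nat \<Rightarrow> 'c list" where
  "per u n = map (\<lambda>i. u ! (i mod length u)) [0..<n]"

lemma length_per [simp]: "length (per u n) = n"
  and nth_per [simp]: "i < n \<Longrightarrow> per u n ! i = u ! (i mod length u)"
  and take_per: "i \<le> n \<Longrightarrow> take i (per u n) = per u i"
  and per_0 [simp]: "per u 0 = []"
  and per_Suc: "per u (Suc n) = per u n @ [u ! (n mod length u)]"
  by (simp_all add: per_def take_map)

lemma per_add: "per u (k * length u + n) = per u (k * length u) @ per u n"
proof (rule nth_equalityI)
  fix i assume "i < length (per u (k * length u + n))"
  moreover have "i mod length u = (i - k * length u) mod length u" if "k * length u \<le> i"
    using mod_mult_self3[of k "length u" "i - k * length u"] that by simp
  ultimately show "per u (k * length u + n) ! i = (per u (k * length u) @ per u n) ! i"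
    by (auto simp: nth_append)
qed simp

lemma per_length_self: "per u (length u) = u"
  by (rule nth_equalityI) simp_all

lemma per_mult: "per u (k * length u) = concat (replicate k u)"
proof (induction k)
  case (Suc k)
  have "per u (Suc k * length u) = per u (1 * length u + k * length u)" by simp
  also have "\<dots> = u @ per u (k * length u)" by (subst per_add) (simp add: per_length_self)
  finally show ?case using Suc by simp
qed simp

lemma nth_mod_mem:
  assumes "u \<noteq> []" "u \<in> lists A" shows "u ! (i mod length u) \<in> A"
  using assms by (auto simp: in_lists_conv_set)

lemma per_in_lists: "u \<noteq> [] \<Longrightarrow> u \<in> lists A \<Longrightarrow> per u n \<in> lists A"
  using nth_mod_mem by (fastforce simp: per_def)

lemma cyclically_reduced_nth:
  assumes "u \<noteq> []" "reduced (u @ u)"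
  shows "u ! (Suc i mod length u) \<noteq> linv (u ! (i mod length u))"
proof -
  let ?r = "i mod length u"
  have r: "?r < length u" using assms by simp
  then have "(u @ u) ! Suc ?r \<noteq> linv ((u @ u) ! ?r)"
    by (intro successively_nth[OF assms(2)]) simp
  moreover have "(u @ u) ! Suc ?r = u ! (Suc i mod length u)"
    using r by (cases "Suc ?r = length u") (auto simp: nth_append mod_Suc)
  ultimately show ?thesis using r by (simp add: nth_append)
qed

lemma reduced_per:
  assumes "u \<noteq> []" "reduced (u @ u)"
  shows "reduced (per u n)"
  using cyclically_reduced_nth[OF assms] by (simp add: successively_conv_nth)

section \<open>Weights of paths in the Cayley graph\<close>

text \<open>A weight \<open>\<chi> g s\<close> is attached to the edge from \<open>g\<close> to \<open>g \<otimes> s\<close>;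
  edges traversed backwards count negatively. The total weight of a path is the Fox derivative
  of its word, paired with \<open>\<chi>\<close>.\<close>

context based_free_group
begin

definition edge_wt :: "('a \<Rightarrow> 'a \<Rightarrow> int) \<Rightarrow> 'a \<Rightarrow> 'a \<times> bool \<Rightarrow> int" where
  "edge_wt \<chi> g l = (if snd l then \<chi> g (fst l) else - \<chi> (g \<otimes> lval l) (fst l))"

primrec word_wt :: "('a \<Rightarrow> 'a \<Rightarrow> int) \<Rightarrow> 'a \<Rightarrow> ('a \<times> bool) list \<Rightarrow> int" where
  "word_wt \<chi> g [] = 0"
| "word_wt \<chi> g (l # w) = edge_wt \<chi> g l + word_wt \<chi> (g \<otimes> lval l) w"

text \<open>For \<open>g\<close> in the carrier the choice of the word does not matter, by
  \<open>word_wt_cong_val\<close>.\<close>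

definition path_wt :: "('a \<Rightarrow> 'a \<Rightarrow> int) \<Rightarrow> 'a \<Rightarrow> 'a \<Rightarrow> int" where
  "path_wt \<chi> g x = word_wt \<chi> g (SOME w. w \<in> words \<and> val w = x)"

lemma word_wt_append:
  "\<lbrakk>g \<in> carrier F; u \<in> words; v \<in> words\<rbrakk>
    \<Longrightarrow> word_wt \<chi> g (u @ v) = word_wt \<chi> g u + word_wt \<chi> (g \<otimes> val u) v"
  by (induction u arbitrary: g) (auto simp: m_assoc)

lemma edge_wt_linv:
  "\<lbrakk>g \<in> carrier F; l \<in> S \<times> UNIV\<rbrakk> \<Longrightarrow> edge_wt \<chi> (g \<otimes> lval l) (linv l) = - edge_wt \<chi> g l"
  by (auto simp: edge_wt_def lval_linv m_assoc)

text \<open>Walking along an edge and straight back contributes zero, so inserting a cancelling pair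
  leaves the weight unchanged.\<close>

lemma word_wt_cong_val:
  assumes "g \<in> carrier F" "u \<in> words" "v \<in> words" "val u = val v"
  shows "word_wt \<chi> g u = word_wt \<chi> g v"
proof (rule val_eq_imp_invariant_eq[of "word_wt \<chi> g", OF _ assms(2-4)])
  fix u v and l :: "'a \<times> bool" assume uv: "u \<in> words" "l \<in> S \<times> UNIV" "v \<in> words"
  then have "l # linv l # v \<in> words" by (simp del: mem_Sigma_iff)
  with uv show "word_wt \<chi> g (u @ l # linv l # v) = word_wt \<chi> g (u @ v)"
    using edge_wt_linv[of "g \<otimes> val u" l \<chi>] assms(1)
    by (simp add: word_wt_append lval_linv m_assoc del: mem_Sigma_iff)
qed

lemma path_wt_val:
  assumes "g \<in> carrier F" "w \<in> words"
  shows "path_wt \<chi> g (val w) = word_wt \<chi> g w"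
proof -
  let ?w = "SOME w'. w' \<in> words \<and> val w' = val w"
  have "?w \<in> words \<and> val ?w = val w" by (rule someI[of _ w]) (use assms in auto)
  then show ?thesis unfolding path_wt_def using assms word_wt_cong_val by blast
qed

text \<open>The product rule of Fox calculus: the second factor is read from the vertex where the
  first one ends.\<close>

lemma path_wt_mult:
  assumes "g \<in> carrier F" "x \<in> carrier F" "y \<in> carrier F"
  shows "path_wt \<chi> g (x \<otimes> y) = path_wt \<chi> g x + path_wt \<chi> (g \<otimes> x) y"
proof -
  obtain u v where uv: "u \<in> words" "val u = x" "v \<in> words" "val v = y"
    using ex_reduced assms by metis
  then have "path_wt \<chi> g (val (u @ v)) = path_wt \<chi> g (val u) + path_wt \<chi> (g \<otimes> val u) (val v)"
    using assms by (subst (1 2 3) path_wt_val) (simp_all add: word_wt_append)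
  then show ?thesis using uv by (simp add: val_append)
qed

lemma path_wt_one [simp]: "g \<in> carrier F \<Longrightarrow> path_wt \<chi> g \<one> = 0"
  using path_wt_mult[of g \<one> \<one> \<chi>] by simp

lemma path_wt_inv:
  assumes "g \<in> carrier F" "x \<in> carrier F"
  shows "path_wt \<chi> g (inv x) = - path_wt \<chi> (g \<otimes> inv x) x"
  using path_wt_mult[of g "inv x" x \<chi>] assms by simp

lemma word_wt_sum:
  assumes "g \<in> carrier F" "w \<in> words"
  shows "word_wt \<chi> g w = (\<Sum>i<length w. edge_wt \<chi> (g \<otimes> val (take i w)) (w ! i))"
  using assms(2)
proof (induction w rule: rev_induct)
  case (snoc l w)
  have "(\<Sum>i<length w. edge_wt \<chi> (g \<otimes> val (take i (w @ [l]))) ((w @ [l]) ! i))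
      = (\<Sum>i<length w. edge_wt \<chi> (g \<otimes> val (take i w)) (w ! i))"
    by (rule sum.cong) (auto simp: nth_append)
  then show ?case using snoc assms by (simp add: word_wt_append)
qed simp

text \<open>For normal \<open>L\<close> these are the edge weights of the Cayley graph of F/L,
  lifted to its covering tree, the Cayley graph of \<open>F\<close>.\<close>

definition invariant_under :: "'a set \<Rightarrow> ('a \<Rightarrow> 'a \<Rightarrow> int) \<Rightarrow> bool" where
  "invariant_under L \<chi> \<longleftrightarrow> (\<forall>n \<in> L. \<forall>g \<in> carrier F. \<chi> (n \<otimes> g) = \<chi> g)"

lemma path_wt_invariant:
  assumes \<chi>: "invariant_under L \<chi>" and L: "L \<lhd> F" "n \<in> L" and g: "g \<in> carrier F" and x: "x \<in> carrier F"
  shows "path_wt \<chi> (n \<otimes> g) x = path_wt \<chi> g x"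
proof -
  have n: "n \<in> carrier F" using L normal_imp_subgroup subgroup.mem_carrier by metis
  obtain w where w: "w \<in> words" "val w = x" using ex_reduced x by metis
  have "word_wt \<chi> (n \<otimes> g) w = word_wt \<chi> g w"
    using w(1) g
  proof (induction w arbitrary: g)
    case (Cons l w)
    then have l: "l \<in> S \<times> UNIV" "w \<in> words" by auto
    have "edge_wt \<chi> (n \<otimes> g) l = edge_wt \<chi> g l"
      using \<chi> L n l Cons.prems by (simp add: edge_wt_def invariant_under_def m_assoc del: mem_Sigma_iff)
    then show ?case using Cons l n by (simp add: m_assoc del: mem_Sigma_iff)
  qed simp
  then show ?thesis using w n g by (auto simp flip: path_wt_val)
qed

lemma path_wt_invariant':
  assumes "invariant_under L \<chi>" "L \<lhd> F" "g \<in> carrier F" "h \<in> carrier F" "g \<otimes> inv h \<in> L" "x \<in> carrier F"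
  shows "path_wt \<chi> g x = path_wt \<chi> h x"
  using path_wt_invariant[OF assms(1,2,5,4,6)] assms by (simp add: m_assoc)

text \<open>Since \<open>z\<close> closes up modulo \<open>L\<close>, the way out along
  \<open>h\<close> and the way back cross the same edges of the quotient graph and cancel.\<close>

lemma path_wt_conj:
  assumes \<chi>: "invariant_under L \<chi>" and L: "L \<lhd> F" "z \<in> L" and g: "g \<in> carrier F" "h \<in> carrier F"
  shows "path_wt \<chi> g (h \<otimes> z \<otimes> inv h) = path_wt \<chi> (g \<otimes> h) z"
proof -
  have z: "z \<in> carrier F" using L normal_imp_subgroup subgroup.mem_carrier by metis
  have "g \<otimes> (h \<otimes> z \<otimes> inv h) \<otimes> inv g \<in> L"
    using normal_conj_mem(1) L g by simp
  then have "path_wt \<chi> (g \<otimes> h \<otimes> z \<otimes> inv h) h = path_wt \<chi> g h"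
    using g z by (intro path_wt_invariant'[OF \<chi> L(1)]) (simp_all add: m_assoc)
  then show ?thesis using g z by (simp add: path_wt_mult path_wt_inv m_assoc)
qed

lemma path_wt_pow:
  assumes \<chi>: "invariant_under L \<chi>" and L: "L \<lhd> F" "z \<in> L" and g: "g \<in> carrier F"
  shows "path_wt \<chi> g (z [^] n) = int n * path_wt \<chi> g z"
proof (induction n)
  case (Suc n)
  have z: "z \<in> carrier F" using L normal_imp_subgroup subgroup.mem_carrier by metis
  have "z [^] n \<in> L"
    using pow_dvd_mem[OF normal_imp_subgroup[OF L(1)] z, of 1 n] L z by simp
  then have "path_wt \<chi> (g \<otimes> z [^] n) z = path_wt \<chi> g z"
    using g z L by (intro path_wt_invariant'[OF \<chi> L(1)]) (simp_all add: normal_conj_mem)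
  then show ?case using g z Suc by (simp add: path_wt_mult algebra_simps)
qed (use g in simp)

text \<open>When \<open>A\<close> is a coset of \<open>L\<close>, this is the indicator of a single
  edge of the Cayley graph of F/L, the one labelled \<open>s\<close> that starts at the vertex
  \<open>A\<close>.\<close>

definition edge :: "'a set \<Rightarrow> 'a \<Rightarrow> 'a \<Rightarrow> 'a \<Rightarrow> int" where
  "edge A s g t = of_bool (g \<in> A \<and> t = s)"

lemma edge_wt_edge:
  "edge_wt (edge A s) g l =
    (if fst l \<noteq> s then 0 else if snd l then of_bool (g \<in> A) else - of_bool (g \<otimes> lval l \<in> A))"
  by (simp add: edge_wt_def edge_def)

lemma edge_invariant:
  assumes L: "L \<lhd> F" and a: "A \<in> rcosets L"
  shows "invariant_under L (edge A s)"
proof -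
  obtain a where a: "a \<in> carrier F" "A = L #> a" using a by (auto simp: RCOSETS_def)
  have sg: "subgroup L F" using L normal_imp_subgroup by auto
  have "n \<otimes> g \<in> L #> a \<longleftrightarrow> g \<in> L #> a" if n: "n \<in> L" and g: "g \<in> carrier F" for n g
  proof -
    have nc: "n \<in> carrier F" using n sg subgroup.mem_carrier by metis
    have "n \<otimes> (g \<otimes> inv a) \<in> L \<longleftrightarrow> g \<otimes> inv a \<in> L"
    proof
      assume "n \<otimes> (g \<otimes> inv a) \<in> L"
      then have "inv n \<otimes> (n \<otimes> (g \<otimes> inv a)) \<in> L"
        using n sg by (simp add: subgroup.m_closed subgroup.m_inv_closed)
      then show "g \<otimes> inv a \<in> L" using nc g a by simp
    qed (use n sg in \<open>simp add: subgroup.m_closed\<close>)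
    then show ?thesis using nc g a by (simp add: mem_rcos_iff[OF sg] m_assoc)
  qed
  then show ?thesis using a by (auto simp: invariant_under_def edge_def fun_eq_iff)
qed

subsection \<open>The next term of a descending series of \<open>p\<close>-power index\<close>

text \<open>If \<open>F\<close> is free on \<open>T\<close>, this is \<open>[L, L] L\<^sup>q\<close>: the weights of the
  edges of the Cayley graph of \<open>F/L\<close> give the class of a loop in homology.\<close>

definition next_level :: "'a set \<Rightarrow> 'a set \<Rightarrow> nat \<Rightarrow> 'a set" where
  "next_level L T q =
    {g \<in> L. \<forall>A \<in> rcosets L. \<forall>s \<in> T. \<forall>v \<in> carrier F. int q dvd path_wt (edge A s) v g}"

text \<open>Conjugation only moves the base point of a loop, and the definition demands the
  congruence at every base point \<open>v\<close>.\<close>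

lemma next_level_normal:
  assumes L: "L \<lhd> F"
  shows "next_level L T q \<lhd> F"
proof -
  have sg: "subgroup L F" using L normal_imp_subgroup by auto
  note cl = subgroup.mem_carrier[OF sg]
  have "subgroup (next_level L T q) F"
  proof
    show "next_level L T q \<subseteq> carrier F" using cl by (auto simp: next_level_def)
    show "\<one> \<in> next_level L T q" by (simp add: next_level_def sg subgroup.one_closed)
  next
    fix x y assume "x \<in> next_level L T q" "y \<in> next_level L T q"
    then show "x \<otimes> y \<in> next_level L T q"
      using sg cl by (simp add: next_level_def subgroup.m_closed path_wt_mult)
  next
    fix x assume "x \<in> next_level L T q"
    then show "inv x \<in> next_level L T q"
      using sg cl by (simp add: next_level_def subgroup.m_inv_closed path_wt_inv)
  qed
  moreover have "x \<otimes> h \<otimes> inv x \<in> next_level L T q"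
    if x: "x \<in> carrier F" and h: "h \<in> next_level L T q" for x h
    using that by (simp add: next_level_def normal_conj_mem L path_wt_conj[OF edge_invariant[OF L] L])
  ultimately show ?thesis by (simp add: normal_inv_iff)
qed

text \<open>The coset of \<open>?M\<close> is determined by the coset of \<open>L\<close> and by
  finitely many weights modulo \<open>p ^ k\<close>: invariance allows one base point per coset, and
  \<open>T\<close> is finite. Raising an element of \<open>L\<close> to the power
  \<open>p ^ k\<close> multiplies its weights by \<open>p ^ k\<close>.\<close>

lemma next_level_pnormal:
  assumes L: "pnormal p F L" and T: "finite T" and p: "p > 0"
  shows "pnormal p F (next_level L T (p ^ k))"
proof -
  let ?M = "next_level L T (p ^ k)" and ?q = "int (p ^ k)"
  have n: "L \<lhd> F" and sg: "subgroup L F" and fin: "finite (rcosets L)"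
    using L by (auto simp: pnormal_def normal_imp_subgroup)
  have M: "?M \<lhd> F" using n by (rule next_level_normal)
  define rep where "rep B = (SOME v. v \<in> carrier F \<and> B = L #> v)" for B
  have rep: "rep B \<in> carrier F \<and> B = L #> rep B" if "B \<in> rcosets L" for B
    unfolding rep_def by (rule someI_ex) (use that in \<open>auto simp: RCOSETS_def\<close>)
  define I where "I = (rcosets L) \<times> T \<times> (rcosets L)"
  define f where "f g = (L #> g, restrict (\<lambda>(A, s, B). path_wt (edge A s) (rep B) g mod ?q) I)" for g
  have "finite (rcosets ?M)"
  proof (rule finite_rcosets_if_finite_image[of _ f])
    have "finite I" using fin T by (simp add: I_def)
    then have "finite ((rcosets L) \<times> (I \<rightarrow>\<^sub>E {0..<?q}))"
      using fin by (simp add: finite_PiE)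
    moreover have "f ` carrier F \<subseteq> (rcosets L) \<times> (I \<rightarrow>\<^sub>E {0..<?q})"
      using p by (auto simp: f_def RCOSETS_def)
    ultimately show "finite (f ` carrier F)" by (rule rev_finite_subset)
  next
    fix x y assume xy: "x \<in> carrier F" "y \<in> carrier F" "f x = f y"
    then have xyL: "x \<otimes> inv y \<in> L" using rcos_eq_iff[OF sg] by (auto simp: f_def)
    moreover have "?q dvd path_wt (edge A s) v (x \<otimes> inv y)"
      if A: "A \<in> rcosets L" and s: "s \<in> T" and v: "v \<in> carrier F" for A s v
    proof -
      let ?\<chi> = "edge A s" and ?B = "L #> v"
      note inv = edge_invariant[OF n A, of s]
      have B: "?B \<in> rcosets L" using v by (auto simp: RCOSETS_def)
      then have *: "v \<otimes> inv (rep ?B) \<in> L" using rep v rcos_eq_iff[OF sg] by metis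
      have "(A, s, ?B) \<in> I" using A s B by (simp add: I_def)
      then have "path_wt ?\<chi> (rep ?B) x mod ?q = path_wt ?\<chi> (rep ?B) y mod ?q"
        using xy(3) by (auto simp: f_def restrict_def dest: fun_cong[of _ _ "(A, s, ?B)"])
      moreover have "path_wt ?\<chi> v z = path_wt ?\<chi> (rep ?B) z" if "z \<in> carrier F" for z
        using path_wt_invariant'[OF inv n v _ * that] rep[OF B] by blast
      ultimately have "path_wt ?\<chi> v x mod ?q = path_wt ?\<chi> v y mod ?q"
        using xy by simp
      \<comment> \<open>Since x y^-1 lies in \<open>L\<close>, the path of x y^-1 from
        \<open>v\<close> ends in the coset of \<open>v\<close>. Its last part is thus the path of
        \<open>y\<close> from \<open>v\<close> run backwards, and the weight of x y^-1 is a
        difference of two weights at \<open>v\<close>.\<close>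
      moreover have "path_wt ?\<chi> (v \<otimes> x \<otimes> inv y) y = path_wt ?\<chi> v y"
        using normal_conj_mem(1)[OF n v xyL] v xy
        by (intro path_wt_invariant'[OF inv n]) (simp_all add: m_assoc)
      ultimately show ?thesis
        using v xy by (simp add: path_wt_mult path_wt_inv mod_eq_dvd_iff)
    qed
    ultimately show "x \<otimes> inv y \<in> ?M" by (simp add: next_level_def)
  qed (use M normal_imp_subgroup in blast)
  moreover have "\<exists>m::nat. g [^] (p ^ m) \<in> ?M" if g: "g \<in> carrier F" for g
  proof -
    obtain m :: nat where m: "g [^] (p ^ m) \<in> L" using L g by (auto simp: pnormal_def)
    have "(g [^] (p ^ m)) [^] (p ^ k) \<in> ?M"
      using path_wt_pow[OF edge_invariant[OF n] n m] pow_dvd_mem[OF sg g m, of "p ^ m * p ^ k"] g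
      by (simp add: next_level_def nat_pow_pow)
    then show ?thesis using g by (auto simp: nat_pow_pow simp flip: power_add)
  qed
  ultimately show ?thesis using M by (simp add: pnormal_def)
qed

end

section \<open>Primitive words and simple loops\<close>

text \<open>Both products are the prefix of length |u| + |w| of one and the same infinite
  word.\<close>

lemma append_commute_if_periodic_eq:
  assumes "u \<noteq> []" "w \<noteq> []" and eq: "\<And>i. u ! (i mod length u) = w ! (i mod length w)"
  shows "u @ w = w @ u"
proof -
  have *: "(a @ b) ! i = a ! (i mod length a)"
    if "i < length a + length b" "\<And>i. a ! (i mod length a) = b ! (i mod length b)" for a b :: "'a list" and i
  proof (cases "i < length a")
    case False
    then have "(a @ b) ! i = b ! ((i - length a) mod length b)"
      using that(1) by (simp add: nth_append)
    also have "\<dots> = a ! (i mod length a)"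
      using that(2)[of "i - length a"] False by (simp add: le_mod_geq)
    finally show ?thesis .
  qed (simp add: nth_append)
  show ?thesis
    by (rule nth_equalityI) (use *[OF _ eq] *[OF _ eq[symmetric]] eq in auto)
qed

lemma nth_concat_replicate:
  assumes "i < n * length z"
  shows "concat (replicate n z) ! i = z ! (i mod length z)"
  using assms nth_per by (metis per_mult)

lemma rotate_concat_replicate:
  "rotate k (concat (replicate n z)) = concat (replicate n (rotate k z))"
proof (rule nth_equalityI)
  fix i assume "i < length (rotate k (concat (replicate n z)))"
  then have i: "i < n * length z" by (simp add: length_concat sum_list_replicate)
  then have "z \<noteq> []" by auto
  moreover have "(k + i) mod (n * length z) < n * length z" using i by (intro mod_less_divisor) linarith
  ultimately show "rotate k (concat (replicate n z)) ! i = concat (replicate n (rotate k z)) ! i"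
    using i
    by (simp add: nth_rotate length_concat sum_list_replicate nth_concat_replicate mod_mod_cancel mod_add_right_eq)
qed (simp add: length_concat sum_list_replicate)

lemma primitive_rotate:
  assumes "primitive v"
  shows "primitive (rotate j v)"
  unfolding primitive_def
proof (intro conjI allI impI)
  fix z n assume "rotate j v = concat (replicate n z)"
  moreover define k where "k = length v - j mod length v"
  have "v \<noteq> []" using assms by (simp add: primitive_def)
  then have "rotate k (rotate (j mod length v) v) = v"
    unfolding rotate_rotate k_def by (simp add: less_imp_le)
  then have "rotate k (rotate j v) = v" by (metis rotate_conv_mod)
  ultimately have "v = concat (replicate n (rotate k z))" by (metis rotate_concat_replicate)
  then show "n = 1" using assms by (auto simp: primitive_def)
qed (use assms in \<open>simp add: primitive_def\<close>)

text \<open>The infinite power of \<open>u\<close> is a shift of that of \<open>v\<close>. Hence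
  \<open>u\<close> commutes with the rotated word and is a power of it, and primitivity makes the
  exponent 1.\<close>

lemma primitive_eq_rotate:
  assumes u: "primitive u" and v: "primitive v"
    and eq: "\<And>i. u ! (i mod length u) = v ! ((j + i) mod length v)"
  shows "u = rotate j v"
proof -
  let ?w = "rotate j v"
  have w: "primitive ?w" using v by (rule primitive_rotate)
  have ne: "u \<noteq> []" "v \<noteq> []" using u v by (auto simp: primitive_def)
  have "u ! (i mod length u) = ?w ! (i mod length ?w)" for i
    using eq[of i] ne by (simp add: nth_rotate mod_add_right_eq)
  then have "u @ ?w = ?w @ u" using ne by (intro append_commute_if_periodic_eq) auto
  then obtain m where m: "u = concat (replicate m ?w)" using primitive_commute w by blast
  then have "m = 1" using u by (auto simp: primitive_def)
  then show ?thesis using m by simp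
qed

context based_free_group
begin

abbreviation direction :: "'a \<times> bool \<Rightarrow> int" where
  "direction l \<equiv> (if snd l then 1 else - 1)"

text \<open>The source of the positively oriented edge that the letter crosses when read at
  \<open>g\<close>; a negative letter crosses its edge from end to start.\<close>

definition tail :: "'a \<Rightarrow> 'a \<times> bool \<Rightarrow> 'a" where
  "tail g l = (if snd l then g else g \<otimes> lval l)"

lemma tail_closed: "\<lbrakk>g \<in> carrier F; l \<in> S \<times> UNIV\<rbrakk> \<Longrightarrow> tail g l \<in> carrier F"
  by (simp add: tail_def del: mem_Sigma_iff)

lemma per_words: "u \<noteq> [] \<Longrightarrow> u \<in> words \<Longrightarrow> per u n \<in> words"
  by (rule per_in_lists)

lemma val_per_Suc:
  assumes "u \<noteq> []" "u \<in> words"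
  shows "val (per u (Suc n)) = val (per u n) \<otimes> lval (u ! (n mod length u))"
  using nth_mod_mem[OF assms] per_words[OF assms, of n]
  by (simp add: per_Suc val_append del: mem_Sigma_iff)

lemma val_per_mult: "u \<in> words \<Longrightarrow> val (per u (k * length u)) = val u [^] k"
  by (simp add: per_mult val_replicate)

lemma val_per_add:
  assumes "u \<noteq> []" "u \<in> words"
  shows "val (per u (k * length u + n)) = val u [^] k \<otimes> val (per u n)"
  using val_append[OF per_words[OF assms] per_words[OF assms]] assms(2)
  by (simp only: per_add val_per_mult)

text \<open>The bi-infinite path labelled \<open>\<dots>uuu\<dots>\<close> projects to a simple loop in the
  Cayley graph of \<open>F/L\<close>.\<close>

definition simple_mod :: "'a set \<Rightarrow> ('a \<times> bool) list \<Rightarrow> bool" where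
  "simple_mod L u \<longleftrightarrow>
    (\<forall>i j. inv (val (per u i)) \<otimes> val (per u j) \<in> L \<longrightarrow> i mod length u = j mod length u)"

lemma simple_mod_mono: "simple_mod L u \<Longrightarrow> K \<subseteq> L \<Longrightarrow> simple_mod K u"
  by (auto simp: simple_mod_def)

lemma edge_wt_le_1: "\<bar>edge_wt (edge A s) g l\<bar> \<le> 1"
  by (simp add: edge_wt_edge)

text \<open>This bound lets a modulus that is large compared with the lengths turn a congruence
  between weights into an equality.\<close>

lemma word_wt_le_length: "\<bar>word_wt (edge A s) g w\<bar> \<le> int (length w)"
proof (induction w arbitrary: g)
  case (Cons l w)
  show ?case using edge_wt_le_1[of A s g l] Cons.IH[of "g \<otimes> lval l"] by simp
qed simp

context
  fixes L u g
  assumes L: "L \<lhd> F" and u: "u \<noteq> []" "u \<in> words" "reduced (u @ u)" "simple_mod L u"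
    and g: "g \<in> carrier F"
begin

text \<open>If some step crossed the edge of step \<open>i\<^sub>0\<close> the other way, simplicity
  of the loop would make the two steps neighbours in the periodic word, up to whole periods. Two
  neighbouring letters would then be mutually inverse, which cyclic reducedness forbids.\<close>

lemma no_backtracking:
  fixes i\<^sub>0 :: nat
  defines "l \<equiv> \<lambda>i. u ! (i mod length u)" and "P \<equiv> \<lambda>i. g \<otimes> val (per u i)"
  defines "\<chi> \<equiv> edge (L #> tail (P i\<^sub>0) (l i\<^sub>0)) (fst (l i\<^sub>0))"
  shows "direction (l i\<^sub>0) * edge_wt \<chi> (P i) (l i) \<ge> 0"
    and "direction (l i\<^sub>0) * edge_wt \<chi> (P i\<^sub>0) (l i\<^sub>0) = 1"
proof -
  have lS: "l i \<in> S \<times> UNIV" for i using nth_mod_mem[OF u(1,2)] by (simp add: l_def)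
  have pc: "val (per u i) \<in> carrier F" for i using u per_words by simp
  have step: "P i \<otimes> lval (l i) = P (Suc i)" for i
    using val_per_Suc[OF u(1,2)] pc[of i] lS[of i] g by (simp add: P_def l_def m_assoc del: mem_Sigma_iff)
  have ll: "l (Suc i) \<noteq> linv (l i)" for i
    using cyclically_reduced_nth[OF u(1,3)] by (simp add: l_def)
  have same: "l i = l j" if "P i \<in> L #> P j" for i j
  proof -
    have "j mod length u = i mod length u"
      using that u(4) mem_rcos_translate[OF L g pc pc] by (simp add: P_def simple_mod_def)
    then show ?thesis by (simp add: l_def)
  qed
  show "direction (l i\<^sub>0) * edge_wt \<chi> (P i) (l i) \<ge> 0"
  proof (cases "snd (l i\<^sub>0)")
    case True
    have False if "fst (l i) = fst (l i\<^sub>0)" "\<not> snd (l i)" "P (Suc i) \<in> L #> P i\<^sub>0"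
      using same[OF that(3)] that(1,2) True ll[of i] by (simp add: linv_def prod_eq_iff)
    then show ?thesis using True by (auto simp: \<chi>_def tail_def edge_wt_edge step)
  next
    case False
    have False if "fst (l i) = fst (l i\<^sub>0)" "snd (l i)" "P i \<in> L #> P (Suc i\<^sub>0)"
      using same[OF that(3)] that(1,2) False ll[of i\<^sub>0] by (simp add: linv_def prod_eq_iff)
    then show ?thesis using False by (auto simp: \<chi>_def tail_def edge_wt_edge step)
  qed
  have "h \<in> L #> h" if "h \<in> carrier F" for h
    using rcos_self[OF that] L normal_imp_subgroup by blast
  then show "direction (l i\<^sub>0) * edge_wt \<chi> (P i\<^sub>0) (l i\<^sub>0) = 1"
    using g pc by (auto simp: \<chi>_def tail_def edge_wt_edge step) (auto simp: P_def)
qed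

lemma word_wt_per:
  "word_wt \<chi> g (per u m) = (\<Sum>i<m. edge_wt \<chi> (g \<otimes> val (per u i)) (u ! (i mod length u)))"
  using word_wt_sum[OF g per_words[OF u(1,2)], of \<chi> m] by (simp add: take_per)

text \<open>After multiplication by the direction all summands are nonnegative and one of them is
  1.\<close>

lemma word_wt_per_pos:
  assumes "i < m"
  defines "l \<equiv> u ! (i mod length u)"
  shows "direction l * word_wt (edge (L #> tail (g \<otimes> val (per u i)) l) (fst l)) g (per u m) > 0"
proof -
  let ?\<chi> = "edge (L #> tail (g \<otimes> val (per u i)) l) (fst l)"
  have "(\<Sum>j<m. direction l * edge_wt ?\<chi> (g \<otimes> val (per u j)) (u ! (j mod length u))) > 0"
    using no_backtracking[of i] assms by (intro sum_pos2[of _ i]) (auto simp: l_def)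
  then show ?thesis by (simp only: word_wt_per sum_distrib_left)
qed

end

text \<open>Induction on the length separates the proper subwords of a cyclically reduced
  \<open>w\<close>, so modulo some \<open>M\<close> its path repeats no vertex before its end. If
  the path closes up, it is a simple loop; the weight of its first edge is nonzero and at most the
  length of \<open>w\<close>, so the next level with a modulus above the length excludes
  \<open>val w\<close>. Other words are conjugate to shorter ones.\<close>

lemma residually_p_word:
  assumes p: "p > 1" and w: "w \<in> words" "reduced w" "w \<noteq> []"
  shows "\<exists>L. pnormal p F L \<and> val w \<notin> L"
  using w
proof (induction "length w" arbitrary: w rule: less_induct)
  case less
  show ?case
  proof (cases "reduced (w @ w)")
    case False
    then obtain l v where w: "w = l # v @ [linv l]" "v \<noteq> []" "reduced v"
      using reduced_conjE less.prems by metis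
    then have lv: "l \<in> S \<times> UNIV" "v \<in> words" using less.prems by auto
    then obtain L where L: "pnormal p F L" "val v \<notin> L" using less.hyps[of v] w by auto
    have "inv (lval l) \<otimes> val w \<otimes> lval l = val v"
      using lv less.prems(1) unfolding w(1)
      by (subst val_conj_word) (simp_all add: m_assoc del: mem_Sigma_iff)
    then have "val w \<notin> L"
      using L normal_conj_mem(2)[OF pnormal_imp_normal[OF L(1)] lval_closed[OF lv(1)]] by metis
    then show ?thesis using L by blast
  next
    case True
    let ?n = "length w" and ?P = "\<lambda>i. val (per w i)"
    have pc: "?P i \<in> carrier F" for i using less.prems per_words by simp
    define I where "I = {(i, j). i < j \<and> j < ?n}"
    have "finite I" by (rule finite_subset[of _ "{..<?n} \<times> {..<?n}"]) (auto simp: I_def)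
    have "\<exists>L. pnormal p F L \<and> inv (?P i) \<otimes> ?P j \<notin> L" if "i < j" "j < ?n" for i j
    proof -
      let ?s = "take (j - i) (drop i w)"
      have "per w j = take j w" "per w i = take i w"
        using that take_per[of j ?n w] take_per[of i ?n w] by (simp_all add: per_length_self)
      then have pj: "per w j = per w i @ ?s"
        using that by (metis le_add_diff_inverse less_imp_le take_add)
      have s: "?s \<in> words" using less.prems(1) by (meson in_listsD in_listsI in_set_dropD in_set_takeD)
      have "reduced (per w j)" using reduced_per less.prems True by blast
      then have rs: "reduced ?s" unfolding pj successively_append_iff by blast
      have "length ?s < ?n" "?s \<noteq> []" using that by auto
      from less.hyps[OF this(1) s rs this(2)]
      obtain L where L: "pnormal p F L" "val ?s \<notin> L" by (elim exE conjE)
      have "inv (?P i) \<otimes> ?P j = val ?s"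
        unfolding pj using s less.prems per_words pc by (simp add: val_append)
      then show ?thesis using L by auto
    qed
    then have "\<forall>ij \<in> I. \<exists>L. pnormal p F L \<and> inv (?P (fst ij)) \<otimes> ?P (snd ij) \<notin> L"
      by (simp add: I_def split_beta)
    then obtain L where L: "\<forall>ij \<in> I. pnormal p F (L ij) \<and> inv (?P (fst ij)) \<otimes> ?P (snd ij) \<notin> L ij"
      using bchoice by meson
    then have "\<And>ij. ij \<in> I \<Longrightarrow> pnormal p F (L ij)" by blast
    from pnormal_INT[of I p L, OF \<open>finite I\<close> this]
    obtain M where M: "pnormal p F M" and sub: "\<forall>ij \<in> I. M \<subseteq> L ij" by blast
    have avoid: "inv (?P i) \<otimes> ?P j \<notin> M" if "i < j" "j < ?n" for i j
    proof -
      have "(i, j) \<in> I" using that by (simp add: I_def)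
      then have "inv (?P i) \<otimes> ?P j \<notin> L (i, j)" "M \<subseteq> L (i, j)" using L sub by auto
      then show ?thesis by blast
    qed
    have n: "M \<lhd> F" and sg: "subgroup M F" using M by (auto simp: pnormal_def normal_imp_subgroup)
    show ?thesis
    proof (cases "val w \<in> M")
      case wM: True
      have "simple_mod M w"
        unfolding simple_mod_def
      proof (intro allI impI)
        fix i j assume ij: "inv (?P i) \<otimes> ?P j \<in> M"
        let ?i = "i mod ?n" and ?j = "j mod ?n"
        have lt: "?i < ?n" "?j < ?n" using less.prems by auto
        have P: "?P k = val w [^] (k div ?n) \<otimes> ?P (k mod ?n)" for k
          using val_per_add[of w "k div ?n" "k mod ?n"] less.prems by simp
        have cw: "val w \<in> carrier F" using less.prems by simp
        have wk: "val w [^] k \<in> M" for k :: nat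
          using pow_dvd_mem[OF sg cw, of 1 k] wM cw by simp
        \<comment> \<open>Whole periods are powers of \<open>val w\<close>, which lies in
          \<open>M\<close>, so both indices may be reduced modulo \<open>?n\<close>.\<close>
        have PP: "inv (?P ?i) \<otimes> ?P ?j \<in> M"
        proof -
          let ?d = "inv (val w [^] (i div ?n)) \<otimes> val w [^] (j div ?n)"
          have d: "?d \<in> M" using wk sg by (simp add: subgroup.m_closed subgroup.m_inv_closed)
          have "inv (?P ?i) \<otimes> inv ?d \<otimes> ?P ?i \<in> M"
            using d sg pc by (intro normal_conj_mem(2)[OF n]) (simp_all add: subgroup.m_inv_closed)
          then have "(inv (?P ?i) \<otimes> inv ?d \<otimes> ?P ?i) \<otimes> (inv (?P i) \<otimes> ?P j) \<in> M"
            using ij sg by (simp add: subgroup.m_closed)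
          also have "(inv (?P ?i) \<otimes> inv ?d \<otimes> ?P ?i) \<otimes> (inv (?P i) \<otimes> ?P j) = inv (?P ?i) \<otimes> ?P ?j"
            unfolding P[of i] P[of j] using pc cw by (simp add: m_assoc inv_mult_group)
          finally show ?thesis .
        qed
        then have "inv (?P ?j) \<otimes> ?P ?i \<in> M"
          using subgroup.m_inv_closed[OF sg PP] pc by (simp add: inv_mult_group)
        then show "?i = ?j" using avoid[of ?i ?j] avoid[of ?j ?i] PP lt by linarith
      qed
      then have "direction (w ! 0) * word_wt (edge (M #> tail (\<one> \<otimes> val (per w 0)) (w ! 0)) (fst (w ! 0))) \<one> (per w ?n) > 0"
        using word_wt_per_pos[of M w \<one> 0 ?n] n less.prems True by simp
      moreover define A where "A = M #> tail (\<one> \<otimes> val (per w 0)) (w ! 0)"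
      moreover define s where "s = fst (w ! 0)"
      ultimately have pos: "word_wt (edge A s) \<one> w \<noteq> 0" by (auto simp: per_length_self)
      have "tail (\<one> \<otimes> val (per w 0)) (w ! 0) \<in> carrier F"
        using nth_mod_mem[of w _ 0] less.prems by (intro tail_closed) auto
      then have A: "A \<in> rcosets M" by (auto simp: A_def RCOSETS_def)
      obtain k where k: "?n < p ^ k" using power_gt_expt[of p ?n] p by auto
      have "\<not> int (p ^ k) dvd word_wt (edge A s) \<one> w"
        using dvd_imp_le_int[OF pos, of "int (p ^ k)"] word_wt_le_length[of A s \<one> w] k by linarith
      then have "val w \<notin> next_level M {s} (p ^ k)"
        using A less.prems(1) by (auto simp: next_level_def path_wt_val)
      then show ?thesis using next_level_pnormal[OF M, of "{s}" k] p by auto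
    qed (use M in blast)
  qed
qed

lemma residually_p:
  assumes "p > 1" "x \<in> carrier F" "x \<noteq> \<one>"
  shows "\<exists>L. pnormal p F L \<and> x \<notin> L"
proof -
  obtain w where "w \<in> words" "reduced w" "val w = x" using ex_reduced assms by metis
  moreover from this have "w \<noteq> []" using assms by auto
  ultimately show ?thesis using residually_p_word[of p w] assms by auto
qed

end

section \<open>Separating conjugates in free groups\<close>

context based_free_group
begin

text \<open>A collision on the path modulo \<open>L\<close> involves an arbitrary power of
  \<open>u\<close>, but only finitely many elements can be kept out of \<open>L\<close>. The
  commutators \<open>c i j\<close> of the elements P i (P j)^-1 with \<open>val u\<close> are blind
  to such powers, and they are nontrivial because the centralizer of \<open>val u\<close> consists
  of its powers.\<close>

lemma ex_simple_mod:
  assumes p: "p > 1" and u: "u \<in> words" "primitive u" "reduced (u @ u)"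
  obtains L where "pnormal p F L" "simple_mod L u"
proof -
  let ?n = "length u" and ?P = "\<lambda>i. val (per u i)" and ?u = "val u"
  have ne: "u \<noteq> []" using u by (simp add: primitive_def)
  have uc: "?u \<in> carrier F" using u by simp
  have pc: "?P i \<in> carrier F" for i using u ne per_words by simp
  have P_inj: "i = j" if "i < ?n" "j < ?n" "?P i = ?u [^] (k::nat) \<otimes> ?P j" for i j k
  proof -
    have "?P i = ?P (k * ?n + j)" using that val_per_add[OF ne u(1)] by simp
    then have "per u i = per u (k * ?n + j)"
      using reduced_eqI[OF per_words per_words reduced_per reduced_per] u ne by blast
    then have "i = k * ?n + j" by (metis length_per)
    then show ?thesis using that by (cases k) auto
  qed
  define c where "c i j = (?P i \<otimes> inv (?P j)) \<otimes> ?u \<otimes> inv (?P i \<otimes> inv (?P j)) \<otimes> inv ?u" for i j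
  define I where "I = {ij. fst ij < ?n \<and> snd ij < ?n \<and> fst ij \<noteq> snd ij}"
  have "finite I" by (rule finite_subset[of _ "{..<?n} \<times> {..<?n}"]) (auto simp: I_def)
  have "c i j \<noteq> \<one>" if ij: "i < ?n" "j < ?n" "i \<noteq> j" for i j
  proof
    let ?z = "?P i \<otimes> inv (?P j)"
    assume "c i j = \<one>"
    then have "c i j \<otimes> ?u \<otimes> ?z = ?u \<otimes> ?z" using uc pc by simp
    then have "?z \<otimes> ?u = ?u \<otimes> ?z" using uc pc by (simp add: c_def m_assoc inv_mult_group)
    then obtain k :: int where k: "?z = ?u [^] k"
      using centralizer_primitive[OF u, of ?z] pc by auto
    have Pi: "?P i = ?u [^] k \<otimes> ?P j" using pc by (simp add: m_assoc flip: k)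
    show False
    proof (cases "k \<ge> 0")
      case True
      then have "?P i = ?u [^] (nat k) \<otimes> ?P j" using Pi by (metis int_nat_eq int_pow_int)
      then show False using P_inj ij by blast
    next
      case False
      have "?P j = ?u [^] (- k) \<otimes> ?P i" using Pi uc pc by (simp add: int_pow_neg)
      moreover have "- k = int (nat (- k))" using False by simp
      ultimately have "?P j = ?u [^] (nat (- k)) \<otimes> ?P i" by (metis int_pow_int)
      then show False using P_inj ij by blast
    qed
  qed
  moreover have cc: "c i j \<in> carrier F" for i j using uc pc by (simp add: c_def)
  ultimately have "\<forall>ij \<in> I. \<exists>L. pnormal p F L \<and> c (fst ij) (snd ij) \<notin> L"
    using residually_p[OF p] by (simp add: I_def)
  then obtain L where L: "\<forall>ij \<in> I. pnormal p F (L ij) \<and> c (fst ij) (snd ij) \<notin> L ij"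
    using bchoice by meson
  then have "\<And>ij. ij \<in> I \<Longrightarrow> pnormal p F (L ij)" by blast
  from pnormal_INT[of I p L, OF \<open>finite I\<close> this]
  obtain M where M: "pnormal p F M" and sub: "\<forall>ij \<in> I. M \<subseteq> L ij" by blast
  have n: "M \<lhd> F" and sg: "subgroup M F" using M by (auto simp: pnormal_def normal_imp_subgroup)
  have "simple_mod M u"
    unfolding simple_mod_def
  proof (intro allI impI, rule ccontr)
    fix i j assume ij: "inv (?P i) \<otimes> ?P j \<in> M" "i mod ?n \<noteq> j mod ?n"
    let ?i = "i mod ?n" and ?j = "j mod ?n"
    let ?d = "?u [^] (int (j div ?n) - int (i div ?n))"
    let ?m = "?d \<otimes> ?P ?j \<otimes> inv (?P ?i)"
    have P: "?P k = ?u [^] (int (k div ?n)) \<otimes> ?P (k mod ?n)" for k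
      using val_per_add[OF ne u(1), of "k div ?n" "k mod ?n"] by (simp add: int_pow_int)
    have dc: "?d \<in> carrier F" using uc by simp
    have d: "inv (?u [^] (int (i div ?n))) \<otimes> ?u [^] (int (j div ?n)) = ?d"
      using int_pow_mult[OF uc, of "- int (i div ?n)" "int (j div ?n)"] int_pow_neg[OF uc] by simp
    have comm: "?d \<otimes> ?u = ?u \<otimes> ?d"
      using int_pow_mult[OF uc, of "int (j div ?n) - int (i div ?n)" 1]
        int_pow_mult[OF uc, of 1 "int (j div ?n) - int (i div ?n)"] uc by (simp add: add.commute)
    have "?P ?i \<otimes> (inv (?P i) \<otimes> ?P j) \<otimes> inv (?P ?i) \<in> M"
      using normal_conj_mem(1)[OF n pc ij(1)] .
    also have "?P ?i \<otimes> (inv (?P i) \<otimes> ?P j) \<otimes> inv (?P ?i)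
        = (inv (?u [^] (int (i div ?n))) \<otimes> ?u [^] (int (j div ?n))) \<otimes> ?P ?j \<otimes> inv (?P ?i)"
      unfolding P[of i] P[of j] using pc uc by (simp add: m_assoc inv_mult_group)
    also have "\<dots> = ?m" by (simp only: d)
    finally have m: "?m \<in> M" .
    \<comment> \<open>A commutator of \<open>?m\<close> with \<open>?u\<close>: the power
      \<open>?d\<close> commutes with \<open>?u\<close> and drops out, which leaves
      \<open>c ?i ?j\<close>.\<close>
    have "inv ?m \<otimes> (?u \<otimes> ?m \<otimes> inv ?u) \<in> M"
      using m sg normal_conj_mem(1)[OF n uc m] by (simp add: subgroup.m_closed subgroup.m_inv_closed)
    also have "inv ?m \<otimes> (?u \<otimes> ?m \<otimes> inv ?u)
        = ?P ?i \<otimes> inv (?P ?j) \<otimes> inv ?d \<otimes> (?u \<otimes> ?d) \<otimes> ?P ?j \<otimes> inv (?P ?i) \<otimes> inv ?u"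
      using pc uc dc by (simp add: m_assoc inv_mult_group)
    also have "\<dots> = c ?i ?j"
      unfolding comm[symmetric] c_def using pc uc dc by (simp add: m_assoc inv_mult_group)
    finally have "c ?i ?j \<in> M" .
    moreover have "(?i, ?j) \<in> I" using ij ne by (simp add: I_def)
    then have "c ?i ?j \<notin> L (?i, ?j)" "M \<subseteq> L (?i, ?j)" using L sub by auto
    ultimately show False by blast
  qed
  then show ?thesis using that M by blast
qed

lemma separate_primitive:
  assumes p: "p > 1" and L\<^sub>0: "pnormal p F L\<^sub>0"
    and u: "u \<in> words" "primitive u" "reduced (u @ u)"
    and v: "v \<in> words" "primitive v" "reduced (v @ v)"
    and ab: "a > 0" "b > 0"
  defines "x \<equiv> val u [^] (a::nat)" and "y \<equiv> val v [^] (b::nat)"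
  obtains M where "pnormal p F M"
    "\<And>g. \<lbrakk>g \<in> carrier F; inv y \<otimes> (g \<otimes> x \<otimes> inv g) \<in> M\<rbrakk>
      \<Longrightarrow> \<exists>h \<in> carrier F. h \<otimes> inv g \<in> L\<^sub>0 \<and> y = h \<otimes> x \<otimes> inv h"
proof -
  let ?nu = "length u" and ?nv = "length v"
  have ne: "u \<noteq> []" "v \<noteq> []" using u v by (simp_all add: primitive_def)
  have uc [simp]: "val u \<in> carrier F" and vc [simp]: "val v \<in> carrier F" using u v by simp_all
  obtain Lu Lv where Luv: "pnormal p F Lu" "simple_mod Lu u" "pnormal p F Lv" "simple_mod Lv v"
    using ex_simple_mod[OF p u] ex_simple_mod[OF p v] by metis
  define L where "L = L\<^sub>0 \<inter> (Lu \<inter> Lv)"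
  have pL: "pnormal p F L" using Luv L\<^sub>0 by (simp add: L_def pnormal_Int)
  have su: "simple_mod L u" and sv: "simple_mod L v"
    using simple_mod_mono[OF Luv(2), of L] simple_mod_mono[OF Luv(4), of L] by (auto simp: L_def)
  have n: "L \<lhd> F" and sg: "subgroup L F" using pL by (auto simp: pnormal_def normal_imp_subgroup)
  obtain n0 where n0: "\<And>n. n \<ge> n0 \<Longrightarrow> val u [^] (p ^ n) \<in> L" "\<And>n. n \<ge> n0 \<Longrightarrow> val v [^] (p ^ n) \<in> L"
    using pnormal_pow_ge2[OF pL pL uc vc] by metis
  \<comment> \<open>The bound \<open>n0\<close> puts the \<open>N\<close>-th powers of
    \<open>val u\<close> and \<open>val v\<close> in \<open>L\<close>, so that both paths close up;
    the bound \<open>?nv\<close> makes \<open>N\<close> exceed the length of \<open>v\<close>, so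
    that \<open>mu\<close> steps cover the common period |u| |v| of the two words.\<close>
  define N where "N = p ^ max n0 ?nv"
  have uN: "val u [^] N \<in> L" and vN: "val v [^] N \<in> L" using n0 by (simp_all add: N_def)
  have "?nv < p ^ ?nv" using p by (simp add: power_gt_expt)
  also have "\<dots> \<le> N" using p by (auto simp: N_def intro: power_increasing)
  finally have N_ge: "?nv < N" .
  define mu mv where "mu = a * N * ?nu" and "mv = b * N * ?nv"
  have mu0: "mu > 0" using ab N_ge ne by (simp add: mu_def)
  \<comment> \<open>The weights compared below differ by at most \<open>mu + mv\<close>, so
    congruence modulo \<open>p ^ k\<close> will mean equality.\<close>
  obtain k where k: "mu + mv < p ^ k" using power_gt_expt[of p "mu + mv"] p by auto
  \<comment> \<open>Only letters of \<open>u\<close> and \<open>v\<close> occur on the two paths, so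
    finitely many edge labels suffice even in infinite rank.\<close>
  define T where "T = fst ` set u \<union> fst ` set v"
  define M where "M = next_level L T (p ^ k)"
  have "pnormal p F M" unfolding M_def by (rule next_level_pnormal[OF pL]) (use p in \<open>auto simp: T_def\<close>)
  moreover have "\<exists>h \<in> carrier F. h \<otimes> inv g \<in> L\<^sub>0 \<and> y = h \<otimes> x \<otimes> inv h"
    if g: "g \<in> carrier F" and gM: "inv y \<otimes> (g \<otimes> x \<otimes> inv g) \<in> M" for g
  proof -
    define lu lv where "lu i = u ! (i mod ?nu)" and "lv i = v ! (i mod ?nv)" for i
    \<comment> \<open>The path of \<open>x\<close> starts at \<open>g\<close>, because by
      \<open>path_wt_conj\<close> the conjugate g x^N g^-1 read at \<one> has the weights of x^N
      read at \<open>g\<close>. The factor \<one> in \<open>Q\<close> matches the shape of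
      \<open>word_wt_per\<close>.\<close>
    define P Q where "P i = g \<otimes> val (per u i)" and "Q i = \<one> \<otimes> val (per v i)" for i
    have luS: "lu i \<in> S \<times> UNIV" and lvS: "lv i \<in> S \<times> UNIV" for i
      using nth_mod_mem u v ne by (metis lu_def, metis lv_def)
    have pu: "val (per u i) \<in> carrier F" and pv: "val (per v i) \<in> carrier F" for i
      using per_words u v ne by simp_all
    then have PQ: "P i \<in> carrier F" "Q i \<in> carrier F" for i using g by (simp_all add: P_def Q_def)
    have xc: "x \<in> carrier F" and yc: "y \<in> carrier F" by (simp_all add: x_def y_def)
    have xN: "x [^] N = (val u [^] N) [^] a" "x [^] N = val (per u mu)"
      using val_per_mult[OF u(1), of "a * N"]
      by (simp_all add: x_def mu_def nat_pow_pow mult.commute[of a N])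
    have yN: "y [^] N = (val v [^] N) [^] b" "y [^] N = val (per v mv)"
      using val_per_mult[OF v(1), of "b * N"]
      by (simp_all add: y_def mv_def nat_pow_pow mult.commute[of b N])
    have xNL: "x [^] N \<in> L"
      unfolding xN(1) using pow_dvd_mem[OF sg, of "val u [^] N" 1 a] uN by simp
    let ?z = "g \<otimes> x \<otimes> inv g"
    \<comment> \<open>The congruence of g x g^-1 and \<open>y\<close> is passed to
      \<open>N\<close>-th powers because these are closed loops modulo \<open>L\<close>, whose
      weights at a base point can be compared.\<close>
    have m: "inv (y [^] N) \<otimes> ?z [^] N \<in> M"
      using normal_congruent_pow[OF _ yc _ gM] g xc M_def next_level_normal[OF n] by simp
    have wt: "word_wt (edge A s) g (per u mu) = word_wt (edge A s) \<one> (per v mv)"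
      "path_wt (edge A s) g (x [^] N) = path_wt (edge A s) \<one> (y [^] N)"
      if A: "A \<in> rcosets L" and s: "s \<in> T" for A s
    proof -
      let ?\<chi> = "edge A s"
      have mc: "inv (y [^] N) \<otimes> ?z [^] N \<in> carrier F" using g xc yc by simp
      have "path_wt ?\<chi> g (x [^] N) = path_wt ?\<chi> \<one> (?z [^] N)"
        using path_wt_conj[OF edge_invariant[OF n A] n xNL, of \<one> g] g xc by (simp add: conj_pow)
      also have "\<dots> = path_wt ?\<chi> \<one> (y [^] N \<otimes> (inv (y [^] N) \<otimes> ?z [^] N))"
        using g xc yc by simp
      also have "\<dots> = path_wt ?\<chi> \<one> (y [^] N) + path_wt ?\<chi> (y [^] N) (inv (y [^] N) \<otimes> ?z [^] N)"
        using mc yc by (subst path_wt_mult) simp_all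
      finally have eq: "path_wt ?\<chi> g (x [^] N) - path_wt ?\<chi> \<one> (y [^] N)
        = path_wt ?\<chi> (y [^] N) (inv (y [^] N) \<otimes> ?z [^] N)" by simp
      have "int (p ^ k) dvd path_wt ?\<chi> (y [^] N) (inv (y [^] N) \<otimes> ?z [^] N)"
        using m A s yc by (simp add: M_def next_level_def)
      then have dvd: "int (p ^ k) dvd path_wt ?\<chi> g (x [^] N) - path_wt ?\<chi> \<one> (y [^] N)"
        by (simp only: eq)
      have w: "path_wt ?\<chi> g (x [^] N) = word_wt ?\<chi> g (per u mu)"
        "path_wt ?\<chi> \<one> (y [^] N) = word_wt ?\<chi> \<one> (per v mv)"
        unfolding xN(2) yN(2) using g u v ne per_words by (simp_all add: path_wt_val)
      have "\<bar>path_wt ?\<chi> g (x [^] N)\<bar> \<le> int mu" "\<bar>path_wt ?\<chi> \<one> (y [^] N)\<bar> \<le> int mv"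
        unfolding w using word_wt_le_length[of A s _ "per u mu"] word_wt_le_length[of A s _ "per v mv"]
        by simp_all
      then have "\<bar>path_wt ?\<chi> g (x [^] N) - path_wt ?\<chi> \<one> (y [^] N)\<bar> < int (p ^ k)"
        using k by linarith
      then have "path_wt ?\<chi> g (x [^] N) - path_wt ?\<chi> \<one> (y [^] N) = 0"
        using dvd_imp_le_int[OF _ dvd] by fastforce
      then show "path_wt ?\<chi> g (x [^] N) = path_wt ?\<chi> \<one> (y [^] N)"
        "word_wt ?\<chi> g (per u mu) = word_wt ?\<chi> \<one> (per v mv)" by (simp_all add: w)
    qed
    have cosets: "L #> tail (P i) (lu i) \<in> rcosets L" for i
      using tail_closed[OF PQ(1) luS] by (auto simp: RCOSETS_def)
    have luT: "fst (lu i) \<in> T" for i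
      using ne by (auto simp: T_def lu_def)
    have pos: "direction (lu i) * word_wt (edge (L #> tail (P i) (lu i)) (fst (lu i))) g (per u mu) > 0"
      if "i < mu" for i
      using word_wt_per_pos[OF n ne(1) u(1,3) su g that] by (simp add: P_def lu_def)
    \<comment> \<open>All passages of the path of \<open>x\<^sup>N\<close> through an edge have the same sign, so no weight cancels
      and the path of \<open>y\<^sup>N\<close> must use the same edges in the same direction.\<close>
    have match: "\<exists>j. lv j = lu i \<and> Q j \<otimes> inv (P i) \<in> L" if i: "i < mu" for i
    proof -
      let ?A = "L #> tail (P i) (lu i)" and ?s = "fst (lu i)"
      have "direction (lu i) * word_wt (edge ?A ?s) \<one> (per v mv) > 0"
        using pos[OF i] wt(1)[OF cosets luT] by simp
      moreover have "word_wt (edge ?A ?s) \<one> (per v mv) = (\<Sum>j<mv. edge_wt (edge ?A ?s) (Q j) (lv j))"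
        using word_wt_per[OF n ne(2) v(1,3) sv one_closed] by (simp add: Q_def lv_def)
      ultimately have "(\<Sum>j<mv. direction (lu i) * edge_wt (edge ?A ?s) (Q j) (lv j)) > 0"
        by (simp only: sum_distrib_left)
      then obtain j where j: "direction (lu i) * edge_wt (edge ?A ?s) (Q j) (lv j) > 0"
        by (meson linorder_not_le sum_nonpos)
      then have l: "lv j = lu i" and t: "tail (Q j) (lv j) \<in> ?A"
        by (auto simp: edge_wt_edge tail_def prod_eq_iff of_bool_def split: if_splits)
      have "tail (Q j) (lu i) \<otimes> inv (tail (P i) (lu i)) \<in> L"
        using t l mem_rcos_iff[OF sg] tail_closed PQ luS by metis
      moreover have "tail (Q j) (lu i) \<otimes> inv (tail (P i) (lu i)) = Q j \<otimes> inv (P i)"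
        using PQ lval_closed[OF luS] by (simp add: tail_def m_assoc inv_mult_group)
      ultimately show ?thesis using l by auto
    qed
    \<comment> \<open>The loop of \<open>v\<close> is simple, so a vertex on it determines the
      letter by which it is left.\<close>
    have congr: "lv i = lv j" if "Q i \<otimes> inv h \<in> L" "Q j \<otimes> inv h \<in> L" "h \<in> carrier F" for i j h
    proof -
      have "(Q i \<otimes> inv h) \<otimes> inv (Q j \<otimes> inv h) \<in> L"
        using that sg by (simp add: subgroup.m_closed subgroup.m_inv_closed)
      then have "Q i \<otimes> inv (Q j) \<in> L" using PQ that(3) by (simp add: m_assoc inv_mult_group)
      then have "inv (Q j) \<otimes> Q i \<in> L" using normal_mult_inv_commute[OF n] PQ by blast
      then have "j mod ?nv = i mod ?nv" using sv pv by (simp add: simple_mod_def Q_def)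
      then show ?thesis by (simp add: lv_def)
    qed
    have PS: "P (Suc i) = P i \<otimes> lval (lu i)" and QS: "Q (Suc i) = Q i \<otimes> lval (lv i)" for i
      using val_per_Suc u v ne g pu pv lval_closed[OF luS] lval_closed[OF lvS]
      by (simp_all add: P_def Q_def lu_def lv_def m_assoc)
    obtain j0 where j0: "lv j0 = lu 0" "Q j0 \<otimes> inv (P 0) \<in> L" using match[OF mu0] by blast
    \<comment> \<open>Every edge of the path of \<open>x\<close> lies on the path of
      \<open>y\<close>, and a vertex of the latter is left by only one letter; so once the two paths
      meet, they run together.\<close>
    have follow: "lv (j0 + i) = lu i \<and> Q (j0 + i) \<otimes> inv (P i) \<in> L" if "i < mu" for i
      using that
    proof (induction i)
      case (Suc i)
      then have IH: "lv (j0 + i) = lu i" "Q (j0 + i) \<otimes> inv (P i) \<in> L" by auto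
      have Q: "Q (j0 + Suc i) \<otimes> inv (P (Suc i)) \<in> L"
        using IH PQ lval_closed[OF luS] by (simp add: PS QS m_assoc inv_mult_group)
      obtain j where "lv j = lu (Suc i)" "Q j \<otimes> inv (P (Suc i)) \<in> L" using match Suc.prems by blast
      then show ?case using congr[OF _ Q PQ(1)] Q by metis
    qed (use j0 in simp)
    have "u ! (i mod ?nu) = v ! ((j0 + i) mod ?nv)" for i
    proof -
      let ?i = "i mod (?nu * ?nv)"
      have "?i < ?nu * ?nv" using ne by simp
      also have "\<dots> \<le> ?nu * N" using N_ge by simp
      also have "\<dots> \<le> mu" using ab by (simp add: mu_def)
      finally have "v ! ((j0 + ?i) mod ?nv) = u ! (?i mod ?nu)"
        using follow by (simp add: lu_def lv_def)
      moreover have "?i mod ?nu = i mod ?nu" by (simp add: mod_mod_cancel)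
      moreover have "(j0 + ?i) mod ?nv = (j0 + ?i mod ?nv) mod ?nv" by (simp add: mod_add_right_eq)
      then have "(j0 + ?i) mod ?nv = (j0 + i) mod ?nv" by (simp add: mod_mod_cancel mod_add_right_eq)
      ultimately show ?thesis by simp
    qed
    then have rot: "u = rotate j0 v" using primitive_eq_rotate u v by blast
    \<comment> \<open>As \<open>u\<close> is \<open>v\<close> rotated by \<open>j0\<close>, the
      prefix of length \<open>j0\<close> conjugates one to the other. It is congruent to
      \<open>g\<close> modulo \<open>L\<close> because the path of \<open>x\<close> starts at
      \<open>g\<close> and the path of \<open>y\<close> is at \<open>h\<close> when they
      meet.\<close>
    define h where "h = val (per v j0)"
    have h: "h \<in> carrier F" using pv by (simp add: h_def)
    have vh: "val v \<otimes> h = h \<otimes> val u"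
    proof -
      have "per v (1 * ?nv + j0) = per v j0 @ u"
      proof (rule nth_equalityI)
        fix i assume "i < length (per v (1 * ?nv + j0))"
        moreover have "?nu = ?nv" using rot by simp
        ultimately show "per v (1 * ?nv + j0) ! i = (per v j0 @ u) ! i"
          by (auto simp: nth_append rot nth_rotate)
      qed (simp add: rot)
      then have "val (per v (1 * ?nv + j0)) = h \<otimes> val u"
        using val_append[OF per_words[OF ne(2) v(1)] u(1)] by (simp add: h_def)
      then show ?thesis using val_per_add[OF ne(2) v(1), of 1 j0] by (simp add: h_def)
    qed
    have "val v = h \<otimes> val u \<otimes> inv h"
      using arg_cong[OF vh, of "\<lambda>t. t \<otimes> inv h"] h by (simp add: m_assoc)
    then have vpow: "val v [^] i = h \<otimes> val u [^] i \<otimes> inv h" for i :: nat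
      using conj_pow h by simp
    have hg: "h \<otimes> inv g \<in> L" using j0(2) g h by (simp add: P_def Q_def h_def)
    \<comment> \<open>On the first edge, x^N and y^N have \<open>a\<close> times and
      \<open>b\<close> times the weight of u^N read at \<open>g\<close>, and this weight is
      nonzero.\<close>
    have "a = b"
    proof -
      define \<chi> where "\<chi> = edge (L #> tail (P 0) (lu 0)) (fst (lu 0))"
      have inv: "invariant_under L \<chi>" unfolding \<chi>_def by (rule edge_invariant[OF n cosets])
      have y: "y [^] N = h \<otimes> (val u [^] N) [^] b \<otimes> inv h"
        using h by (simp add: yN(1) vpow conj_pow)
      have uNc: "val u [^] N \<in> carrier F" by simp
      have "(val u [^] N) [^] b \<in> L" using pow_dvd_mem[OF sg uNc, of 1 b] uN by simp
      then have "path_wt \<chi> \<one> (y [^] N) = path_wt \<chi> h ((val u [^] N) [^] b)"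
        unfolding y using path_wt_conj[OF inv n _ one_closed h] h by simp
      also have "\<dots> = int b * path_wt \<chi> g (val u [^] N)"
        using path_wt_pow[OF inv n uN h] path_wt_invariant'[OF inv n h g hg uNc] by simp
      finally have "path_wt \<chi> \<one> (y [^] N) = int b * path_wt \<chi> g (val u [^] N)" .
      moreover have "path_wt \<chi> g (x [^] N) = path_wt \<chi> \<one> (y [^] N)"
        unfolding \<chi>_def by (rule wt(2)[OF cosets luT])
      moreover have "path_wt \<chi> g (x [^] N) = int a * path_wt \<chi> g (val u [^] N)"
        unfolding xN(1) by (rule path_wt_pow[OF inv n uN g])
      moreover have "path_wt \<chi> g (x [^] N) \<noteq> 0"
        using pos[OF mu0] g u ne per_words unfolding \<chi>_def xN(2) by (auto simp: path_wt_val)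
      then have "path_wt \<chi> g (val u [^] N) \<noteq> 0"
        using path_wt_pow[OF inv n uN g, of a] by (auto simp: xN(1))
      ultimately show ?thesis by simp
    qed
    then have "y = h \<otimes> x \<otimes> inv h" by (simp add: x_def y_def vpow)
    moreover have "h \<otimes> inv g \<in> L\<^sub>0" using hg by (simp add: L_def)
    ultimately show ?thesis using h by blast
  qed
  ultimately show ?thesis by (rule that)
qed

end

section \<open>Separation of arbitrary elements\<close>

context based_free_group
begin

lemma ex_root:
  assumes "x \<in> carrier F" "x \<noteq> \<one>"
  obtains g u a where "g \<in> carrier F" "u \<in> words" "primitive u" "reduced (u @ u)" "a > 0"
    "x = g \<otimes> val u [^] (a::nat) \<otimes> inv g"
proof -
  obtain g w where w: "g \<in> carrier F" "w \<in> words" "reduced (w @ w)" "x = g \<otimes> val w \<otimes> inv g"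
    using ex_cyclically_reduced assms(1) by blast
  then have "w \<noteq> []" using assms by auto
  then obtain u a where u: "primitive u" "a > 0" "w = concat (replicate a u)"
    using ex_primitive_root by blast
  then have "set u \<subseteq> set w" by auto
  then have uw: "u \<in> words" using w(2) by auto
  \<comment> \<open>Since \<open>a\<close> is positive, \<open>w @ w\<close> starts with
    \<open>u @ u\<close>, and \<open>u\<close> inherits cyclic reducedness.\<close>
  obtain m where m: "a + a = Suc (Suc m)" using u(2) by (cases a) auto
  have "w @ w = concat (replicate (a + a) u)" unfolding u(3) by (simp add: replicate_add)
  then have "w @ w = (u @ u) @ concat (replicate m u)" unfolding m by simp
  then have "reduced (u @ u)" using w(3) by (simp only: successively_append_iff[of _ "u @ u"])
  then show ?thesis using that[OF w(1) uw u(1) _ u(2)] w(4) uw by (simp add: u(3) val_replicate)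
qed

text \<open>If exactly one of \<open>x\<close> and \<open>y\<close> is trivial, residual
  p-finiteness makes the premise on \<open>g\<close> impossible. If neither is, both are conjugate
  to powers of primitive words, and normality of \<open>L\<close> and \<open>M\<close> lets the
  conjugator be translated back and forth.\<close>

theorem separate_conjugates:
  assumes p: "p > 1" and L: "pnormal p F L" and x: "x \<in> carrier F" and y: "y \<in> carrier F"
  shows "\<exists>M. pnormal p F M \<and>
    (\<forall>g \<in> carrier F. inv y \<otimes> (g \<otimes> x \<otimes> inv g) \<in> M \<longrightarrow>
      (\<exists>h \<in> carrier F. h \<otimes> inv g \<in> L \<and> y = h \<otimes> x \<otimes> inv h))"
proof -
  consider "x = \<one>" "y = \<one>" | "x = \<one>" "y \<noteq> \<one>" | "x \<noteq> \<one>" "y = \<one>" | "x \<noteq> \<one>" "y \<noteq> \<one>"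
    by blast
  then show ?thesis
  proof cases
    case 1
    have "\<exists>h \<in> carrier F. h \<otimes> inv g \<in> L \<and> y = h \<otimes> x \<otimes> inv h" if g: "g \<in> carrier F" for g
      using g 1 L pnormal_imp_subgroup subgroup.one_closed by (intro bexI[of _ g]) auto
    then show ?thesis using pnormal_carrier by blast
  next
    case 2
    then obtain M where M: "pnormal p F M" "inv y \<notin> M"
      using residually_p[OF p, of "inv y"] y by auto
    then show ?thesis using M(1) 2 y by auto
  next
    case 3
    then obtain M where M: "pnormal p F M" "x \<notin> M" using residually_p[OF p x] by auto
    have "inv y \<otimes> (g \<otimes> x \<otimes> inv g) \<notin> M" if g: "g \<in> carrier F" for g
    proof
      assume "inv y \<otimes> (g \<otimes> x \<otimes> inv g) \<in> M"
      then have "inv g \<otimes> (g \<otimes> x \<otimes> inv g) \<otimes> g \<in> M"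
        using 3 g x normal_conj_mem(2)[OF pnormal_imp_normal[OF M(1)] g] by simp
      then show False using M(2) g x by (simp add: m_assoc)
    qed
    then show ?thesis using M(1) by blast
  next
    case 4
    obtain c u a where u: "c \<in> carrier F" "u \<in> words" "primitive u" "reduced (u @ u)" "a > 0"
      "x = c \<otimes> val u [^] (a::nat) \<otimes> inv c" using ex_root[OF x 4(1)] by blast
    obtain d v b where v: "d \<in> carrier F" "v \<in> words" "primitive v" "reduced (v @ v)" "b > 0"
      "y = d \<otimes> val v [^] (b::nat) \<otimes> inv d" using ex_root[OF y 4(2)] by blast
    let ?x = "val u [^] a" and ?y = "val v [^] b"
    have c: "?x \<in> carrier F" "?y \<in> carrier F" using u v by simp_all
    obtain M where M: "pnormal p F M" and sep: "\<And>g. \<lbrakk>g \<in> carrier F; inv ?y \<otimes> (g \<otimes> ?x \<otimes> inv g) \<in> M\<rbrakk>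
      \<Longrightarrow> \<exists>h \<in> carrier F. h \<otimes> inv g \<in> L \<and> ?y = h \<otimes> ?x \<otimes> inv h"
      using separate_primitive[OF p L u(2-4) v(2-4) u(5) v(5)] by blast
    have "\<exists>h \<in> carrier F. h \<otimes> inv g \<in> L \<and> y = h \<otimes> x \<otimes> inv h"
      if g: "g \<in> carrier F" and gM: "inv y \<otimes> (g \<otimes> x \<otimes> inv g) \<in> M" for g
    proof -
      let ?g = "inv d \<otimes> g \<otimes> c"
      have gc: "?g \<in> carrier F" using u v g by simp
      have "inv d \<otimes> (inv y \<otimes> (g \<otimes> x \<otimes> inv g)) \<otimes> d = inv ?y \<otimes> (?g \<otimes> ?x \<otimes> inv ?g)"
        unfolding u(6) v(6) using u(1) v(1) c g by (simp add: m_assoc inv_mult_group)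
      then have "inv ?y \<otimes> (?g \<otimes> ?x \<otimes> inv ?g) \<in> M"
        using normal_conj_mem(2)[OF pnormal_imp_normal[OF M] v(1) gM] by simp
      then obtain h where h: "h \<in> carrier F" "h \<otimes> inv ?g \<in> L" "?y = h \<otimes> ?x \<otimes> inv h"
        using sep[OF gc] by blast
      let ?h = "d \<otimes> h \<otimes> inv c"
      have "?h \<otimes> inv g = d \<otimes> (h \<otimes> inv ?g) \<otimes> inv d"
        using u(1) v(1) h(1) g by (simp add: m_assoc inv_mult_group)
      then have "?h \<otimes> inv g \<in> L"
        using normal_conj_mem(1)[OF pnormal_imp_normal[OF L] v(1) h(2)] by simp
      moreover have "y = ?h \<otimes> x \<otimes> inv ?h"
        unfolding v(6) u(6) h(3) using u(1) v(1) h(1) c by (simp add: m_assoc inv_mult_group)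
      ultimately show ?thesis using u(1) v(1) h(1) by blast
    qed
    then show ?thesis using M by blast
  qed
qed

text \<open>After conjugation \<open>x\<close> is the value of a cyclically reduced word
  \<open>w\<close>. A word that commutes with \<open>w\<close> or with its inverse shares a root
  with it, and this root is one of the finitely many prefixes in \<open>Z\<close>. Each of them has
  finite order modulo \<open>N\<close>, so finitely many powers represent the whole
  centralizer.\<close>

lemma centralizer_finite_mod:
  assumes x: "x \<in> carrier F" "x \<noteq> \<one>" and N: "N \<lhd> F"
    and per: "\<And>g. g \<in> carrier F \<Longrightarrow> \<exists>n>0. g [^] (n::nat) \<in> N"
  shows "\<exists>B. finite B \<and> B \<subseteq> carrier F \<and>
    (\<forall>c \<in> carrier F. c \<otimes> x = x \<otimes> c \<longrightarrow> (\<exists>b \<in> B. c \<otimes> inv b \<in> N))"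
proof -
  obtain g w where w: "g \<in> carrier F" "w \<in> words" "reduced (w @ w)" "x = g \<otimes> val w \<otimes> inv g"
    using ex_cyclically_reduced x(1) by blast
  then have ne: "w \<noteq> []" using x by auto
  have wc: "val w \<in> carrier F" using w by simp
  define Z where "Z = (\<lambda>j. take j w) ` {..length w} \<union> (\<lambda>j. take j (winv w)) ` {..length w}"
  have "finite Z" by (simp add: Z_def)
  have prefix: "z \<in> Z" if "v = concat (replicate n z)" "v = w \<or> v = winv w" for v z n
  proof -
    have "v \<noteq> []" using that(2) ne winv_simps(5) by metis
    then have "n \<noteq> 0" using that(1) by auto
    then obtain n' where "n = Suc n'" using not0_implies_Suc by blast
    then have "z = take (length z) v" "length z \<le> length v" using that(1) by simp_all
    moreover have "length v = length w" using that(2) by auto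
    ultimately have "z \<in> (\<lambda>j. take j v) ` {..length w}" by (intro image_eqI[of _ _ "length z"]) auto
    then show ?thesis using that(2) unfolding Z_def by (elim disjE) simp_all
  qed
  have Zw: "z \<in> words" if "z \<in> Z" for z
  proof -
    have "take j v \<in> words" if "v \<in> words" for v j
      using that by (auto dest!: in_set_takeD)
    moreover have "winv w \<in> words" using w(2) by (simp only: winv_mem)
    ultimately have "take j w \<in> words" "take j (winv w) \<in> words" for j using w(2) by blast+
    then show ?thesis using that unfolding Z_def by blast
  qed
  have Zc: "val z \<in> carrier F" if "z \<in> Z" for z using Zw[OF that] by simp
  then have "\<forall>z \<in> Z. \<exists>n. n > 0 \<and> val z [^] (n::nat) \<in> N" using per by simp
  then obtain e :: "('a \<times> bool) list \<Rightarrow> nat" where e: "\<forall>z \<in> Z. e z > 0 \<and> val z [^] e z \<in> N"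
    using bchoice by meson
  define B where "B = (\<Union>z \<in> Z. (\<lambda>i. g \<otimes> val z [^] i \<otimes> inv g) ` {..<e z})"
  have "finite B" using \<open>finite Z\<close> by (simp add: B_def)
  moreover have "B \<subseteq> carrier F" using w(1) Zc by (auto simp: B_def)
  moreover have "\<exists>b \<in> B. c \<otimes> inv b \<in> N" if c: "c \<in> carrier F" "c \<otimes> x = x \<otimes> c" for c
  proof -
    let ?c = "inv g \<otimes> c \<otimes> g"
    have "?c \<otimes> val w = inv g \<otimes> (c \<otimes> x) \<otimes> g" "val w \<otimes> ?c = inv g \<otimes> (x \<otimes> c) \<otimes> g"
      using w(1) wc c(1) unfolding w(4) by (simp_all add: m_assoc)
    then have comm: "?c \<otimes> val w = val w \<otimes> ?c" using c(2) by simp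
    have "?c \<in> carrier F" using w(1) c(1) by simp
    then obtain r where r: "r \<in> words" "reduced r" "val r = ?c" by (rule ex_reduced)
    then obtain v where "r @ v = v @ r" and v: "v = w \<or> v = winv w"
      using commute_imp_words_commute[of r w] w ne comm by auto
    then obtain m n z where mn: "concat (replicate m z) = r" "concat (replicate n z) = v"
      using comm_append_are_replicate[of r v] by auto
    have z: "z \<in> Z" using prefix[OF mn(2)[symmetric] v] .
    let ?z = "val z" and ?i = "m mod e z" and ?k = "m div e z"
    have zc: "?z \<in> carrier F" using z by (rule Zc)
    have "?c = ?z [^] m" using val_replicate[OF Zw[OF z], of m] mn(1) r(3) by simp
    also have "m = e z * ?k + ?i" by simp
    finally have "?c = ?z [^] (e z * ?k) \<otimes> ?z [^] ?i" using zc by (simp add: nat_pow_mult)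
    then have "?c \<otimes> inv (?z [^] ?i) = ?z [^] (e z * ?k)" using zc by (simp add: m_assoc)
    moreover have "?z [^] (e z * ?k) \<in> N"
      using pow_dvd_mem[OF normal_imp_subgroup[OF N] zc, of "e z" "e z * ?k"] e z by simp
    ultimately have "g \<otimes> (?c \<otimes> inv (?z [^] ?i)) \<otimes> inv g \<in> N"
      using normal_conj_mem(1)[OF N w(1)] by simp
    also have "g \<otimes> (?c \<otimes> inv (?z [^] ?i)) \<otimes> inv g = c \<otimes> inv (g \<otimes> ?z [^] ?i \<otimes> inv g)"
      using w(1) c(1) zc by (simp add: m_assoc inv_mult_group)
    finally have "c \<otimes> inv (g \<otimes> ?z [^] ?i \<otimes> inv g) \<in> N" .
    moreover have "g \<otimes> ?z [^] ?i \<otimes> inv g \<in> B"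
      unfolding B_def using z e by (intro UN_I[OF z] imageI) simp
    ultimately show ?thesis by blast
  qed
  ultimately show ?thesis by blast
qed

section \<open>Elements that generate their own centralizers\<close>

lemma comm_group_if_rank_le_1:
  assumes "\<And>a b. \<lbrakk>a \<in> S; b \<in> S\<rbrakk> \<Longrightarrow> a = b"
  shows "comm_group F"
proof -
  have "S \<subseteq> carrier F" using basis by (simp add: free_basis_def)
  then obtain a where a: "S \<subseteq> {a}" "a \<in> carrier F" using assms one_closed by blast
  have "\<exists>k::int. val w = a [^] k" if "w \<in> words" for w
    using that
  proof (induction w)
    case Nil
    then show ?case by (intro exI[of _ 0]) simp
  next
    case (Cons l w)
    then obtain k :: int where "val w = a [^] k" by auto
    moreover have "l \<in> S \<times> UNIV" using Cons.hyps by simp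
    then have "fst l = a" using a(1) by auto
    then have "lval l = a [^] (if snd l then 1 else - 1 :: int)"
      using a(2) by (simp add: letter_val_def int_pow_neg)
    ultimately have "val (l # w) = a [^] ((if snd l then 1 else - 1) + k)"
      using a by (simp add: int_pow_mult)
    then show ?case ..
  qed
  then have *: "\<exists>k::int. x = a [^] k" if "x \<in> carrier F" for x using ex_reduced[OF that] by metis
  show ?thesis
  proof (rule group_comm_groupI)
    fix x y assume "x \<in> carrier F" "y \<in> carrier F"
    then obtain k l :: int where "x = a [^] k" "y = a [^] l" using * by meson
    then show "x \<otimes> y = y \<otimes> x" using a(2) by (simp add: add.commute flip: int_pow_mult)
  qed
qed

text \<open>In a proper power the long block of \<open>a\<close> either fills a whole period or is repeated half the
  length later, where it meets the block of inverses.\<close>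

lemma primitive_block_word:
  fixes a :: "'c \<times> bool"
  assumes m: "m > length w + length t + 4"
  shows "primitive (w @ (e # replicate m a @ [f]) @ t @ winv (e # replicate m a @ [f]))"
    (is "primitive ?c")
  unfolding primitive_def
proof (intro conjI allI impI)
  fix z n assume z: "?c = concat (replicate n z)"
  let ?d = "length z" and ?r = "length w + 1"
  let ?s = "?r + m + 1 + length t + 1"
  have wr: "winv (replicate m a) = replicate m (linv a)" by (simp add: winv_def)
  have len: "length ?c = n * ?d" unfolding z by (simp add: length_concat sum_list_replicate)
  have len': "length ?c = length w + length t + 4 + 2 * m" by simp
  have periodic: "?c ! i = ?c ! j" if "i < length ?c" "j < length ?c" "i mod ?d = j mod ?d" for i j
    using that unfolding len unfolding z by (simp add: nth_concat_replicate)
  have pos: "?c ! (?r + i) = a" if "i < m" for i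
    using that by (simp add: nth_append)
  have neg: "?c ! (?s + i) = linv a" if "i < m" for i
    using that by (simp add: nth_append wr)
  show "n = 1"
  proof (rule ccontr)
    assume "n \<noteq> 1"
    moreover have "n \<noteq> 0" using z by (cases n) auto
    ultimately have n: "n \<ge> 2" by simp
    have d: "?d > 0" using len len' by (cases "?d = 0") auto
    show False
    proof (cases "?d \<le> m")
      case True
      let ?i = "(?s - ?r) mod ?d"
      have i: "?i < m" using True d by (meson less_le_trans mod_less_divisor)
      have "(?r + ?i) mod ?d = (?r + (?s - ?r)) mod ?d" by (rule mod_add_right_eq)
      also have "?r + (?s - ?r) = ?s + 0" by simp
      finally have "(?r + ?i) mod ?d = (?s + 0) mod ?d" .
      then have "?c ! (?r + ?i) = ?c ! (?s + 0)" using i len' by (intro periodic) auto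
      then show False using pos[OF i] neg[of 0] m by simp
    next
      case False
      \<comment> \<open>Three periods, each longer than \<open>m\<close>, would exceed the length,
        which the bound on \<open>m\<close> keeps below \<open>3 * m\<close>.\<close>
      have "n < 3"
      proof (rule ccontr)
        assume "\<not> n < 3"
        then have "3 * ?d \<le> n * ?d" by simp
        then show False using False m len len' by linarith
      qed
      then have "n = 2" using n by simp
      then have d2: "2 * ?d = length w + length t + 4 + 2 * m" using len len' by simp
      \<comment> \<open>Subtraction truncates, so at most one of \<open>?i\<close> and
        \<open>?j\<close> is nonzero. They cover both cases: the start of the \<open>a\<close>
        block, shifted by half the length, may land before or after \<open>?s\<close>.\<close>
      let ?i = "?s - (?r + ?d)" and ?j = "?r + ?d - ?s"
      have ij: "?i < m" "?j < m" "?r + ?i + ?d = ?s + ?j" using d2 m by linarith+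
      have "(?r + ?i) mod ?d = (?s + ?j) mod ?d"
        unfolding ij(3)[symmetric] by (rule mod_add_self2[symmetric])
      then have "?c ! (?r + ?i) = ?c ! (?s + ?j)" using ij len' by (intro periodic) auto
      then show False using pos[OF ij(1)] neg[OF ij(2)] by simp
    qed
  qed
qed simp

text \<open>Multiplying by a conjugate h t h^-1 of a nontrivial \<open>t\<close> in \<open>N\<close>
  stays in the coset of \<open>w\<close>. With a long block of one letter inside \<open>h\<close>,
  the word W h T h^-1 is cyclically reduced and primitive, so its value generates its own
  centralizer.\<close>

lemma ex_own_centralizer:
  assumes nc: "\<not> comm_group F" and N: "N \<lhd> F" "N \<noteq> {\<one>}" and w: "w \<in> carrier F"
  obtains n where "n \<in> N"
    "\<And>g. \<lbrakk>g \<in> carrier F; g \<otimes> (w \<otimes> n) = (w \<otimes> n) \<otimes> g\<rbrakk> \<Longrightarrow> \<exists>k::int. g = (w \<otimes> n) [^] k"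
proof -
  have sg: "subgroup N F" using N normal_imp_subgroup by blast
  have "\<exists>a \<in> S. \<exists>b \<in> S. a \<noteq> b"
  proof (rule ccontr)
    assume "\<not> ?thesis"
    then have "comm_group F" by (intro comm_group_if_rank_le_1) blast
    with nc show False by contradiction
  qed
  then obtain a b where ab: "a \<in> S" "b \<in> S" "a \<noteq> b" by blast
  obtain t where t: "t \<in> N" "t \<noteq> \<one>" using N(2) subgroup.one_closed[OF sg] by blast
  \<comment> \<open>For trivial \<open>w\<close> the word \<open>W\<close> would be empty and have
    no last letter to avoid; then \<open>t\<close> moves it off the identity.\<close>
  define n\<^sub>0 where "n\<^sub>0 = (if w = \<one> then t else \<one>)"
  have n0: "n\<^sub>0 \<in> N" "n\<^sub>0 \<in> carrier F" "w \<otimes> n\<^sub>0 \<noteq> \<one>"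
    using t w sg subgroup.mem_carrier[OF sg] by (auto simp: n\<^sub>0_def subgroup.one_closed)
  have "w \<otimes> n\<^sub>0 \<in> carrier F" using n0 w by simp
  then obtain W where W: "W \<in> words" "reduced W" "val W = w \<otimes> n\<^sub>0" by (rule ex_reduced)
  have "t \<in> carrier F" using t(1) by (rule subgroup.mem_carrier[OF sg])
  then obtain T where T: "T \<in> words" "reduced T" "val T = t" by (rule ex_reduced)
  have ne: "W \<noteq> []" "T \<noteq> []" using W T n0 t by auto
  \<comment> \<open>Two generators give four letters, so three prohibitions leave one free.\<close>
  have free_letter: "\<exists>e \<in> S \<times> UNIV. e \<notin> {x, y, z}" for x y z :: "'a \<times> bool"
  proof (rule ccontr)
    assume "\<not> ?thesis"
    then have "{a, b} \<times> UNIV \<subseteq> {x, y, z}" using ab by blast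
    then have "card ({a, b} \<times> (UNIV :: bool set)) \<le> card {x, y, z}" by (intro card_mono) auto
    also have "\<dots> \<le> 3" by (simp add: card_insert_if)
    finally show False using ab by (simp add: card_cartesian_product)
  qed
  let ?a = "(a, True)"
  \<comment> \<open>The exclusions for \<open>e\<close> and \<open>f\<close> rule out cancellation
    inside \<open>h\<close> and at every junction of W h T h^-1 read cyclically.\<close>
  obtain e where e: "e \<in> S \<times> UNIV" "e \<notin> {linv ?a, linv (last W), hd W}" using free_letter by blast
  obtain f where f: "f \<in> S \<times> UNIV" "f \<notin> {linv ?a, linv (hd T), last T}" using free_letter by blast
  define m where "m = length W + length T + 5"
  define h where "h = e # replicate m ?a @ [f]"
  have h: "h \<in> words" using e f ab by (auto simp: h_def)
  have "reduced (replicate m ?a)" by (simp add: successively_conv_nth)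
  then have red_h: "reduced h" and h_ne: "h \<noteq> []" "hd h = e" "last h = f"
    using e f by (auto simp: h_def successively_append_iff successively_Cons m_def linv_swap)
  let ?c = "W @ h @ T @ winv h"
  have c: "?c \<in> words" using h W T by simp
  have "primitive ?c" unfolding h_def by (rule primitive_block_word) (simp add: m_def)
  moreover have "reduced (?c @ ?c)"
  proof -
    have "hd (winv h) \<noteq> linv (last T)" "hd T \<noteq> linv (last h)" "hd h \<noteq> linv (last W)"
      "hd W \<noteq> linv (last (winv h))"
      using e f h_ne by (auto simp: hd_winv last_winv)
    then show ?thesis using W(2) T(2) red_h ne h_ne(1) by (simp add: successively_append_iff)
  qed
  ultimately have cent: "\<exists>k::int. g = val ?c [^] k"
    if "g \<in> carrier F" "g \<otimes> val ?c = val ?c \<otimes> g" for g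
    using centralizer_primitive[OF c] that by blast
  have hc: "val h \<in> carrier F" using h by simp
  define n where "n = n\<^sub>0 \<otimes> (val h \<otimes> t \<otimes> inv (val h))"
  have "n \<in> N" using n0 normal_conj_mem(1)[OF N(1) hc t(1)] sg by (simp add: n_def subgroup.m_closed)
  moreover have "val ?c = w \<otimes> n"
    using W T h n0 w t subgroup.mem_carrier[OF sg] by (simp add: val_append val_winv n_def m_assoc)
  ultimately show ?thesis using that cent by simp
qed

end

section \<open>Separability in terms of normal subgroups\<close>

lemma (in group_hom) pnormal_vimage:
  assumes "pnormal p H M"
  shows "pnormal p G {x \<in> carrier G. h x \<in> M}"
proof -
  let ?K = "{x \<in> carrier G. h x \<in> M}"
  have n: "M \<lhd> H" and sg: "subgroup M H" using assms by (auto simp: pnormal_def normal_imp_subgroup)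
  have K: "subgroup ?K G"
    using sg by unfold_locales (auto simp: subgroup.m_closed subgroup.one_closed subgroup.m_inv_closed)
  then have "?K \<lhd> G"
    using H.normal_conj_mem(1)[OF n] by (auto simp: G.normal_inv_iff)
  moreover have "finite (rcosets ?K)"
  proof (rule G.finite_rcosets_if_finite_image[OF K, of "\<lambda>x. M #>\<^bsub>H\<^esub> h x"])
    have "(\<lambda>x. M #>\<^bsub>H\<^esub> h x) ` carrier G \<subseteq> rcosets\<^bsub>H\<^esub> M" 
      unfolding RCOSETS_def using hom_closed by blast
    then show "finite ((\<lambda>x. M #>\<^bsub>H\<^esub> h x) ` carrier G)"
      using assms finite_subset by (auto simp: pnormal_def)
  qed (use H.rcos_eq_iff[OF sg] in auto)
  moreover have "\<exists>n::nat. x [^] (p ^ n) \<in> ?K" if x: "x \<in> carrier G" for x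
    using assms x by (auto simp: pnormal_def hom_nat_pow)
  ultimately show ?thesis by (simp add: pnormal_def)
qed

text \<open>Divisors of a power of a prime are themselves powers of it, so it is enough that some
  p-power annihilates \<open>x\<close>.\<close>

lemma (in group) p_group_iff:
  assumes "Factorial_Ring.prime p"
  shows "p_group p G \<longleftrightarrow> (\<forall>x \<in> carrier G. \<exists>n::nat. x [^] (p ^ n) = \<one>)"
  using divides_primepow_nat[OF assms]
  by (simp add: p_group_def pow_eq_id is_group) (meson order_refl)

lemma (in group) pnormal_trivial:
  assumes "Factorial_Ring.prime p" "p_group p G" "finite (carrier G)"
  shows "pnormal p G {\<one>}"
proof -
  have "{\<one>} \<lhd> G" by (auto simp: normal_inv_iff triv_subgroup)
  moreover have "finite (rcosets {\<one>})" using assms(3) by (simp add: RCOSETS_def)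
  ultimately show ?thesis using assms p_group_iff by (auto simp: pnormal_def)
qed

text \<open>Separability and residual finiteness are stated for target groups on the natural
  numbers, so the cosets of \<open>N\<close> are numbered and the group structure is
  transported.\<close>

lemma (in group) ex_nat_quotient:
  assumes N: "N \<lhd> G" and fin: "finite (rcosets N)"
  obtains M :: "nat monoid" and \<phi> where "group M" "finite (carrier M)" "\<phi> \<in> hom G M"
    "carrier M = \<phi> ` carrier G" "\<And>x. x \<in> carrier G \<Longrightarrow> \<phi> x = \<one>\<^bsub>M\<^esub> \<longleftrightarrow> x \<in> N"
proof -
  have sg: "subgroup N G" using N normal_imp_subgroup by blast
  obtain f :: "'a set \<Rightarrow> nat" where f: "inj_on f (rcosets N)"
    using fin finite_imp_inj_to_nat_seg by meson
  define \<phi> where "\<phi> x = f (N #> x)" for x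
  have eq: "\<phi> x = \<phi> y \<longleftrightarrow> x \<otimes> inv y \<in> N" if "x \<in> carrier G" "y \<in> carrier G" for x y
    using inj_on_eq_iff[OF f, of "N #> x" "N #> y"] that rcos_eq_iff[OF sg that]
    by (auto simp: \<phi>_def RCOSETS_def)
  then have wgm: "weak_group_morphism \<phi> N G" using N by (intro weak_group_morphismsI) auto
  have "\<phi> ` carrier G = f ` (rcosets N)" by (auto simp: \<phi>_def RCOSETS_def)
  then have "finite (carrier (image_group \<phi> G))" using fin by (simp add: image_group_carrier)
  moreover have "\<phi> x = \<one>\<^bsub>image_group \<phi> G\<^esub> \<longleftrightarrow> x \<in> N" if "x \<in> carrier G" for x
    using eq[OF that one_closed] that by (simp add: image_group_one)
  ultimately show ?thesis
    using that image_group_is_group[OF wgm] weak_group_morphism_is_hom[OF wgm] image_group_carrier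
    by metis
qed

text \<open>With \<open>K\<close> the kernel of \<phi>, an element of the image conjugates \<phi> x
  to \<phi> y exactly when some \<open>g\<close> above it has y^-1 (g x g^-1) in \<open>K\<close>. A
  given \<phi> may fail to be onto, but elements outside its image impose no condition on
  \<open>K\<close>; conversely the quotient map is onto, so no conjugator is missed.\<close>

lemma (in group) p_conjugacy_separable_iff:
  assumes p: "Factorial_Ring.prime p"
  shows "p_conjugacy_separable p G \<longleftrightarrow>
    (\<forall>x \<in> carrier G. \<forall>y \<in> carrier G. \<not> conjugate G x y \<longrightarrow>
      (\<exists>K. pnormal p G K \<and> (\<forall>g \<in> carrier G. inv y \<otimes> (g \<otimes> x \<otimes> inv g) \<notin> K)))"
proof -
  have "(\<exists>(M :: nat monoid) \<phi>. p_group p M \<and> finite (carrier M) \<and> \<phi> \<in> hom G M \<and> \<not> conjugate M (\<phi> x) (\<phi> y))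
    \<longleftrightarrow> (\<exists>K. pnormal p G K \<and> (\<forall>g \<in> carrier G. inv y \<otimes> (g \<otimes> x \<otimes> inv g) \<notin> K))"
    (is "?L \<longleftrightarrow> ?R") if x: "x \<in> carrier G" and y: "y \<in> carrier G" for x y
  proof
    assume ?L
    then obtain M :: "nat monoid" and \<phi> where M: "p_group p M" "finite (carrier M)" "\<phi> \<in> hom G M"
      and nc: "\<not> conjugate M (\<phi> x) (\<phi> y)" by blast
    have "group M" using M by (simp add: p_group_def)
    then interpret h: group_hom G M \<phi>
      using M(3) by (simp add: group_hom_def group_hom_axioms_def is_group)
    let ?K = "{z \<in> carrier G. \<phi> z \<in> {\<one>\<^bsub>M\<^esub>}}"
    have "pnormal p G ?K" using h.pnormal_vimage h.H.pnormal_trivial[OF p M(1,2)] by blast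
    moreover have "inv y \<otimes> (g \<otimes> x \<otimes> inv g) \<notin> ?K" if g: "g \<in> carrier G" for g
    proof
      assume "inv y \<otimes> (g \<otimes> x \<otimes> inv g) \<in> ?K"
      then have "inv\<^bsub>M\<^esub> \<phi> y \<otimes>\<^bsub>M\<^esub> (\<phi> g \<otimes>\<^bsub>M\<^esub> \<phi> x \<otimes>\<^bsub>M\<^esub> inv\<^bsub>M\<^esub> \<phi> g) = \<one>\<^bsub>M\<^esub>"
        using g x y by simp
      then have "\<phi> y \<otimes>\<^bsub>M\<^esub> (inv\<^bsub>M\<^esub> \<phi> y \<otimes>\<^bsub>M\<^esub> (\<phi> g \<otimes>\<^bsub>M\<^esub> \<phi> x \<otimes>\<^bsub>M\<^esub> inv\<^bsub>M\<^esub> \<phi> g)) = \<phi> y \<otimes>\<^bsub>M\<^esub> \<one>\<^bsub>M\<^esub>"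
        by simp
      then have "\<phi> y = \<phi> g \<otimes>\<^bsub>M\<^esub> \<phi> x \<otimes>\<^bsub>M\<^esub> inv\<^bsub>M\<^esub> \<phi> g" using g x y by simp
      then show False using nc g by (auto simp: conjugate_def)
    qed
    ultimately show ?R by blast
  next
    assume ?R
    then obtain K where K: "pnormal p G K" "\<And>g. g \<in> carrier G \<Longrightarrow> inv y \<otimes> (g \<otimes> x \<otimes> inv g) \<notin> K"
      by blast
    have n: "K \<lhd> G" "finite (rcosets K)" using K by (auto simp: pnormal_def)
    obtain M :: "nat monoid" and \<phi> where M: "group M" "finite (carrier M)" "\<phi> \<in> hom G M"
      "carrier M = \<phi> ` carrier G" "\<And>x. x \<in> carrier G \<Longrightarrow> \<phi> x = \<one>\<^bsub>M\<^esub> \<longleftrightarrow> x \<in> K"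
      using ex_nat_quotient[OF n] by metis
    interpret h: group_hom G M \<phi>
      using M by (simp add: group_hom_def group_hom_axioms_def is_group)
    have "\<exists>n::nat. z [^]\<^bsub>M\<^esub> (p ^ n) = \<one>\<^bsub>M\<^esub>" if z: "z \<in> carrier M" for z
    proof -
      obtain g where g: "g \<in> carrier G" "z = \<phi> g" using z M(4) by blast
      moreover obtain n :: nat where "g [^] (p ^ n) \<in> K" using K g by (auto simp: pnormal_def)
      ultimately have "z [^]\<^bsub>M\<^esub> (p ^ n) = \<one>\<^bsub>M\<^esub>" using M(5) by (simp flip: h.hom_nat_pow)
      then show ?thesis ..
    qed
    then have "p_group p M" using h.H.p_group_iff[OF p] by blast
    moreover have "\<not> conjugate M (\<phi> x) (\<phi> y)"
    proof
      assume "conjugate M (\<phi> x) (\<phi> y)"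
      then obtain g where g: "g \<in> carrier G" "\<phi> y = \<phi> g \<otimes>\<^bsub>M\<^esub> \<phi> x \<otimes>\<^bsub>M\<^esub> inv\<^bsub>M\<^esub> \<phi> g"
        using M(4) by (auto simp: conjugate_def)
      then have "\<phi> (inv y \<otimes> (g \<otimes> x \<otimes> inv g)) = inv\<^bsub>M\<^esub> \<phi> y \<otimes>\<^bsub>M\<^esub> \<phi> y" using x y by simp
      then have "\<phi> (inv y \<otimes> (g \<otimes> x \<otimes> inv g)) = \<one>\<^bsub>M\<^esub>" using y by simp
      moreover have "inv y \<otimes> (g \<otimes> x \<otimes> inv g) \<in> carrier G" using g x y by simp
      ultimately show False using K(2)[OF g(1)] M(5) by blast
    qed
    ultimately show ?L using M by blast
  qed
  then show ?thesis unfolding p_conjugacy_separable_def by blast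
qed

lemma (in group) p_group_Mod_iff:
  assumes p: "Factorial_Ring.prime p" and N: "N \<lhd> G"
  shows "p_group p (G Mod N) \<longleftrightarrow> (\<forall>x \<in> carrier G. \<exists>n::nat. x [^] (p ^ n) \<in> N)"
proof -
  interpret Q: group "G Mod N" using N by (rule normal.factorgroup_is_group)
  have "(N #> x) [^]\<^bsub>G Mod N\<^esub> (n::nat) = \<one>\<^bsub>G Mod N\<^esub> \<longleftrightarrow> x [^] n \<in> N" if "x \<in> carrier G" for x n
    using normal.FactGroup_pow[OF N that, of n] that
      rcos_eq_iff[OF normal_imp_subgroup[OF N], of "x [^] n" \<one>]
      coset_mult_one[OF subgroup.subset[OF normal_imp_subgroup[OF N]]] by simp
  then show ?thesis unfolding Q.p_group_iff[OF p] carrier_FactGroup by simp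
qed

text \<open>Finite quotients of G/N are the finite quotients of \<open>G\<close> whose kernel
  contains \<open>N\<close>.\<close>

lemma (in group) residually_finite_Mod_iff:
  assumes N: "N \<lhd> G"
  shows "residually_finite (G Mod N) \<longleftrightarrow>
    (\<forall>x \<in> carrier G - N. \<exists>T. T \<lhd> G \<and> finite (rcosets T) \<and> N \<subseteq> T \<and> x \<notin> T)" (is "?L \<longleftrightarrow> ?R")
proof -
  have sg: "subgroup N G" using N normal_imp_subgroup by blast
  have grQ: "group (G Mod N)" using N by (rule normal.factorgroup_is_group)
  have one: "N #> x = N \<longleftrightarrow> x \<in> N" if "x \<in> carrier G" for x
    using rcos_eq_iff[OF sg that one_closed] coset_mult_one[OF subgroup.subset[OF sg]] that by simp
  show ?thesis
  proof
    assume L: ?L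
    show ?R
    proof
      fix x assume x: "x \<in> carrier G - N"
      then have "N #> x \<in> carrier (G Mod N)" "N #> x \<noteq> \<one>\<^bsub>G Mod N\<^esub>"
        using one by (auto simp: carrier_FactGroup)
      then obtain M :: "nat monoid" and \<psi> where M: "group M" "finite (carrier M)"
        "\<psi> \<in> hom (G Mod N) M" "\<psi> (N #> x) \<noteq> \<one>\<^bsub>M\<^esub>"
        using L unfolding residually_finite_def by blast
      define \<phi> where "\<phi> = \<psi> \<circ> (\<lambda>a. N #> a)"
      interpret \<psi>: group_hom "G Mod N" M \<psi>
        using M grQ by (simp add: group_hom_def group_hom_axioms_def)
      interpret r: group_hom G "G Mod N" "\<lambda>a. N #> a"
        using normal.r_coset_hom_Mod[OF N] grQ by (simp add: group_hom_def group_hom_axioms_def is_group)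
      have "\<phi> \<in> hom G M"
        by (rule homI) (simp_all add: \<phi>_def del: mult_FactGroup)
      then interpret h: group_hom G M \<phi>
        using M by (simp add: group_hom_def group_hom_axioms_def is_group)
      let ?T = "kernel G M \<phi>"
      have "finite (rcosets ?T)"
      proof (rule finite_rcosets_if_finite_image[OF h.subgroup_kernel, of \<phi>])
        show "finite (\<phi> ` carrier G)" using M(2) h.hom_closed by (meson finite_subset image_subsetI)
      qed (simp add: kernel_def)
      moreover have "N \<subseteq> ?T"
      proof
        fix n assume n: "n \<in> N"
        then have nc: "n \<in> carrier G" using subgroup.mem_carrier[OF sg] by blast
        then have "N #> n = \<one>\<^bsub>G Mod N\<^esub>" using one n by simp
        then have "\<phi> n = \<one>\<^bsub>M\<^esub>" by (simp add: \<phi>_def del: one_FactGroup)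
        then show "n \<in> ?T" using nc by (simp add: kernel_def)
      qed
      moreover have "x \<notin> ?T" using M(4) by (simp add: kernel_def \<phi>_def)
      ultimately show "\<exists>T. T \<lhd> G \<and> finite (rcosets T) \<and> N \<subseteq> T \<and> x \<notin> T"
        using h.normal_kernel by blast
    qed
  next
    assume R: ?R
    show ?L
      unfolding residually_finite_def
    proof (intro ballI impI)
      fix c assume "c \<in> carrier (G Mod N)" "c \<noteq> \<one>\<^bsub>G Mod N\<^esub>"
      then obtain x where x: "x \<in> carrier G" "c = N #> x" "x \<notin> N"
        using one by (auto simp: carrier_FactGroup)
      then obtain T where T: "T \<lhd> G" "finite (rcosets T)" "N \<subseteq> T" "x \<notin> T" using R by blast
      obtain M :: "nat monoid" and \<phi> where M: "group M" "finite (carrier M)" "\<phi> \<in> hom G M"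
        "carrier M = \<phi> ` carrier G" "\<And>x. x \<in> carrier G \<Longrightarrow> \<phi> x = \<one>\<^bsub>M\<^esub> \<longleftrightarrow> x \<in> T"
        using ex_nat_quotient[OF T(1,2)] by metis
      interpret h: group_hom G M \<phi>
        using M by (simp add: group_hom_def group_hom_axioms_def is_group)
      have "\<phi> a = \<phi> b" if ab: "a \<in> carrier G" "b \<in> carrier G" "N #> a = N #> b" for a b
      proof -
        have "a \<otimes> inv b \<in> T" using rcos_eq_iff[OF sg ab(1,2)] ab(3) T(3) by auto
        moreover have "a \<otimes> inv b \<in> carrier G" using ab by simp
        ultimately have "\<phi> (a \<otimes> inv b) = \<one>\<^bsub>M\<^esub>" using M(5) by blast
        then have "\<phi> a \<otimes>\<^bsub>M\<^esub> inv\<^bsub>M\<^esub> \<phi> b \<otimes>\<^bsub>M\<^esub> \<phi> b = \<one>\<^bsub>M\<^esub> \<otimes>\<^bsub>M\<^esub> \<phi> b" using ab by simp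
        then show ?thesis using ab by (simp add: h.H.m_assoc)
      qed
      then obtain \<psi> where \<psi>: "\<psi> \<in> hom (G Mod N) M" "\<And>x. x \<in> carrier G \<Longrightarrow> \<psi> (N #> x) = \<phi> x"
        using FactGroup_universal[OF M(3) N] by metis
      have "\<psi> c \<noteq> \<one>\<^bsub>M\<^esub>" using \<psi>(2) x T(4) M(5) by simp
      then show "\<exists>(M :: nat monoid) \<phi>. group M \<and> finite (carrier M) \<and> \<phi> \<in> hom (G Mod N) M \<and> \<phi> c \<noteq> \<one>\<^bsub>M\<^esub>"
        using M \<psi>(1) by blast
    qed
  qed
qed

section \<open>Subdirect products\<close>

locale subdirect = F\<^sub>1: group F\<^sub>1 + F\<^sub>2: group F\<^sub>2
  for F\<^sub>1 :: "('a, 'c) monoid_scheme" and F\<^sub>2 :: "('b, 'd) monoid_scheme" +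
  fixes G :: "('a \<times> 'b) set"
  assumes subdirect: "subdirect_product F\<^sub>1 F\<^sub>2 G"
begin

abbreviation P where "P \<equiv> (F\<^sub>1 \<times>\<times> F\<^sub>2)\<lparr>carrier := G\<rparr>"
abbreviation N\<^sub>1 where "N\<^sub>1 \<equiv> inter_fst F\<^sub>1 F\<^sub>2 G"
abbreviation N\<^sub>2 where "N\<^sub>2 \<equiv> inter_snd F\<^sub>1 F\<^sub>2 G"

lemma subgroup_G: "subgroup G (F\<^sub>1 \<times>\<times> F\<^sub>2)"
  using subdirect by (simp add: subdirect_product_def)

lemma group_P: "group P"
  using subgroup.subgroup_is_group[OF subgroup_G DirProd_group[OF F\<^sub>1.is_group F\<^sub>2.is_group]] .

sublocale P: group P
  by (rule group_P)

lemma closed: "(a, b) \<in> G \<Longrightarrow> a \<in> carrier F\<^sub>1" "(a, b) \<in> G \<Longrightarrow> b \<in> carrier F\<^sub>2"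
  using subgroup.subset[OF subgroup_G] by auto

lemma lift_fst:
  assumes "a \<in> carrier F\<^sub>1" shows "\<exists>b. (a, b) \<in> G"
proof -
  have "a \<in> fst ` G" using assms subdirect by (simp add: subdirect_product_def)
  then show ?thesis by auto
qed

lemma lift_snd:
  assumes "b \<in> carrier F\<^sub>2" shows "\<exists>a. (a, b) \<in> G"
proof -
  have "b \<in> snd ` G" using assms subdirect by (simp add: subdirect_product_def)
  then show ?thesis by auto
qed

lemma mult_mem: "(a, b) \<in> G \<Longrightarrow> (c, d) \<in> G \<Longrightarrow> (a \<otimes>\<^bsub>F\<^sub>1\<^esub> c, b \<otimes>\<^bsub>F\<^sub>2\<^esub> d) \<in> G"
  using subgroup.m_closed[OF subgroup_G, of "(a, b)" "(c, d)"] by simp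

lemma inv_P:
  assumes "(a, b) \<in> G"
  shows "inv\<^bsub>P\<^esub> (a, b) = (inv\<^bsub>F\<^sub>1\<^esub> a, inv\<^bsub>F\<^sub>2\<^esub> b)"
  using group.m_inv_consistent[OF DirProd_group[OF F\<^sub>1.is_group F\<^sub>2.is_group] subgroup_G assms]
    inv_DirProd[OF F\<^sub>1.is_group F\<^sub>2.is_group closed(1)[OF assms] closed(2)[OF assms]] by simp

lemma inv_mem: "(a, b) \<in> G \<Longrightarrow> (inv\<^bsub>F\<^sub>1\<^esub> a, inv\<^bsub>F\<^sub>2\<^esub> b) \<in> G"
  using P.inv_closed[of "(a, b)"] by (simp add: inv_P)

lemma pow_P: "(a, b) [^]\<^bsub>P\<^esub> (n::nat) = (a [^]\<^bsub>F\<^sub>1\<^esub> n, b [^]\<^bsub>F\<^sub>2\<^esub> n)"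
  by (induction n) simp_all

lemma pow_mem: "(a, b) \<in> G \<Longrightarrow> (a [^]\<^bsub>F\<^sub>1\<^esub> (n::nat), b [^]\<^bsub>F\<^sub>2\<^esub> n) \<in> G"
  using P.nat_pow_closed[of "(a, b)" n] by (simp add: pow_P)

lemma int_pow_mem:
  assumes "(a, b) \<in> G" shows "(a [^]\<^bsub>F\<^sub>1\<^esub> (k::int), b [^]\<^bsub>F\<^sub>2\<^esub> k) \<in> G"
proof (cases k rule: int_cases2)
  case (nonneg n)
  then show ?thesis using pow_mem[OF assms] by (simp add: int_pow_int)
next
  case (nonpos n)
  then show ?thesis
    using inv_mem[OF pow_mem[OF assms]] closed[OF assms]
    by (simp add: F\<^sub>1.int_pow_neg_int F\<^sub>2.int_pow_neg_int)
qed

lemma one_mem: "(\<one>\<^bsub>F\<^sub>1\<^esub>, \<one>\<^bsub>F\<^sub>2\<^esub>) \<in> G"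
  using P.one_closed by simp

lemma mem_N\<^sub>1: "x \<in> N\<^sub>1 \<longleftrightarrow> (x, \<one>\<^bsub>F\<^sub>2\<^esub>) \<in> G"
  and mem_N\<^sub>2: "y \<in> N\<^sub>2 \<longleftrightarrow> (\<one>\<^bsub>F\<^sub>1\<^esub>, y) \<in> G"
  using closed(1)[of x "\<one>\<^bsub>F\<^sub>2\<^esub>"] closed(2)[of "\<one>\<^bsub>F\<^sub>1\<^esub>" y]
  by (auto simp: inter_fst_def inter_snd_def)

lemma N\<^sub>1_normal: "N\<^sub>1 \<lhd> F\<^sub>1"
proof -
  have "subgroup N\<^sub>1 F\<^sub>1"
  proof
    show "N\<^sub>1 \<subseteq> carrier F\<^sub>1" by (auto simp: inter_fst_def inter_snd_def)
    show "\<one>\<^bsub>F\<^sub>1\<^esub> \<in> N\<^sub>1" using one_mem by (simp add: mem_N\<^sub>1)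
    show "x \<otimes>\<^bsub>F\<^sub>1\<^esub> y \<in> N\<^sub>1" if "x \<in> N\<^sub>1" "y \<in> N\<^sub>1" for x y
      using that mult_mem[of x "\<one>\<^bsub>F\<^sub>2\<^esub>" y "\<one>\<^bsub>F\<^sub>2\<^esub>"] by (simp add: mem_N\<^sub>1)
    show "inv\<^bsub>F\<^sub>1\<^esub> x \<in> N\<^sub>1" if "x \<in> N\<^sub>1" for x
      using that inv_mem[of x "\<one>\<^bsub>F\<^sub>2\<^esub>"] by (simp add: mem_N\<^sub>1)
  qed
  moreover have "x \<otimes>\<^bsub>F\<^sub>1\<^esub> h \<otimes>\<^bsub>F\<^sub>1\<^esub> inv\<^bsub>F\<^sub>1\<^esub> x \<in> N\<^sub>1" if x: "x \<in> carrier F\<^sub>1" and h: "h \<in> N\<^sub>1" for x h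
  proof -
    obtain z where z: "(x, z) \<in> G" using lift_fst x by blast
    show ?thesis using mult_mem[OF mult_mem[OF z] inv_mem[OF z], of h "\<one>\<^bsub>F\<^sub>2\<^esub>"] h closed[OF z]
      by (simp add: mem_N\<^sub>1)
  qed
  ultimately show ?thesis by (simp add: F\<^sub>1.normal_inv_iff)
qed

lemma N\<^sub>2_normal: "N\<^sub>2 \<lhd> F\<^sub>2"
proof -
  have "subgroup N\<^sub>2 F\<^sub>2"
  proof
    show "N\<^sub>2 \<subseteq> carrier F\<^sub>2" by (auto simp: inter_fst_def inter_snd_def)
    show "\<one>\<^bsub>F\<^sub>2\<^esub> \<in> N\<^sub>2" using one_mem by (simp add: mem_N\<^sub>2)
    show "x \<otimes>\<^bsub>F\<^sub>2\<^esub> y \<in> N\<^sub>2" if "x \<in> N\<^sub>2" "y \<in> N\<^sub>2" for x y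
      using that mult_mem[of "\<one>\<^bsub>F\<^sub>1\<^esub>" x "\<one>\<^bsub>F\<^sub>1\<^esub>" y] by (simp add: mem_N\<^sub>2)
    show "inv\<^bsub>F\<^sub>2\<^esub> x \<in> N\<^sub>2" if "x \<in> N\<^sub>2" for x
      using that inv_mem[of "\<one>\<^bsub>F\<^sub>1\<^esub>" x] by (simp add: mem_N\<^sub>2)
  qed
  moreover have "x \<otimes>\<^bsub>F\<^sub>2\<^esub> h \<otimes>\<^bsub>F\<^sub>2\<^esub> inv\<^bsub>F\<^sub>2\<^esub> x \<in> N\<^sub>2" if x: "x \<in> carrier F\<^sub>2" and h: "h \<in> N\<^sub>2" for x h
  proof -
    obtain z where z: "(z, x) \<in> G" using lift_snd x by blast
    show ?thesis using mult_mem[OF mult_mem[OF z] inv_mem[OF z], of "\<one>\<^bsub>F\<^sub>1\<^esub>" h] h closed[OF z]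
      by (simp add: mem_N\<^sub>2)
  qed
  ultimately show ?thesis by (simp add: F\<^sub>2.normal_inv_iff)
qed

text \<open>\<open>G\<close> identifies F1/N1 with F2/N2 (Goursat), and this is the form in which
  the identification is used: dividing (a, b) by (a, 1) gives (1, b).\<close>

lemma fst_snd_mem_iff:
  assumes "(a, b) \<in> G" shows "a \<in> N\<^sub>1 \<longleftrightarrow> b \<in> N\<^sub>2"
proof
  assume "a \<in> N\<^sub>1"
  then show "b \<in> N\<^sub>2"
    using mult_mem[OF inv_mem assms, of a "\<one>\<^bsub>F\<^sub>2\<^esub>"] closed[OF assms] by (simp add: mem_N\<^sub>1 mem_N\<^sub>2)
next
  assume "b \<in> N\<^sub>2"
  then show "a \<in> N\<^sub>1"
    using mult_mem[OF inv_mem assms, of "\<one>\<^bsub>F\<^sub>1\<^esub>" b] closed[OF assms] by (simp add: mem_N\<^sub>1 mem_N\<^sub>2)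
qed

lemma pnormal_P:
  assumes "pnormal p F\<^sub>1 M\<^sub>1" "pnormal p F\<^sub>2 M\<^sub>2"
  shows "pnormal p P {g \<in> G. fst g \<in> M\<^sub>1 \<and> snd g \<in> M\<^sub>2}"
proof -
  interpret f: group_hom P F\<^sub>1 fst
    by unfold_locales (auto intro!: homI dest: closed)
  interpret s: group_hom P F\<^sub>2 snd
    by unfold_locales (auto intro!: homI dest: closed)
  have "{g \<in> carrier P. fst g \<in> M\<^sub>1} \<inter> {g \<in> carrier P. snd g \<in> M\<^sub>2} = {g \<in> G. fst g \<in> M\<^sub>1 \<and> snd g \<in> M\<^sub>2}"
    by auto
  then show ?thesis
    using P.pnormal_Int[OF f.pnormal_vimage[OF assms(1)] s.pnormal_vimage[OF assms(2)]] by simp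
qed

text \<open>\<open>?U\<close> is the full preimage in F2 of the image of \<open>T\<close> in the
  common quotient; lifts along \<open>G\<close> carry normality, finite index and p-power exponents
  over.\<close>

lemma pnormal_transfer:
  assumes T: "pnormal p F\<^sub>1 T"
  shows "pnormal p F\<^sub>2 {b \<in> carrier F\<^sub>2. \<exists>a \<in> T. (a, b) \<in> G}" (is "pnormal p F\<^sub>2 ?U")
proof -
  have n: "T \<lhd> F\<^sub>1" and sg: "subgroup T F\<^sub>1" using T by (auto simp: pnormal_def normal_imp_subgroup)
  have U: "subgroup ?U F\<^sub>2"
  proof
    show "\<one>\<^bsub>F\<^sub>2\<^esub> \<in> ?U" using one_mem subgroup.one_closed[OF sg] by auto
  next
    fix x y assume "x \<in> ?U" "y \<in> ?U"
    then show "x \<otimes>\<^bsub>F\<^sub>2\<^esub> y \<in> ?U" using mult_mem subgroup.m_closed[OF sg] by fastforce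
  next
    fix x assume "x \<in> ?U"
    then show "inv\<^bsub>F\<^sub>2\<^esub> x \<in> ?U" using inv_mem subgroup.m_inv_closed[OF sg] by fastforce
  qed auto
  have "x \<otimes>\<^bsub>F\<^sub>2\<^esub> h \<otimes>\<^bsub>F\<^sub>2\<^esub> inv\<^bsub>F\<^sub>2\<^esub> x \<in> ?U" if x: "x \<in> carrier F\<^sub>2" and h: "h \<in> ?U" for x h
  proof -
    obtain z a where z: "(z, x) \<in> G" and a: "a \<in> T" "(a, h) \<in> G" using lift_snd x h by blast
    have "z \<otimes>\<^bsub>F\<^sub>1\<^esub> a \<otimes>\<^bsub>F\<^sub>1\<^esub> inv\<^bsub>F\<^sub>1\<^esub> z \<in> T" using F\<^sub>1.normal_conj_mem(1)[OF n closed(1)[OF z] a(1)] .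
    then show ?thesis using mult_mem[OF mult_mem[OF z a(2)] inv_mem[OF z]] closed by blast
  qed
  then have "?U \<lhd> F\<^sub>2" using U by (simp add: F\<^sub>2.normal_inv_iff)
  moreover have "finite (rcosets\<^bsub>F\<^sub>2\<^esub> ?U)"
  proof -
    define f where "f b = (SOME a. (a, b) \<in> G)" for b
    have f: "(f b, b) \<in> G" if "b \<in> carrier F\<^sub>2" for b
      unfolding f_def using lift_snd[OF that] by (rule someI_ex)
    show ?thesis
    proof (rule F\<^sub>2.finite_rcosets_if_finite_image[OF U, of "\<lambda>b. T #>\<^bsub>F\<^sub>1\<^esub> f b"])
      have "(\<lambda>b. T #>\<^bsub>F\<^sub>1\<^esub> f b) ` carrier F\<^sub>2 \<subseteq> rcosets\<^bsub>F\<^sub>1\<^esub> T"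
        unfolding RCOSETS_def using closed(1)[OF f] by blast
      then show "finite ((\<lambda>b. T #>\<^bsub>F\<^sub>1\<^esub> f b) ` carrier F\<^sub>2)"
        using T finite_subset by (auto simp: pnormal_def)
    next
      fix x y assume xy: "x \<in> carrier F\<^sub>2" "y \<in> carrier F\<^sub>2" "T #>\<^bsub>F\<^sub>1\<^esub> f x = T #>\<^bsub>F\<^sub>1\<^esub> f y"
      have "f x \<otimes>\<^bsub>F\<^sub>1\<^esub> inv\<^bsub>F\<^sub>1\<^esub> f y \<in> T"
        using F\<^sub>1.rcos_eq_iff[OF sg] xy f closed by blast
      moreover have "(f x \<otimes>\<^bsub>F\<^sub>1\<^esub> inv\<^bsub>F\<^sub>1\<^esub> f y, x \<otimes>\<^bsub>F\<^sub>2\<^esub> inv\<^bsub>F\<^sub>2\<^esub> y) \<in> G"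
        using mult_mem[OF f inv_mem[OF f]] xy by blast
      ultimately show "x \<otimes>\<^bsub>F\<^sub>2\<^esub> inv\<^bsub>F\<^sub>2\<^esub> y \<in> ?U" using xy by auto
    qed
  qed
  moreover have "\<exists>n::nat. b [^]\<^bsub>F\<^sub>2\<^esub> (p ^ n) \<in> ?U" if b: "b \<in> carrier F\<^sub>2" for b
  proof -
    obtain a where a: "(a, b) \<in> G" using lift_snd b by blast
    obtain n :: nat where "a [^]\<^bsub>F\<^sub>1\<^esub> (p ^ n) \<in> T" using T closed(1)[OF a] by (auto simp: pnormal_def)
    then show ?thesis using pow_mem[OF a] b by blast
  qed
  ultimately show ?thesis by (simp add: pnormal_def)
qed

lemma conjugate_P_iff:
  assumes "(x\<^sub>1, x\<^sub>2) \<in> G"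
  shows "conjugate P (x\<^sub>1, x\<^sub>2) (y\<^sub>1, y\<^sub>2) \<longleftrightarrow>
    (\<exists>(h\<^sub>1, h\<^sub>2) \<in> G. y\<^sub>1 = h\<^sub>1 \<otimes>\<^bsub>F\<^sub>1\<^esub> x\<^sub>1 \<otimes>\<^bsub>F\<^sub>1\<^esub> inv\<^bsub>F\<^sub>1\<^esub> h\<^sub>1 \<and> y\<^sub>2 = h\<^sub>2 \<otimes>\<^bsub>F\<^sub>2\<^esub> x\<^sub>2 \<otimes>\<^bsub>F\<^sub>2\<^esub> inv\<^bsub>F\<^sub>2\<^esub> h\<^sub>2)"
  by (force simp: conjugate_def inv_P)

end

section \<open>From a residually finite p-quotient to separability\<close>

locale free_subdirect =
  F\<^sub>1: based_free_group F\<^sub>1 S\<^sub>1 + F\<^sub>2: based_free_group F\<^sub>2 S\<^sub>2 + subdirect F\<^sub>1 F\<^sub>2 G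
  for F\<^sub>1 :: "('a, 'c) monoid_scheme" and S\<^sub>1 :: "'a set"
    and F\<^sub>2 :: "('b, 'd) monoid_scheme" and S\<^sub>2 :: "'b set" and G :: "('a \<times> 'b) set"
begin

definition conjugators\<^sub>1 :: "'a \<Rightarrow> 'a \<Rightarrow> 'a set" where
  "conjugators\<^sub>1 x y = {h \<in> carrier F\<^sub>1. y = h \<otimes>\<^bsub>F\<^sub>1\<^esub> x \<otimes>\<^bsub>F\<^sub>1\<^esub> inv\<^bsub>F\<^sub>1\<^esub> h}"

definition conjugators\<^sub>2 :: "'b \<Rightarrow> 'b \<Rightarrow> 'b set" where
  "conjugators\<^sub>2 x y = {h \<in> carrier F\<^sub>2. y = h \<otimes>\<^bsub>F\<^sub>2\<^esub> x \<otimes>\<^bsub>F\<^sub>2\<^esub> inv\<^bsub>F\<^sub>2\<^esub> h}"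

text \<open>The elements of \<open>F\<^sub>1\<close> by which pairs of conjugators in the two factors fail to lie in \<open>G\<close>.\<close>

definition defect :: "'a \<times> 'b \<Rightarrow> 'a \<times> 'b \<Rightarrow> 'a set" where
  "defect x y = {inv\<^bsub>F\<^sub>1\<^esub> h\<^sub>1 \<otimes>\<^bsub>F\<^sub>1\<^esub> f | h\<^sub>1 f h\<^sub>2.
     h\<^sub>1 \<in> conjugators\<^sub>1 (fst x) (fst y) \<and> h\<^sub>2 \<in> conjugators\<^sub>2 (snd x) (snd y) \<and> (f, h\<^sub>2) \<in> G}"

text \<open>The pair (f, h2) lies in \<open>G\<close>, and dividing f by the defect gives h1; a
  defect in \<open>N\<^sub>1\<close> would therefore put (h1, h2) in \<open>G\<close>.\<close>

lemma defect_disjoint: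
  assumes x: "x \<in> G" and nc: "\<not> conjugate P x y" and e: "e \<in> defect x y"
  shows "e \<in> carrier F\<^sub>1 - N\<^sub>1"
proof -
  obtain h\<^sub>1 f h\<^sub>2 where h: "e = inv\<^bsub>F\<^sub>1\<^esub> h\<^sub>1 \<otimes>\<^bsub>F\<^sub>1\<^esub> f" "h\<^sub>1 \<in> conjugators\<^sub>1 (fst x) (fst y)"
    "h\<^sub>2 \<in> conjugators\<^sub>2 (snd x) (snd y)" "(f, h\<^sub>2) \<in> G"
    using e unfolding defect_def by blast
  have c: "h\<^sub>1 \<in> carrier F\<^sub>1" "f \<in> carrier F\<^sub>1" "h\<^sub>2 \<in> carrier F\<^sub>2"
    using h closed by (auto simp: conjugators\<^sub>1_def)
  have False if "e \<in> N\<^sub>1"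
  proof -
    have "(inv\<^bsub>F\<^sub>1\<^esub> e, \<one>\<^bsub>F\<^sub>2\<^esub>) \<in> G" using inv_mem[of e "\<one>\<^bsub>F\<^sub>2\<^esub>"] that by (simp add: mem_N\<^sub>1)
    then have "(f \<otimes>\<^bsub>F\<^sub>1\<^esub> inv\<^bsub>F\<^sub>1\<^esub> e, h\<^sub>2 \<otimes>\<^bsub>F\<^sub>2\<^esub> \<one>\<^bsub>F\<^sub>2\<^esub>) \<in> G" using mult_mem h(4) by blast
    then have "(h\<^sub>1, h\<^sub>2) \<in> G" using c by (simp add: h(1) F\<^sub>1.inv_mult_group)
    then have "conjugate P (fst x, snd x) (fst y, snd y)"
      using h(2,3) x by (subst conjugate_P_iff) (auto simp: conjugators\<^sub>1_def conjugators\<^sub>2_def)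
    then show False using nc by simp
  qed
  moreover have "e \<in> carrier F\<^sub>1" using h(1) c by simp
  ultimately show ?thesis by blast
qed

text \<open>All conjugators arise from one pair k1, k2 by elements of the centralizers of the two
  components, and these have finite images modulo \<open>N\<^sub>1\<close> and
  \<open>N\<^sub>2\<close>. Neither component is trivial: a trivial one is fixed by every
  conjugation, so a lift of the other conjugator would already conjugate in
  \<open>G\<close>.\<close>

lemma defect_finite_mod:
  assumes x: "x \<in> G" and y: "y \<in> G" and nc: "\<not> conjugate P x y"
    and per: "\<And>a. a \<in> carrier F\<^sub>1 \<Longrightarrow> \<exists>n>0. a [^]\<^bsub>F\<^sub>1\<^esub> (n::nat) \<in> N\<^sub>1"
  shows "\<exists>B. finite B \<and> B \<subseteq> carrier F\<^sub>1 \<and> (\<forall>e \<in> defect x y. \<exists>b \<in> B. e \<otimes>\<^bsub>F\<^sub>1\<^esub> inv\<^bsub>F\<^sub>1\<^esub> b \<in> N\<^sub>1)"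
proof -
  let ?H\<^sub>1 = "conjugators\<^sub>1 (fst x) (fst y)" and ?H\<^sub>2 = "conjugators\<^sub>2 (snd x) (snd y)"
  obtain x\<^sub>1 x\<^sub>2 y\<^sub>1 y\<^sub>2 where xy: "x = (x\<^sub>1, x\<^sub>2)" "y = (y\<^sub>1, y\<^sub>2)" by (cases x, cases y)
  have xc: "x\<^sub>1 \<in> carrier F\<^sub>1" "x\<^sub>2 \<in> carrier F\<^sub>2" using x closed xy by auto
  show ?thesis
  proof (cases "?H\<^sub>1 = {} \<or> ?H\<^sub>2 = {}")
    case True
    then have "defect x y = {}" by (auto simp: defect_def)
    then show ?thesis by (intro exI[of _ "{}"]) simp
  next
    case False
    then obtain k\<^sub>1 k\<^sub>2 where k: "k\<^sub>1 \<in> ?H\<^sub>1" "k\<^sub>2 \<in> ?H\<^sub>2" by blast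
    then have kc: "k\<^sub>1 \<in> carrier F\<^sub>1" "k\<^sub>2 \<in> carrier F\<^sub>2"
      and ky: "y\<^sub>1 = k\<^sub>1 \<otimes>\<^bsub>F\<^sub>1\<^esub> x\<^sub>1 \<otimes>\<^bsub>F\<^sub>1\<^esub> inv\<^bsub>F\<^sub>1\<^esub> k\<^sub>1" "y\<^sub>2 = k\<^sub>2 \<otimes>\<^bsub>F\<^sub>2\<^esub> x\<^sub>2 \<otimes>\<^bsub>F\<^sub>2\<^esub> inv\<^bsub>F\<^sub>2\<^esub> k\<^sub>2"
      by (auto simp: conjugators\<^sub>1_def conjugators\<^sub>2_def xy)
    have nc': "\<not> (\<exists>(h\<^sub>1, h\<^sub>2) \<in> G. y\<^sub>1 = h\<^sub>1 \<otimes>\<^bsub>F\<^sub>1\<^esub> x\<^sub>1 \<otimes>\<^bsub>F\<^sub>1\<^esub> inv\<^bsub>F\<^sub>1\<^esub> h\<^sub>1 \<and> y\<^sub>2 = h\<^sub>2 \<otimes>\<^bsub>F\<^sub>2\<^esub> x\<^sub>2 \<otimes>\<^bsub>F\<^sub>2\<^esub> inv\<^bsub>F\<^sub>2\<^esub> h\<^sub>2)"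
      using nc x conjugate_P_iff[of x\<^sub>1 x\<^sub>2 y\<^sub>1 y\<^sub>2] by (simp add: xy)
    have x\<^sub>1: "x\<^sub>1 \<noteq> \<one>\<^bsub>F\<^sub>1\<^esub>"
    proof
      assume 1: "x\<^sub>1 = \<one>\<^bsub>F\<^sub>1\<^esub>"
      obtain f where f: "(f, k\<^sub>2) \<in> G" using lift_snd kc(2) by blast
      have "y\<^sub>1 = f \<otimes>\<^bsub>F\<^sub>1\<^esub> x\<^sub>1 \<otimes>\<^bsub>F\<^sub>1\<^esub> inv\<^bsub>F\<^sub>1\<^esub> f" using closed(1)[OF f] kc(1) by (simp add: ky(1) 1)
      then show False using nc' f ky(2) by blast
    qed
    have x\<^sub>2: "x\<^sub>2 \<noteq> \<one>\<^bsub>F\<^sub>2\<^esub>"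
    proof
      assume 1: "x\<^sub>2 = \<one>\<^bsub>F\<^sub>2\<^esub>"
      obtain f where f: "(k\<^sub>1, f) \<in> G" using lift_fst kc(1) by blast
      have "y\<^sub>2 = f \<otimes>\<^bsub>F\<^sub>2\<^esub> x\<^sub>2 \<otimes>\<^bsub>F\<^sub>2\<^esub> inv\<^bsub>F\<^sub>2\<^esub> f" using closed(2)[OF f] kc(2) by (simp add: ky(2) 1)
      then show False using nc' f ky(1) by blast
    qed
    have per\<^sub>2: "\<exists>n>0. b [^]\<^bsub>F\<^sub>2\<^esub> (n::nat) \<in> N\<^sub>2" if b: "b \<in> carrier F\<^sub>2" for b
    proof -
      obtain a where a: "(a, b) \<in> G" using lift_snd b by blast
      then obtain n :: nat where "n > 0" "a [^]\<^bsub>F\<^sub>1\<^esub> n \<in> N\<^sub>1" using per[OF closed(1)[OF a]] by blast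
      then show ?thesis using fst_snd_mem_iff[OF pow_mem[OF a]] by blast
    qed
    obtain B\<^sub>1 where B\<^sub>1: "finite B\<^sub>1" "B\<^sub>1 \<subseteq> carrier F\<^sub>1"
      "\<forall>c \<in> carrier F\<^sub>1. c \<otimes>\<^bsub>F\<^sub>1\<^esub> x\<^sub>1 = x\<^sub>1 \<otimes>\<^bsub>F\<^sub>1\<^esub> c \<longrightarrow> (\<exists>b \<in> B\<^sub>1. c \<otimes>\<^bsub>F\<^sub>1\<^esub> inv\<^bsub>F\<^sub>1\<^esub> b \<in> N\<^sub>1)"
      using F\<^sub>1.centralizer_finite_mod[OF xc(1) x\<^sub>1 N\<^sub>1_normal per] by auto
    obtain B\<^sub>2 where B\<^sub>2: "finite B\<^sub>2" "B\<^sub>2 \<subseteq> carrier F\<^sub>2"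
      "\<forall>c \<in> carrier F\<^sub>2. c \<otimes>\<^bsub>F\<^sub>2\<^esub> x\<^sub>2 = x\<^sub>2 \<otimes>\<^bsub>F\<^sub>2\<^esub> c \<longrightarrow> (\<exists>b \<in> B\<^sub>2. c \<otimes>\<^bsub>F\<^sub>2\<^esub> inv\<^bsub>F\<^sub>2\<^esub> b \<in> N\<^sub>2)"
      using F\<^sub>2.centralizer_finite_mod[OF xc(2) x\<^sub>2 N\<^sub>2_normal per\<^sub>2] by auto
    have "\<forall>b \<in> B\<^sub>2. \<exists>a. (a, k\<^sub>2 \<otimes>\<^bsub>F\<^sub>2\<^esub> b) \<in> G" using lift_snd kc B\<^sub>2(2) by auto
    then obtain \<beta> where \<beta>: "\<forall>b \<in> B\<^sub>2. (\<beta> b, k\<^sub>2 \<otimes>\<^bsub>F\<^sub>2\<^esub> b) \<in> G" using bchoice by meson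
    then have \<beta>c: "\<beta> b \<in> carrier F\<^sub>1" if "b \<in> B\<^sub>2" for b using closed(1) that by blast
    define B where "B = (\<lambda>(b\<^sub>1, b\<^sub>2). inv\<^bsub>F\<^sub>1\<^esub> b\<^sub>1 \<otimes>\<^bsub>F\<^sub>1\<^esub> (inv\<^bsub>F\<^sub>1\<^esub> k\<^sub>1 \<otimes>\<^bsub>F\<^sub>1\<^esub> \<beta> b\<^sub>2)) ` (B\<^sub>1 \<times> B\<^sub>2)"
    have "finite B" using B\<^sub>1 B\<^sub>2 by (simp add: B_def)
    moreover have "B \<subseteq> carrier F\<^sub>1" using B\<^sub>1(2) \<beta>c kc by (auto simp: B_def)
    moreover have "\<exists>b \<in> B. e \<otimes>\<^bsub>F\<^sub>1\<^esub> inv\<^bsub>F\<^sub>1\<^esub> b \<in> N\<^sub>1" if e: "e \<in> defect x y" for e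
    proof -
      obtain h\<^sub>1 f h\<^sub>2 where h: "e = inv\<^bsub>F\<^sub>1\<^esub> h\<^sub>1 \<otimes>\<^bsub>F\<^sub>1\<^esub> f" "h\<^sub>1 \<in> ?H\<^sub>1" "h\<^sub>2 \<in> ?H\<^sub>2" "(f, h\<^sub>2) \<in> G"
        using e unfolding defect_def by blast
      have hc: "h\<^sub>1 \<in> carrier F\<^sub>1" "h\<^sub>2 \<in> carrier F\<^sub>2" "f \<in> carrier F\<^sub>1"
        and hy: "y\<^sub>1 = h\<^sub>1 \<otimes>\<^bsub>F\<^sub>1\<^esub> x\<^sub>1 \<otimes>\<^bsub>F\<^sub>1\<^esub> inv\<^bsub>F\<^sub>1\<^esub> h\<^sub>1" "y\<^sub>2 = h\<^sub>2 \<otimes>\<^bsub>F\<^sub>2\<^esub> x\<^sub>2 \<otimes>\<^bsub>F\<^sub>2\<^esub> inv\<^bsub>F\<^sub>2\<^esub> h\<^sub>2"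
        using h closed by (auto simp: conjugators\<^sub>1_def conjugators\<^sub>2_def xy)
      let ?c = "inv\<^bsub>F\<^sub>1\<^esub> k\<^sub>1 \<otimes>\<^bsub>F\<^sub>1\<^esub> h\<^sub>1" and ?d = "inv\<^bsub>F\<^sub>2\<^esub> k\<^sub>2 \<otimes>\<^bsub>F\<^sub>2\<^esub> h\<^sub>2"
      have cc: "?c \<in> carrier F\<^sub>1" "?d \<in> carrier F\<^sub>2" using hc kc by simp_all
      have "?c \<otimes>\<^bsub>F\<^sub>1\<^esub> x\<^sub>1 = inv\<^bsub>F\<^sub>1\<^esub> k\<^sub>1 \<otimes>\<^bsub>F\<^sub>1\<^esub> y\<^sub>1 \<otimes>\<^bsub>F\<^sub>1\<^esub> h\<^sub>1"
        unfolding hy(1) using hc kc xc by (simp add: F\<^sub>1.m_assoc)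
      also have "\<dots> = x\<^sub>1 \<otimes>\<^bsub>F\<^sub>1\<^esub> ?c" unfolding ky(1) using hc kc xc by (simp add: F\<^sub>1.m_assoc)
      finally obtain b\<^sub>1 where b\<^sub>1: "b\<^sub>1 \<in> B\<^sub>1" "?c \<otimes>\<^bsub>F\<^sub>1\<^esub> inv\<^bsub>F\<^sub>1\<^esub> b\<^sub>1 \<in> N\<^sub>1" using B\<^sub>1(3) cc(1) by blast
      have "?d \<otimes>\<^bsub>F\<^sub>2\<^esub> x\<^sub>2 = inv\<^bsub>F\<^sub>2\<^esub> k\<^sub>2 \<otimes>\<^bsub>F\<^sub>2\<^esub> y\<^sub>2 \<otimes>\<^bsub>F\<^sub>2\<^esub> h\<^sub>2"
        unfolding hy(2) using hc kc xc by (simp add: F\<^sub>2.m_assoc)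
      also have "\<dots> = x\<^sub>2 \<otimes>\<^bsub>F\<^sub>2\<^esub> ?d" unfolding ky(2) using hc kc xc by (simp add: F\<^sub>2.m_assoc)
      finally obtain b\<^sub>2 where b\<^sub>2: "b\<^sub>2 \<in> B\<^sub>2" "?d \<otimes>\<^bsub>F\<^sub>2\<^esub> inv\<^bsub>F\<^sub>2\<^esub> b\<^sub>2 \<in> N\<^sub>2" using B\<^sub>2(3) cc(2) by blast
      have bc: "b\<^sub>1 \<in> carrier F\<^sub>1" "b\<^sub>2 \<in> carrier F\<^sub>2" "\<beta> b\<^sub>2 \<in> carrier F\<^sub>1" using b\<^sub>1 b\<^sub>2 B\<^sub>1 B\<^sub>2 \<beta>c by auto
      have "k\<^sub>2 \<otimes>\<^bsub>F\<^sub>2\<^esub> (?d \<otimes>\<^bsub>F\<^sub>2\<^esub> inv\<^bsub>F\<^sub>2\<^esub> b\<^sub>2) \<otimes>\<^bsub>F\<^sub>2\<^esub> inv\<^bsub>F\<^sub>2\<^esub> k\<^sub>2 = h\<^sub>2 \<otimes>\<^bsub>F\<^sub>2\<^esub> inv\<^bsub>F\<^sub>2\<^esub> (k\<^sub>2 \<otimes>\<^bsub>F\<^sub>2\<^esub> b\<^sub>2)"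
        using hc kc bc by (simp add: F\<^sub>2.m_assoc F\<^sub>2.inv_mult_group)
      then have "h\<^sub>2 \<otimes>\<^bsub>F\<^sub>2\<^esub> inv\<^bsub>F\<^sub>2\<^esub> (k\<^sub>2 \<otimes>\<^bsub>F\<^sub>2\<^esub> b\<^sub>2) \<in> N\<^sub>2"
        using F\<^sub>2.normal_conj_mem(1)[OF N\<^sub>2_normal kc(2) b\<^sub>2(2)] by simp
      moreover have "(f \<otimes>\<^bsub>F\<^sub>1\<^esub> inv\<^bsub>F\<^sub>1\<^esub> \<beta> b\<^sub>2, h\<^sub>2 \<otimes>\<^bsub>F\<^sub>2\<^esub> inv\<^bsub>F\<^sub>2\<^esub> (k\<^sub>2 \<otimes>\<^bsub>F\<^sub>2\<^esub> b\<^sub>2)) \<in> G"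
        using mult_mem[OF h(4) inv_mem] \<beta> b\<^sub>2(1) by blast
      ultimately have "f \<otimes>\<^bsub>F\<^sub>1\<^esub> inv\<^bsub>F\<^sub>1\<^esub> \<beta> b\<^sub>2 \<in> N\<^sub>1" using fst_snd_mem_iff by blast
      then have 1: "inv\<^bsub>F\<^sub>1\<^esub> h\<^sub>1 \<otimes>\<^bsub>F\<^sub>1\<^esub> (f \<otimes>\<^bsub>F\<^sub>1\<^esub> inv\<^bsub>F\<^sub>1\<^esub> \<beta> b\<^sub>2) \<otimes>\<^bsub>F\<^sub>1\<^esub> h\<^sub>1 \<in> N\<^sub>1"
        using F\<^sub>1.normal_conj_mem(2)[OF N\<^sub>1_normal hc(1)] by blast
      have "inv\<^bsub>F\<^sub>1\<^esub> b\<^sub>1 \<otimes>\<^bsub>F\<^sub>1\<^esub> ?c \<in> N\<^sub>1"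
        using F\<^sub>1.normal_mult_inv_commute[OF N\<^sub>1_normal cc(1) bc(1)] b\<^sub>1(2) by blast
      then have "inv\<^bsub>F\<^sub>1\<^esub> (inv\<^bsub>F\<^sub>1\<^esub> b\<^sub>1 \<otimes>\<^bsub>F\<^sub>1\<^esub> ?c) \<in> N\<^sub>1"
        using subgroup.m_inv_closed[OF normal_imp_subgroup[OF N\<^sub>1_normal]] by blast
      \<comment> \<open>The first factor corrects the lift \<open>f\<close> to
        \<open>\<beta> b\<^sub>2\<close>, the second replaces the centralizer element
        \<open>?c\<close> by \<open>b\<^sub>1\<close>.\<close>
      with 1 have "(inv\<^bsub>F\<^sub>1\<^esub> h\<^sub>1 \<otimes>\<^bsub>F\<^sub>1\<^esub> (f \<otimes>\<^bsub>F\<^sub>1\<^esub> inv\<^bsub>F\<^sub>1\<^esub> \<beta> b\<^sub>2) \<otimes>\<^bsub>F\<^sub>1\<^esub> h\<^sub>1) \<otimes>\<^bsub>F\<^sub>1\<^esub> inv\<^bsub>F\<^sub>1\<^esub> (inv\<^bsub>F\<^sub>1\<^esub> b\<^sub>1 \<otimes>\<^bsub>F\<^sub>1\<^esub> ?c) \<in> N\<^sub>1"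
        by (rule subgroup.m_closed[OF normal_imp_subgroup[OF N\<^sub>1_normal]])
      also have "(inv\<^bsub>F\<^sub>1\<^esub> h\<^sub>1 \<otimes>\<^bsub>F\<^sub>1\<^esub> (f \<otimes>\<^bsub>F\<^sub>1\<^esub> inv\<^bsub>F\<^sub>1\<^esub> \<beta> b\<^sub>2) \<otimes>\<^bsub>F\<^sub>1\<^esub> h\<^sub>1) \<otimes>\<^bsub>F\<^sub>1\<^esub> inv\<^bsub>F\<^sub>1\<^esub> (inv\<^bsub>F\<^sub>1\<^esub> b\<^sub>1 \<otimes>\<^bsub>F\<^sub>1\<^esub> ?c)
          = e \<otimes>\<^bsub>F\<^sub>1\<^esub> inv\<^bsub>F\<^sub>1\<^esub> (inv\<^bsub>F\<^sub>1\<^esub> b\<^sub>1 \<otimes>\<^bsub>F\<^sub>1\<^esub> (inv\<^bsub>F\<^sub>1\<^esub> k\<^sub>1 \<otimes>\<^bsub>F\<^sub>1\<^esub> \<beta> b\<^sub>2))"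
        using hc kc bc by (simp add: h(1) F\<^sub>1.m_assoc F\<^sub>1.inv_mult_group)
      finally show ?thesis using b\<^sub>1(1) b\<^sub>2(1) by (auto simp: B_def)
    qed
    ultimately show ?thesis by blast
  qed
qed

text \<open>A pair (g1, g2) in \<open>G\<close> that conjugates modulo \<open>?K\<close> is close to
  true conjugators h1, h2. Lifting h2 to a pair (l g1, h2) in \<open>G\<close> with l in
  \<open>T\<close> produces a defect that lies in \<open>T\<close>, but \<open>T\<close> is chosen
  to avoid all defects; this is possible because they are finite in number modulo
  \<open>N\<^sub>1\<close>.\<close>

theorem p_conjugacy_separable_if_residually_finite_p_group:
  assumes p: "Factorial_Ring.prime p"
    and pgr: "p_group p (F\<^sub>1 Mod N\<^sub>1)" and rf: "residually_finite (F\<^sub>1 Mod N\<^sub>1)"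
  shows "p_conjugacy_separable p P"
  unfolding P.p_conjugacy_separable_iff[OF p]
proof (intro ballI impI)
  fix x y assume "x \<in> carrier P" "y \<in> carrier P" and nc: "\<not> conjugate P x y"
  then have xy: "x \<in> G" "y \<in> G" by simp_all
  have p1: "p > 1" using p prime_gt_1_nat by blast
  have pN: "\<exists>n::nat. a [^]\<^bsub>F\<^sub>1\<^esub> (p ^ n) \<in> N\<^sub>1" if "a \<in> carrier F\<^sub>1" for a
    using iffD1[OF F\<^sub>1.p_group_Mod_iff[OF p N\<^sub>1_normal] pgr] that by (rule bspec)
  have sg: "subgroup N\<^sub>1 F\<^sub>1" using N\<^sub>1_normal normal_imp_subgroup by blast
  obtain x\<^sub>1 x\<^sub>2 y\<^sub>1 y\<^sub>2 where eq: "x = (x\<^sub>1, x\<^sub>2)" "y = (y\<^sub>1, y\<^sub>2)" by (cases x, cases y)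
  have c: "x\<^sub>1 \<in> carrier F\<^sub>1" "x\<^sub>2 \<in> carrier F\<^sub>2" "y\<^sub>1 \<in> carrier F\<^sub>1" "y\<^sub>2 \<in> carrier F\<^sub>2"
    using xy closed by (auto simp: eq)
  have per: "\<exists>n>0. a [^]\<^bsub>F\<^sub>1\<^esub> (n::nat) \<in> N\<^sub>1" if a: "a \<in> carrier F\<^sub>1" for a
  proof -
    obtain n :: nat where "a [^]\<^bsub>F\<^sub>1\<^esub> (p ^ n) \<in> N\<^sub>1" using pN[OF a] ..
    then show ?thesis using p1 by (intro exI[of _ "p ^ n"]) simp
  qed
  obtain B where B: "finite B" "B \<subseteq> carrier F\<^sub>1"
    "\<forall>e \<in> defect x y. \<exists>b \<in> B. e \<otimes>\<^bsub>F\<^sub>1\<^esub> inv\<^bsub>F\<^sub>1\<^esub> b \<in> N\<^sub>1"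
    using defect_finite_mod[OF xy nc per] by auto
  have "\<forall>b \<in> B - N\<^sub>1. \<exists>T. T \<lhd> F\<^sub>1 \<and> finite (rcosets\<^bsub>F\<^sub>1\<^esub> T) \<and> N\<^sub>1 \<subseteq> T \<and> b \<notin> T"
  proof
    fix b assume "b \<in> B - N\<^sub>1"
    then have "b \<in> carrier F\<^sub>1 - N\<^sub>1" using B(2) by auto
    with iffD1[OF F\<^sub>1.residually_finite_Mod_iff[OF N\<^sub>1_normal] rf]
    show "\<exists>T. T \<lhd> F\<^sub>1 \<and> finite (rcosets\<^bsub>F\<^sub>1\<^esub> T) \<and> N\<^sub>1 \<subseteq> T \<and> b \<notin> T" by (rule bspec)
  qed
  from bchoice[OF this] obtain t
    where t: "\<forall>b \<in> B - N\<^sub>1. t b \<lhd> F\<^sub>1 \<and> finite (rcosets\<^bsub>F\<^sub>1\<^esub> t b) \<and> N\<^sub>1 \<subseteq> t b \<and> b \<notin> t b" ..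
  \<comment> \<open>Residual finiteness supplies only finite index; the p-power exponents come from
    F1/N1 being a p-group and \<open>t b\<close> containing \<open>N\<^sub>1\<close>.\<close>
  have pt: "pnormal p F\<^sub>1 (t b)" if b: "b \<in> B - N\<^sub>1" for b
  proof -
    have tb: "t b \<lhd> F\<^sub>1" "finite (rcosets\<^bsub>F\<^sub>1\<^esub> t b)" "N\<^sub>1 \<subseteq> t b" using t b by auto
    then have "\<exists>n::nat. a [^]\<^bsub>F\<^sub>1\<^esub> (p ^ n) \<in> t b" if "a \<in> carrier F\<^sub>1" for a using pN[OF that] by blast
    then show ?thesis using tb by (simp add: pnormal_def)
  qed
  define T where "T = carrier F\<^sub>1 \<inter> (\<Inter>b \<in> B - N\<^sub>1. t b)"
  have T: "pnormal p F\<^sub>1 T" unfolding T_def using B(1) pt by (intro F\<^sub>1.pnormal_INT) auto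
  have nT: "T \<lhd> F\<^sub>1" and sT: "subgroup T F\<^sub>1" using T by (auto simp: pnormal_def normal_imp_subgroup)
  have NT: "N\<^sub>1 \<subseteq> T" using t subgroup.subset[OF sg] unfolding T_def by blast
  have avoid: "e \<notin> T" if e: "e \<in> defect x y" for e
  proof
    assume eT: "e \<in> T"
    have ec: "e \<in> carrier F\<^sub>1 - N\<^sub>1" using defect_disjoint[OF xy(1) nc e] .
    obtain b where b: "b \<in> B" "e \<otimes>\<^bsub>F\<^sub>1\<^esub> inv\<^bsub>F\<^sub>1\<^esub> b \<in> N\<^sub>1" using B(3) e by blast
    have bc: "b \<in> carrier F\<^sub>1" using b B by blast
    have "b \<notin> N\<^sub>1"
    proof
      assume "b \<in> N\<^sub>1"
      then have "e \<otimes>\<^bsub>F\<^sub>1\<^esub> inv\<^bsub>F\<^sub>1\<^esub> b \<otimes>\<^bsub>F\<^sub>1\<^esub> b \<in> N\<^sub>1" using b(2) subgroup.m_closed[OF sg] by blast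
      then show False using ec bc by (simp add: F\<^sub>1.m_assoc)
    qed
    then have "b \<notin> T" using t b(1) unfolding T_def by blast
    moreover have "inv\<^bsub>F\<^sub>1\<^esub> (e \<otimes>\<^bsub>F\<^sub>1\<^esub> inv\<^bsub>F\<^sub>1\<^esub> b) \<otimes>\<^bsub>F\<^sub>1\<^esub> e \<in> T"
      using b(2) NT eT subgroup.m_closed[OF sT] subgroup.m_inv_closed[OF sT] by blast
    then have "b \<in> T" using ec bc by (simp add: F\<^sub>1.inv_mult_group F\<^sub>1.m_assoc)
    ultimately show False by blast
  qed
  define U where "U = {b \<in> carrier F\<^sub>2. \<exists>a \<in> T. (a, b) \<in> G}"
  have U: "pnormal p F\<^sub>2 U" unfolding U_def by (rule pnormal_transfer[OF T])
  obtain M\<^sub>1 where M\<^sub>1: "pnormal p F\<^sub>1 M\<^sub>1"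
    "\<forall>g \<in> carrier F\<^sub>1. inv\<^bsub>F\<^sub>1\<^esub> y\<^sub>1 \<otimes>\<^bsub>F\<^sub>1\<^esub> (g \<otimes>\<^bsub>F\<^sub>1\<^esub> x\<^sub>1 \<otimes>\<^bsub>F\<^sub>1\<^esub> inv\<^bsub>F\<^sub>1\<^esub> g) \<in> M\<^sub>1 \<longrightarrow>
      (\<exists>h \<in> carrier F\<^sub>1. h \<otimes>\<^bsub>F\<^sub>1\<^esub> inv\<^bsub>F\<^sub>1\<^esub> g \<in> T \<and> y\<^sub>1 = h \<otimes>\<^bsub>F\<^sub>1\<^esub> x\<^sub>1 \<otimes>\<^bsub>F\<^sub>1\<^esub> inv\<^bsub>F\<^sub>1\<^esub> h)"
    using F\<^sub>1.separate_conjugates[OF p1 T c(1,3)] by auto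
  obtain M\<^sub>2 where M\<^sub>2: "pnormal p F\<^sub>2 M\<^sub>2"
    "\<forall>g \<in> carrier F\<^sub>2. inv\<^bsub>F\<^sub>2\<^esub> y\<^sub>2 \<otimes>\<^bsub>F\<^sub>2\<^esub> (g \<otimes>\<^bsub>F\<^sub>2\<^esub> x\<^sub>2 \<otimes>\<^bsub>F\<^sub>2\<^esub> inv\<^bsub>F\<^sub>2\<^esub> g) \<in> M\<^sub>2 \<longrightarrow>
      (\<exists>h \<in> carrier F\<^sub>2. h \<otimes>\<^bsub>F\<^sub>2\<^esub> inv\<^bsub>F\<^sub>2\<^esub> g \<in> U \<and> y\<^sub>2 = h \<otimes>\<^bsub>F\<^sub>2\<^esub> x\<^sub>2 \<otimes>\<^bsub>F\<^sub>2\<^esub> inv\<^bsub>F\<^sub>2\<^esub> h)"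
    using F\<^sub>2.separate_conjugates[OF p1 U c(2,4)] by auto
  let ?K = "{g \<in> G. fst g \<in> M\<^sub>1 \<and> snd g \<in> M\<^sub>2}"
  have "inv\<^bsub>P\<^esub> y \<otimes>\<^bsub>P\<^esub> (g \<otimes>\<^bsub>P\<^esub> x \<otimes>\<^bsub>P\<^esub> inv\<^bsub>P\<^esub> g) \<notin> ?K" if g: "g \<in> carrier P" for g
  proof
    assume K: "inv\<^bsub>P\<^esub> y \<otimes>\<^bsub>P\<^esub> (g \<otimes>\<^bsub>P\<^esub> x \<otimes>\<^bsub>P\<^esub> inv\<^bsub>P\<^esub> g) \<in> ?K"
    obtain g\<^sub>1 g\<^sub>2 where g12: "g = (g\<^sub>1, g\<^sub>2)" by (cases g)
    then have gG: "(g\<^sub>1, g\<^sub>2) \<in> G" using g by simp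
    note gc = closed[OF gG]
    have gM: "inv\<^bsub>F\<^sub>1\<^esub> y\<^sub>1 \<otimes>\<^bsub>F\<^sub>1\<^esub> (g\<^sub>1 \<otimes>\<^bsub>F\<^sub>1\<^esub> x\<^sub>1 \<otimes>\<^bsub>F\<^sub>1\<^esub> inv\<^bsub>F\<^sub>1\<^esub> g\<^sub>1) \<in> M\<^sub>1"
      "inv\<^bsub>F\<^sub>2\<^esub> y\<^sub>2 \<otimes>\<^bsub>F\<^sub>2\<^esub> (g\<^sub>2 \<otimes>\<^bsub>F\<^sub>2\<^esub> x\<^sub>2 \<otimes>\<^bsub>F\<^sub>2\<^esub> inv\<^bsub>F\<^sub>2\<^esub> g\<^sub>2) \<in> M\<^sub>2"
      using K xy gG by (simp_all add: eq g12 inv_P)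
    obtain h\<^sub>1 h\<^sub>2 where h: "h\<^sub>1 \<in> carrier F\<^sub>1" "h\<^sub>1 \<otimes>\<^bsub>F\<^sub>1\<^esub> inv\<^bsub>F\<^sub>1\<^esub> g\<^sub>1 \<in> T"
      "y\<^sub>1 = h\<^sub>1 \<otimes>\<^bsub>F\<^sub>1\<^esub> x\<^sub>1 \<otimes>\<^bsub>F\<^sub>1\<^esub> inv\<^bsub>F\<^sub>1\<^esub> h\<^sub>1" "h\<^sub>2 \<in> carrier F\<^sub>2" "h\<^sub>2 \<otimes>\<^bsub>F\<^sub>2\<^esub> inv\<^bsub>F\<^sub>2\<^esub> g\<^sub>2 \<in> U"
      "y\<^sub>2 = h\<^sub>2 \<otimes>\<^bsub>F\<^sub>2\<^esub> x\<^sub>2 \<otimes>\<^bsub>F\<^sub>2\<^esub> inv\<^bsub>F\<^sub>2\<^esub> h\<^sub>2"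
      using M\<^sub>1(2)[rule_format, OF gc(1) gM(1)] M\<^sub>2(2)[rule_format, OF gc(2) gM(2)] by blast
    obtain l where l: "l \<in> T" "(l, h\<^sub>2 \<otimes>\<^bsub>F\<^sub>2\<^esub> inv\<^bsub>F\<^sub>2\<^esub> g\<^sub>2) \<in> G" using h(5) by (auto simp: U_def)
    have lc: "l \<in> carrier F\<^sub>1" using closed(1)[OF l(2)] .
    have "(l \<otimes>\<^bsub>F\<^sub>1\<^esub> g\<^sub>1, h\<^sub>2) \<in> G" using mult_mem[OF l(2) gG] h(4) gc by (simp add: F\<^sub>2.m_assoc)
    then have e: "inv\<^bsub>F\<^sub>1\<^esub> h\<^sub>1 \<otimes>\<^bsub>F\<^sub>1\<^esub> (l \<otimes>\<^bsub>F\<^sub>1\<^esub> g\<^sub>1) \<in> defect x y"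
      unfolding defect_def conjugators\<^sub>1_def conjugators\<^sub>2_def eq fst_conv snd_conv
      using h(1,3,4,6) by blast
    have "inv\<^bsub>F\<^sub>1\<^esub> (h\<^sub>1 \<otimes>\<^bsub>F\<^sub>1\<^esub> inv\<^bsub>F\<^sub>1\<^esub> g\<^sub>1) \<otimes>\<^bsub>F\<^sub>1\<^esub> l \<in> T"
      using h(2) l(1) subgroup.m_closed[OF sT] subgroup.m_inv_closed[OF sT] by blast
    then have "inv\<^bsub>F\<^sub>1\<^esub> g\<^sub>1 \<otimes>\<^bsub>F\<^sub>1\<^esub> (inv\<^bsub>F\<^sub>1\<^esub> (h\<^sub>1 \<otimes>\<^bsub>F\<^sub>1\<^esub> inv\<^bsub>F\<^sub>1\<^esub> g\<^sub>1) \<otimes>\<^bsub>F\<^sub>1\<^esub> l) \<otimes>\<^bsub>F\<^sub>1\<^esub> g\<^sub>1 \<in> T"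
      using F\<^sub>1.normal_conj_mem(2)[OF nT gc(1)] by blast
    then have "inv\<^bsub>F\<^sub>1\<^esub> h\<^sub>1 \<otimes>\<^bsub>F\<^sub>1\<^esub> (l \<otimes>\<^bsub>F\<^sub>1\<^esub> g\<^sub>1) \<in> T"
      using h(1) gc lc by (simp add: F\<^sub>1.inv_mult_group F\<^sub>1.m_assoc)
    then show False using avoid[OF e] by blast
  qed
  then show "\<exists>K. pnormal p P K \<and> (\<forall>g \<in> carrier P. inv\<^bsub>P\<^esub> y \<otimes>\<^bsub>P\<^esub> (g \<otimes>\<^bsub>P\<^esub> x \<otimes>\<^bsub>P\<^esub> inv\<^bsub>P\<^esub> g) \<notin> K)"
    by (intro exI[of _ ?K] conjI ballI pnormal_P[OF M\<^sub>1(1) M\<^sub>2(1)])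
qed

end

section \<open>From separability back to the common quotient\<close>

context subdirect
begin

lemma normal_P_mem:
  assumes K: "K \<lhd> P"
  shows "K \<subseteq> G" and "(\<one>\<^bsub>F\<^sub>1\<^esub>, \<one>\<^bsub>F\<^sub>2\<^esub>) \<in> K"
    and "\<lbrakk>(a, b) \<in> K; (c, d) \<in> K\<rbrakk> \<Longrightarrow> (a \<otimes>\<^bsub>F\<^sub>1\<^esub> c, b \<otimes>\<^bsub>F\<^sub>2\<^esub> d) \<in> K"
    and "(a, b) \<in> K \<Longrightarrow> (inv\<^bsub>F\<^sub>1\<^esub> a, inv\<^bsub>F\<^sub>2\<^esub> b) \<in> K"
    and "\<lbrakk>(g, h) \<in> G; (a, b) \<in> K\<rbrakk> \<Longrightarrow>
      (g \<otimes>\<^bsub>F\<^sub>1\<^esub> a \<otimes>\<^bsub>F\<^sub>1\<^esub> inv\<^bsub>F\<^sub>1\<^esub> g, h \<otimes>\<^bsub>F\<^sub>2\<^esub> b \<otimes>\<^bsub>F\<^sub>2\<^esub> inv\<^bsub>F\<^sub>2\<^esub> h) \<in> K"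
proof -
  have sg: "subgroup K P" using K normal_imp_subgroup by blast
  show sub: "K \<subseteq> G" using subgroup.subset[OF sg] by simp
  show "(\<one>\<^bsub>F\<^sub>1\<^esub>, \<one>\<^bsub>F\<^sub>2\<^esub>) \<in> K" using subgroup.one_closed[OF sg] by simp
  show "(a \<otimes>\<^bsub>F\<^sub>1\<^esub> c, b \<otimes>\<^bsub>F\<^sub>2\<^esub> d) \<in> K" if "(a, b) \<in> K" "(c, d) \<in> K"
    using subgroup.m_closed[OF sg that] by simp
  show "(inv\<^bsub>F\<^sub>1\<^esub> a, inv\<^bsub>F\<^sub>2\<^esub> b) \<in> K" if "(a, b) \<in> K"
    using subgroup.m_inv_closed[OF sg that] inv_P[of a b] sub that by auto
  show "(g \<otimes>\<^bsub>F\<^sub>1\<^esub> a \<otimes>\<^bsub>F\<^sub>1\<^esub> inv\<^bsub>F\<^sub>1\<^esub> g, h \<otimes>\<^bsub>F\<^sub>2\<^esub> b \<otimes>\<^bsub>F\<^sub>2\<^esub> inv\<^bsub>F\<^sub>2\<^esub> h) \<in> K"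
    if "(g, h) \<in> G" "(a, b) \<in> K"
    using P.normal_conj_mem(1)[OF K, of "(g, h)" "(a, b)"] that inv_P[of g h] by simp
qed

text \<open>The preimage in \<open>F\<^sub>1\<close> of the image of \<open>K\<close> in \<open>F\<^sub>1/N\<^sub>1\<close>.\<close>

definition fst_image :: "('a \<times> 'b) set \<Rightarrow> 'a set" where
  "fst_image K = {a \<in> carrier F\<^sub>1. \<exists>n \<in> N\<^sub>1. \<exists>b. (a \<otimes>\<^bsub>F\<^sub>1\<^esub> n, b) \<in> K}"

text \<open>Normality and finite index pass to the image under the surjection of \<open>G\<close>
  onto F1/N1, and from there to the preimage in F1.\<close>

lemma fst_image_normal:
  assumes K: "K \<lhd> P" and fin: "finite (rcosets\<^bsub>P\<^esub> K)"
  shows "fst_image K \<lhd> F\<^sub>1" "finite (rcosets\<^bsub>F\<^sub>1\<^esub> fst_image K)" "N\<^sub>1 \<subseteq> fst_image K"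
proof -
  note Km = normal_P_mem[OF K]
  have sgN: "subgroup N\<^sub>1 F\<^sub>1" using N\<^sub>1_normal normal_imp_subgroup by blast
  note Nc = subgroup.mem_carrier[OF sgN]
  have sg: "subgroup (fst_image K) F\<^sub>1"
  proof
    show "\<one>\<^bsub>F\<^sub>1\<^esub> \<in> fst_image K"
      using Km(2) subgroup.one_closed[OF sgN] by (auto simp: fst_image_def intro!: bexI[of _ "\<one>\<^bsub>F\<^sub>1\<^esub>"])
  next
    fix x y assume "x \<in> fst_image K" "y \<in> fst_image K"
    then obtain m b n d where x: "x \<in> carrier F\<^sub>1" "m \<in> N\<^sub>1" "(x \<otimes>\<^bsub>F\<^sub>1\<^esub> m, b) \<in> K"
      and y: "y \<in> carrier F\<^sub>1" "n \<in> N\<^sub>1" "(y \<otimes>\<^bsub>F\<^sub>1\<^esub> n, d) \<in> K" unfolding fst_image_def by blast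
    have "(x \<otimes>\<^bsub>F\<^sub>1\<^esub> m) \<otimes>\<^bsub>F\<^sub>1\<^esub> (y \<otimes>\<^bsub>F\<^sub>1\<^esub> n) = (x \<otimes>\<^bsub>F\<^sub>1\<^esub> y) \<otimes>\<^bsub>F\<^sub>1\<^esub> ((inv\<^bsub>F\<^sub>1\<^esub> y \<otimes>\<^bsub>F\<^sub>1\<^esub> m \<otimes>\<^bsub>F\<^sub>1\<^esub> y) \<otimes>\<^bsub>F\<^sub>1\<^esub> n)"
      using x y Nc by (simp add: F\<^sub>1.m_assoc)
    then have "((x \<otimes>\<^bsub>F\<^sub>1\<^esub> y) \<otimes>\<^bsub>F\<^sub>1\<^esub> ((inv\<^bsub>F\<^sub>1\<^esub> y \<otimes>\<^bsub>F\<^sub>1\<^esub> m \<otimes>\<^bsub>F\<^sub>1\<^esub> y) \<otimes>\<^bsub>F\<^sub>1\<^esub> n), b \<otimes>\<^bsub>F\<^sub>2\<^esub> d) \<in> K"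
      using Km(3)[OF x(3) y(3)] by simp
    moreover have "(inv\<^bsub>F\<^sub>1\<^esub> y \<otimes>\<^bsub>F\<^sub>1\<^esub> m \<otimes>\<^bsub>F\<^sub>1\<^esub> y) \<otimes>\<^bsub>F\<^sub>1\<^esub> n \<in> N\<^sub>1"
      using subgroup.m_closed[OF sgN F\<^sub>1.normal_conj_mem(2)[OF N\<^sub>1_normal y(1) x(2)] y(2)] .
    ultimately show "x \<otimes>\<^bsub>F\<^sub>1\<^esub> y \<in> fst_image K" using x(1) y(1) unfolding fst_image_def by blast
  next
    fix x assume "x \<in> fst_image K"
    then obtain m b where x: "x \<in> carrier F\<^sub>1" "m \<in> N\<^sub>1" "(x \<otimes>\<^bsub>F\<^sub>1\<^esub> m, b) \<in> K"
      unfolding fst_image_def by blast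
    have "inv\<^bsub>F\<^sub>1\<^esub> (x \<otimes>\<^bsub>F\<^sub>1\<^esub> m) = inv\<^bsub>F\<^sub>1\<^esub> x \<otimes>\<^bsub>F\<^sub>1\<^esub> (x \<otimes>\<^bsub>F\<^sub>1\<^esub> inv\<^bsub>F\<^sub>1\<^esub> m \<otimes>\<^bsub>F\<^sub>1\<^esub> inv\<^bsub>F\<^sub>1\<^esub> x)"
      using x Nc by (simp add: F\<^sub>1.m_assoc F\<^sub>1.inv_mult_group)
    then have "(inv\<^bsub>F\<^sub>1\<^esub> x \<otimes>\<^bsub>F\<^sub>1\<^esub> (x \<otimes>\<^bsub>F\<^sub>1\<^esub> inv\<^bsub>F\<^sub>1\<^esub> m \<otimes>\<^bsub>F\<^sub>1\<^esub> inv\<^bsub>F\<^sub>1\<^esub> x), inv\<^bsub>F\<^sub>2\<^esub> b) \<in> K"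
      using Km(4)[OF x(3)] by simp
    moreover have "x \<otimes>\<^bsub>F\<^sub>1\<^esub> inv\<^bsub>F\<^sub>1\<^esub> m \<otimes>\<^bsub>F\<^sub>1\<^esub> inv\<^bsub>F\<^sub>1\<^esub> x \<in> N\<^sub>1"
      using F\<^sub>1.normal_conj_mem(1)[OF N\<^sub>1_normal x(1) subgroup.m_inv_closed[OF sgN x(2)]] .
    ultimately show "inv\<^bsub>F\<^sub>1\<^esub> x \<in> fst_image K" using F\<^sub>1.inv_closed[OF x(1)] unfolding fst_image_def by blast
  qed (auto simp: fst_image_def)
  moreover have "z \<otimes>\<^bsub>F\<^sub>1\<^esub> x \<otimes>\<^bsub>F\<^sub>1\<^esub> inv\<^bsub>F\<^sub>1\<^esub> z \<in> fst_image K" if z: "z \<in> carrier F\<^sub>1" and xK: "x \<in> fst_image K" for z x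
  proof -
    obtain m b where x: "x \<in> carrier F\<^sub>1" "m \<in> N\<^sub>1" "(x \<otimes>\<^bsub>F\<^sub>1\<^esub> m, b) \<in> K"
      using xK unfolding fst_image_def by blast
    obtain w where w: "(z, w) \<in> G" using lift_fst z by blast
    have "z \<otimes>\<^bsub>F\<^sub>1\<^esub> (x \<otimes>\<^bsub>F\<^sub>1\<^esub> m) \<otimes>\<^bsub>F\<^sub>1\<^esub> inv\<^bsub>F\<^sub>1\<^esub> z
        = (z \<otimes>\<^bsub>F\<^sub>1\<^esub> x \<otimes>\<^bsub>F\<^sub>1\<^esub> inv\<^bsub>F\<^sub>1\<^esub> z) \<otimes>\<^bsub>F\<^sub>1\<^esub> (z \<otimes>\<^bsub>F\<^sub>1\<^esub> m \<otimes>\<^bsub>F\<^sub>1\<^esub> inv\<^bsub>F\<^sub>1\<^esub> z)"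
      using x z Nc by (simp add: F\<^sub>1.m_assoc)
    then have "((z \<otimes>\<^bsub>F\<^sub>1\<^esub> x \<otimes>\<^bsub>F\<^sub>1\<^esub> inv\<^bsub>F\<^sub>1\<^esub> z) \<otimes>\<^bsub>F\<^sub>1\<^esub> (z \<otimes>\<^bsub>F\<^sub>1\<^esub> m \<otimes>\<^bsub>F\<^sub>1\<^esub> inv\<^bsub>F\<^sub>1\<^esub> z),
        w \<otimes>\<^bsub>F\<^sub>2\<^esub> b \<otimes>\<^bsub>F\<^sub>2\<^esub> inv\<^bsub>F\<^sub>2\<^esub> w) \<in> K"
      using Km(5)[OF w x(3)] by simp
    moreover have "z \<otimes>\<^bsub>F\<^sub>1\<^esub> m \<otimes>\<^bsub>F\<^sub>1\<^esub> inv\<^bsub>F\<^sub>1\<^esub> z \<in> N\<^sub>1"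
      using F\<^sub>1.normal_conj_mem(1)[OF N\<^sub>1_normal z x(2)] .
    moreover have "z \<otimes>\<^bsub>F\<^sub>1\<^esub> x \<otimes>\<^bsub>F\<^sub>1\<^esub> inv\<^bsub>F\<^sub>1\<^esub> z \<in> carrier F\<^sub>1" using x z by simp
    ultimately show ?thesis unfolding fst_image_def by blast
  qed
  ultimately show "fst_image K \<lhd> F\<^sub>1" by (simp add: F\<^sub>1.normal_inv_iff)
  show "finite (rcosets\<^bsub>F\<^sub>1\<^esub> fst_image K)"
  proof -
    define f where "f a = (SOME b. (a, b) \<in> G)" for a
    have f: "(a, f a) \<in> G" if "a \<in> carrier F\<^sub>1" for a
      unfolding f_def using lift_fst[OF that] by (rule someI_ex)
    show ?thesis
    proof (rule F\<^sub>1.finite_rcosets_if_finite_image[OF sg, of "\<lambda>a. K #>\<^bsub>P\<^esub> (a, f a)"])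
      have "(\<lambda>a. K #>\<^bsub>P\<^esub> (a, f a)) ` carrier F\<^sub>1 \<subseteq> rcosets\<^bsub>P\<^esub> K"
        using f by (auto simp: RCOSETS_def)
      then show "finite ((\<lambda>a. K #>\<^bsub>P\<^esub> (a, f a)) ` carrier F\<^sub>1)" using fin finite_subset by blast
    next
      fix x y assume xy: "x \<in> carrier F\<^sub>1" "y \<in> carrier F\<^sub>1" "K #>\<^bsub>P\<^esub> (x, f x) = K #>\<^bsub>P\<^esub> (y, f y)"
      have "(x, f x) \<otimes>\<^bsub>P\<^esub> inv\<^bsub>P\<^esub> (y, f y) \<in> K"
        using P.rcos_eq_iff[OF normal_imp_subgroup[OF K], of "(x, f x)" "(y, f y)"] xy f by simp
      then have "(x \<otimes>\<^bsub>F\<^sub>1\<^esub> inv\<^bsub>F\<^sub>1\<^esub> y, f x \<otimes>\<^bsub>F\<^sub>2\<^esub> inv\<^bsub>F\<^sub>2\<^esub> f y) \<in> K"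
        by (simp add: inv_P[OF f[OF xy(2)]])
      moreover have c: "x \<otimes>\<^bsub>F\<^sub>1\<^esub> inv\<^bsub>F\<^sub>1\<^esub> y \<in> carrier F\<^sub>1" using xy by simp
      ultimately have "((x \<otimes>\<^bsub>F\<^sub>1\<^esub> inv\<^bsub>F\<^sub>1\<^esub> y) \<otimes>\<^bsub>F\<^sub>1\<^esub> \<one>\<^bsub>F\<^sub>1\<^esub>, f x \<otimes>\<^bsub>F\<^sub>2\<^esub> inv\<^bsub>F\<^sub>2\<^esub> f y) \<in> K" by simp
      then show "x \<otimes>\<^bsub>F\<^sub>1\<^esub> inv\<^bsub>F\<^sub>1\<^esub> y \<in> fst_image K"
        using c subgroup.one_closed[OF sgN] unfolding fst_image_def by blast
    qed
  qed
  show "N\<^sub>1 \<subseteq> fst_image K"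
  proof
    fix n assume n: "n \<in> N\<^sub>1"
    then have "(n \<otimes>\<^bsub>F\<^sub>1\<^esub> inv\<^bsub>F\<^sub>1\<^esub> n, \<one>\<^bsub>F\<^sub>2\<^esub>) \<in> K" using Km(2) Nc by simp
    then show "n \<in> fst_image K"
      using n Nc subgroup.m_inv_closed[OF sgN] unfolding fst_image_def by blast
  qed
qed

end

lemma nat_int_pow_pow:
  assumes "group G" "x \<in> carrier G"
  shows "(x [^]\<^bsub>G\<^esub> (m::nat)) [^]\<^bsub>G\<^esub> (k::int) = x [^]\<^bsub>G\<^esub> (int m * k)"
  using group.int_pow_pow[OF assms, of "int m" k] by (simp add: int_pow_int)

context free_subdirect
begin

text \<open>Since c and d generate their own centralizers, a conjugator has the form (c^i, w2 d^j).
  Dividing it by (c, d)^i, which lies in \<open>G\<close>, leaves w2 d^(j - i) in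
  \<open>N\<^sub>2\<close>, and in the quotient this reads q^(1 + m (j - i)) = 1. If there is no
  conjugator, separability supplies \<open>K\<close>.\<close>

lemma power_mem_or_separated:
  assumes p: "Factorial_Ring.prime p" and sep: "p_conjugacy_separable p P"
    and nc: "\<not> comm_group F\<^sub>1" "\<not> comm_group F\<^sub>2" and ne: "N\<^sub>1 \<noteq> {\<one>\<^bsub>F\<^sub>1\<^esub>}" "N\<^sub>2 \<noteq> {\<one>\<^bsub>F\<^sub>2\<^esub>}"
    and w: "(w\<^sub>1, w\<^sub>2) \<in> G"
  shows "(\<exists>k::int. w\<^sub>1 [^]\<^bsub>F\<^sub>1\<^esub> (1 + int m * k) \<in> N\<^sub>1) \<or>
    (\<exists>c d n K. n \<in> N\<^sub>2 \<and> d = w\<^sub>2 [^]\<^bsub>F\<^sub>2\<^esub> (m::nat) \<otimes>\<^bsub>F\<^sub>2\<^esub> n \<and> (c, d) \<in> G \<and> pnormal p P K \<and>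
      (\<forall>g h. (g, h) \<in> G \<longrightarrow>
        (inv\<^bsub>F\<^sub>1\<^esub> c \<otimes>\<^bsub>F\<^sub>1\<^esub> (g \<otimes>\<^bsub>F\<^sub>1\<^esub> c \<otimes>\<^bsub>F\<^sub>1\<^esub> inv\<^bsub>F\<^sub>1\<^esub> g),
         inv\<^bsub>F\<^sub>2\<^esub> (w\<^sub>2 \<otimes>\<^bsub>F\<^sub>2\<^esub> d \<otimes>\<^bsub>F\<^sub>2\<^esub> inv\<^bsub>F\<^sub>2\<^esub> w\<^sub>2) \<otimes>\<^bsub>F\<^sub>2\<^esub> (h \<otimes>\<^bsub>F\<^sub>2\<^esub> d \<otimes>\<^bsub>F\<^sub>2\<^esub> inv\<^bsub>F\<^sub>2\<^esub> h)) \<notin> K))"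
    (is "?A \<or> ?B")
proof -
  have wc: "w\<^sub>1 \<in> carrier F\<^sub>1" "w\<^sub>2 \<in> carrier F\<^sub>2" using closed[OF w] by auto
  have sg\<^sub>2: "subgroup N\<^sub>2 F\<^sub>2" using N\<^sub>2_normal normal_imp_subgroup by blast
  have wm: "w\<^sub>1 [^]\<^bsub>F\<^sub>1\<^esub> m \<in> carrier F\<^sub>1" "w\<^sub>2 [^]\<^bsub>F\<^sub>2\<^esub> m \<in> carrier F\<^sub>2" using wc by simp_all
  obtain n\<^sub>1 where n\<^sub>1: "n\<^sub>1 \<in> N\<^sub>1"
    and cent\<^sub>1: "\<And>g. \<lbrakk>g \<in> carrier F\<^sub>1; g \<otimes>\<^bsub>F\<^sub>1\<^esub> (w\<^sub>1 [^]\<^bsub>F\<^sub>1\<^esub> m \<otimes>\<^bsub>F\<^sub>1\<^esub> n\<^sub>1) = (w\<^sub>1 [^]\<^bsub>F\<^sub>1\<^esub> m \<otimes>\<^bsub>F\<^sub>1\<^esub> n\<^sub>1) \<otimes>\<^bsub>F\<^sub>1\<^esub> g\<rbrakk>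
      \<Longrightarrow> \<exists>k::int. g = (w\<^sub>1 [^]\<^bsub>F\<^sub>1\<^esub> m \<otimes>\<^bsub>F\<^sub>1\<^esub> n\<^sub>1) [^]\<^bsub>F\<^sub>1\<^esub> k"
    using F\<^sub>1.ex_own_centralizer[OF nc(1) N\<^sub>1_normal ne(1) wm(1)] by metis
  obtain n\<^sub>2 where n\<^sub>2: "n\<^sub>2 \<in> N\<^sub>2"
    and cent\<^sub>2: "\<And>g. \<lbrakk>g \<in> carrier F\<^sub>2; g \<otimes>\<^bsub>F\<^sub>2\<^esub> (w\<^sub>2 [^]\<^bsub>F\<^sub>2\<^esub> m \<otimes>\<^bsub>F\<^sub>2\<^esub> n\<^sub>2) = (w\<^sub>2 [^]\<^bsub>F\<^sub>2\<^esub> m \<otimes>\<^bsub>F\<^sub>2\<^esub> n\<^sub>2) \<otimes>\<^bsub>F\<^sub>2\<^esub> g\<rbrakk>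
      \<Longrightarrow> \<exists>k::int. g = (w\<^sub>2 [^]\<^bsub>F\<^sub>2\<^esub> m \<otimes>\<^bsub>F\<^sub>2\<^esub> n\<^sub>2) [^]\<^bsub>F\<^sub>2\<^esub> k"
    using F\<^sub>2.ex_own_centralizer[OF nc(2) N\<^sub>2_normal ne(2) wm(2)] by metis
  define c where "c = w\<^sub>1 [^]\<^bsub>F\<^sub>1\<^esub> m \<otimes>\<^bsub>F\<^sub>1\<^esub> n\<^sub>1"
  define d where "d = w\<^sub>2 [^]\<^bsub>F\<^sub>2\<^esub> m \<otimes>\<^bsub>F\<^sub>2\<^esub> n\<^sub>2"
  have nG: "(n\<^sub>1, \<one>\<^bsub>F\<^sub>2\<^esub>) \<in> G" "(\<one>\<^bsub>F\<^sub>1\<^esub>, n\<^sub>2) \<in> G" using n\<^sub>1 n\<^sub>2 by (simp_all add: mem_N\<^sub>1 mem_N\<^sub>2)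
  have ncl: "n\<^sub>1 \<in> carrier F\<^sub>1" "n\<^sub>2 \<in> carrier F\<^sub>2" using closed nG by blast+
  have cd: "(c, d) \<in> G"
    using mult_mem[OF pow_mem[OF w] mult_mem[OF nG], of m] ncl by (simp add: c_def d_def)
  have cdc: "c \<in> carrier F\<^sub>1" "d \<in> carrier F\<^sub>2" using closed[OF cd] by auto
  let ?y = "w\<^sub>2 \<otimes>\<^bsub>F\<^sub>2\<^esub> d \<otimes>\<^bsub>F\<^sub>2\<^esub> inv\<^bsub>F\<^sub>2\<^esub> w\<^sub>2"
  \<comment> \<open>Modulo \<open>N\<^sub>2\<close> the element \<open>d\<close> is a power of
    \<open>w\<^sub>2\<close>, so conjugation by \<open>w\<^sub>2\<close> does not change its
    class.\<close>
  have yG: "(c, ?y) \<in> G"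
  proof -
    let ?e = "w\<^sub>2 \<otimes>\<^bsub>F\<^sub>2\<^esub> n\<^sub>2 \<otimes>\<^bsub>F\<^sub>2\<^esub> inv\<^bsub>F\<^sub>2\<^esub> w\<^sub>2 \<otimes>\<^bsub>F\<^sub>2\<^esub> inv\<^bsub>F\<^sub>2\<^esub> n\<^sub>2"
    have "?e \<in> N\<^sub>2"
      using subgroup.m_closed[OF sg\<^sub>2 F\<^sub>2.normal_conj_mem(1)[OF N\<^sub>2_normal wc(2) n\<^sub>2] subgroup.m_inv_closed[OF sg\<^sub>2 n\<^sub>2]] .
    then have "w\<^sub>2 [^]\<^bsub>F\<^sub>2\<^esub> m \<otimes>\<^bsub>F\<^sub>2\<^esub> ?e \<otimes>\<^bsub>F\<^sub>2\<^esub> inv\<^bsub>F\<^sub>2\<^esub> (w\<^sub>2 [^]\<^bsub>F\<^sub>2\<^esub> m) \<in> N\<^sub>2"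
      by (rule F\<^sub>2.normal_conj_mem(1)[OF N\<^sub>2_normal wm(2)])
    then have "(\<one>\<^bsub>F\<^sub>1\<^esub> \<otimes>\<^bsub>F\<^sub>1\<^esub> c, w\<^sub>2 [^]\<^bsub>F\<^sub>2\<^esub> m \<otimes>\<^bsub>F\<^sub>2\<^esub> ?e \<otimes>\<^bsub>F\<^sub>2\<^esub> inv\<^bsub>F\<^sub>2\<^esub> (w\<^sub>2 [^]\<^bsub>F\<^sub>2\<^esub> m) \<otimes>\<^bsub>F\<^sub>2\<^esub> d) \<in> G"
      using mult_mem[OF _ cd] by (simp add: mem_N\<^sub>2 del: F\<^sub>1.l_one)
    moreover have "w\<^sub>2 [^]\<^bsub>F\<^sub>2\<^esub> m \<otimes>\<^bsub>F\<^sub>2\<^esub> ?e \<otimes>\<^bsub>F\<^sub>2\<^esub> inv\<^bsub>F\<^sub>2\<^esub> (w\<^sub>2 [^]\<^bsub>F\<^sub>2\<^esub> m) \<otimes>\<^bsub>F\<^sub>2\<^esub> d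
        = (w\<^sub>2 [^]\<^bsub>F\<^sub>2\<^esub> m \<otimes>\<^bsub>F\<^sub>2\<^esub> w\<^sub>2) \<otimes>\<^bsub>F\<^sub>2\<^esub> n\<^sub>2 \<otimes>\<^bsub>F\<^sub>2\<^esub> inv\<^bsub>F\<^sub>2\<^esub> w\<^sub>2"
      using wc wm ncl by (simp add: d_def F\<^sub>2.m_assoc)
    moreover have "(w\<^sub>2 [^]\<^bsub>F\<^sub>2\<^esub> m \<otimes>\<^bsub>F\<^sub>2\<^esub> w\<^sub>2) \<otimes>\<^bsub>F\<^sub>2\<^esub> n\<^sub>2 \<otimes>\<^bsub>F\<^sub>2\<^esub> inv\<^bsub>F\<^sub>2\<^esub> w\<^sub>2 = ?y"
      using F\<^sub>2.nat_pow_Suc2[OF wc(2), of m] wc wm ncl by (simp add: d_def F\<^sub>2.m_assoc)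
    ultimately show ?thesis using cdc by simp
  qed
  show ?thesis
  proof (cases "conjugate P (c, d) (c, ?y)")
    case True
    then obtain h\<^sub>1 h\<^sub>2 where h: "(h\<^sub>1, h\<^sub>2) \<in> G" and h1: "c = h\<^sub>1 \<otimes>\<^bsub>F\<^sub>1\<^esub> c \<otimes>\<^bsub>F\<^sub>1\<^esub> inv\<^bsub>F\<^sub>1\<^esub> h\<^sub>1"
      and h2: "?y = h\<^sub>2 \<otimes>\<^bsub>F\<^sub>2\<^esub> d \<otimes>\<^bsub>F\<^sub>2\<^esub> inv\<^bsub>F\<^sub>2\<^esub> h\<^sub>2"
      unfolding conjugate_P_iff[OF cd] by blast
    note hc = closed[OF h]
    have "c \<otimes>\<^bsub>F\<^sub>1\<^esub> h\<^sub>1 = (h\<^sub>1 \<otimes>\<^bsub>F\<^sub>1\<^esub> c \<otimes>\<^bsub>F\<^sub>1\<^esub> inv\<^bsub>F\<^sub>1\<^esub> h\<^sub>1) \<otimes>\<^bsub>F\<^sub>1\<^esub> h\<^sub>1" using h1 by simp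
    then have "h\<^sub>1 \<otimes>\<^bsub>F\<^sub>1\<^esub> c = c \<otimes>\<^bsub>F\<^sub>1\<^esub> h\<^sub>1" using hc cdc by (simp add: F\<^sub>1.m_assoc)
    then obtain i :: int where i: "h\<^sub>1 = c [^]\<^bsub>F\<^sub>1\<^esub> i" using cent\<^sub>1[OF hc(1)] unfolding c_def by blast
    let ?h = "inv\<^bsub>F\<^sub>2\<^esub> w\<^sub>2 \<otimes>\<^bsub>F\<^sub>2\<^esub> h\<^sub>2"
    have "?h \<otimes>\<^bsub>F\<^sub>2\<^esub> d = inv\<^bsub>F\<^sub>2\<^esub> w\<^sub>2 \<otimes>\<^bsub>F\<^sub>2\<^esub> (h\<^sub>2 \<otimes>\<^bsub>F\<^sub>2\<^esub> d \<otimes>\<^bsub>F\<^sub>2\<^esub> inv\<^bsub>F\<^sub>2\<^esub> h\<^sub>2) \<otimes>\<^bsub>F\<^sub>2\<^esub> h\<^sub>2"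
      using hc cdc wc by (simp add: F\<^sub>2.m_assoc)
    also have "\<dots> = d \<otimes>\<^bsub>F\<^sub>2\<^esub> ?h" unfolding h2[symmetric] using hc cdc wc by (simp add: F\<^sub>2.m_assoc)
    finally have comm: "?h \<otimes>\<^bsub>F\<^sub>2\<^esub> d = d \<otimes>\<^bsub>F\<^sub>2\<^esub> ?h" .
    have "?h \<in> carrier F\<^sub>2" using hc wc by simp
    then obtain j :: int where j: "?h = d [^]\<^bsub>F\<^sub>2\<^esub> j" using cent\<^sub>2 comm unfolding d_def by blast
    have h2j: "h\<^sub>2 = w\<^sub>2 \<otimes>\<^bsub>F\<^sub>2\<^esub> d [^]\<^bsub>F\<^sub>2\<^esub> j" unfolding j[symmetric] using hc wc by simp
    let ?k = "j - i"
    have "(h\<^sub>1 \<otimes>\<^bsub>F\<^sub>1\<^esub> inv\<^bsub>F\<^sub>1\<^esub> (c [^]\<^bsub>F\<^sub>1\<^esub> i), h\<^sub>2 \<otimes>\<^bsub>F\<^sub>2\<^esub> inv\<^bsub>F\<^sub>2\<^esub> (d [^]\<^bsub>F\<^sub>2\<^esub> i)) \<in> G"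
      using mult_mem[OF h inv_mem[OF int_pow_mem[OF cd]]] .
    moreover have "h\<^sub>2 \<otimes>\<^bsub>F\<^sub>2\<^esub> inv\<^bsub>F\<^sub>2\<^esub> (d [^]\<^bsub>F\<^sub>2\<^esub> i) = w\<^sub>2 \<otimes>\<^bsub>F\<^sub>2\<^esub> d [^]\<^bsub>F\<^sub>2\<^esub> ?k"
      unfolding h2j using wc cdc by (simp add: F\<^sub>2.m_assoc F\<^sub>2.int_pow_diff)
    ultimately have mem: "w\<^sub>2 \<otimes>\<^bsub>F\<^sub>2\<^esub> d [^]\<^bsub>F\<^sub>2\<^esub> ?k \<in> N\<^sub>2" using cdc by (simp add: i mem_N\<^sub>2)
    interpret r: group_hom F\<^sub>2 "F\<^sub>2 Mod N\<^sub>2" "\<lambda>a. N\<^sub>2 #>\<^bsub>F\<^sub>2\<^esub> a"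
      using normal.r_coset_hom_Mod[OF N\<^sub>2_normal] normal.factorgroup_is_group[OF N\<^sub>2_normal] F\<^sub>2.is_group
      by (simp add: group_hom_def group_hom_axioms_def)
    let ?q = "N\<^sub>2 #>\<^bsub>F\<^sub>2\<^esub> w\<^sub>2"
    have r: "N\<^sub>2 #>\<^bsub>F\<^sub>2\<^esub> z = \<one>\<^bsub>F\<^sub>2 Mod N\<^sub>2\<^esub> \<longleftrightarrow> z \<in> N\<^sub>2" if "z \<in> carrier F\<^sub>2" for z
      using F\<^sub>2.rcos_eq_iff[OF sg\<^sub>2 that F\<^sub>2.one_closed] F\<^sub>2.coset_mult_one[OF subgroup.subset[OF sg\<^sub>2]] that by simp
    have qc: "?q \<in> carrier (F\<^sub>2 Mod N\<^sub>2)" using wc by simp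
    have "N\<^sub>2 #>\<^bsub>F\<^sub>2\<^esub> n\<^sub>2 = \<one>\<^bsub>F\<^sub>2 Mod N\<^sub>2\<^esub>" using r n\<^sub>2 ncl by blast
    then have "N\<^sub>2 #>\<^bsub>F\<^sub>2\<^esub> d = ?q [^]\<^bsub>F\<^sub>2 Mod N\<^sub>2\<^esub> m"
      using r.hom_mult[OF wm(2) ncl(2)] r.hom_nat_pow[OF wc(2), of m] qc
      by (simp add: d_def del: one_FactGroup mult_FactGroup)
    then have "N\<^sub>2 #>\<^bsub>F\<^sub>2\<^esub> (w\<^sub>2 \<otimes>\<^bsub>F\<^sub>2\<^esub> d [^]\<^bsub>F\<^sub>2\<^esub> ?k) = ?q \<otimes>\<^bsub>F\<^sub>2 Mod N\<^sub>2\<^esub> (?q [^]\<^bsub>F\<^sub>2 Mod N\<^sub>2\<^esub> m) [^]\<^bsub>F\<^sub>2 Mod N\<^sub>2\<^esub> ?k"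
      using wc cdc by (simp add: r.hom_int_pow del: one_FactGroup mult_FactGroup)
    also have "\<dots> = ?q [^]\<^bsub>F\<^sub>2 Mod N\<^sub>2\<^esub> (1 + int m * ?k)"
      using qc by (simp add: nat_int_pow_pow[OF r.H.is_group] r.H.int_pow_mult del: one_FactGroup mult_FactGroup)
    also have "\<dots> = N\<^sub>2 #>\<^bsub>F\<^sub>2\<^esub> (w\<^sub>2 [^]\<^bsub>F\<^sub>2\<^esub> (1 + int m * ?k))"
      using r.hom_int_pow[OF wc(2)] by simp
    finally have "w\<^sub>2 [^]\<^bsub>F\<^sub>2\<^esub> (1 + int m * ?k) \<in> N\<^sub>2"
      using mem r wc cdc by (metis F\<^sub>2.int_pow_closed F\<^sub>2.m_closed)
    then have ?A using fst_snd_mem_iff[OF int_pow_mem[OF w]] by blast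
    then show ?thesis ..
  next
    case False
    then obtain K where K: "pnormal p P K"
      "\<forall>g \<in> carrier P. inv\<^bsub>P\<^esub> (c, ?y) \<otimes>\<^bsub>P\<^esub> (g \<otimes>\<^bsub>P\<^esub> (c, d) \<otimes>\<^bsub>P\<^esub> inv\<^bsub>P\<^esub> g) \<notin> K"
      using iffD1[OF P.p_conjugacy_separable_iff[OF p] sep, rule_format, of "(c, d)" "(c, ?y)"] cd yG by auto
    have "(inv\<^bsub>F\<^sub>1\<^esub> c \<otimes>\<^bsub>F\<^sub>1\<^esub> (g \<otimes>\<^bsub>F\<^sub>1\<^esub> c \<otimes>\<^bsub>F\<^sub>1\<^esub> inv\<^bsub>F\<^sub>1\<^esub> g), inv\<^bsub>F\<^sub>2\<^esub> ?y \<otimes>\<^bsub>F\<^sub>2\<^esub> (h \<otimes>\<^bsub>F\<^sub>2\<^esub> d \<otimes>\<^bsub>F\<^sub>2\<^esub> inv\<^bsub>F\<^sub>2\<^esub> h)) \<notin> K"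
      if "(g, h) \<in> G" for g h
      using K(2)[rule_format, of "(g, h)"] that inv_P[OF yG] inv_P[OF that] by simp
    then have ?B using n\<^sub>2 d_def cd K(1) by blast
    then show ?thesis ..
  qed
qed

end

context free_subdirect
begin

context
  fixes p :: nat
  assumes p: "Factorial_Ring.prime p" and sep: "p_conjugacy_separable p P"
    and nc: "\<not> comm_group F\<^sub>1" "\<not> comm_group F\<^sub>2" and ne: "N\<^sub>1 \<noteq> {\<one>\<^bsub>F\<^sub>1\<^esub>}" "N\<^sub>2 \<noteq> {\<one>\<^bsub>F\<^sub>2\<^esub>}"
begin

text \<open>With exponent 0 the element \<open>d\<close> lies in \<open>N\<^sub>2\<close>. Suppose
  (x m, b) were in \<open>K\<close> with m in \<open>N\<^sub>1\<close>. Then v = b^-1 w gives (1, v)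
  in \<open>G\<close>, and conjugating \<open>d\<close> by v instead of \<open>w\<close> changes the
  result only by a commutator with (x m, b), which lies in \<open>K\<close>. So (1, v) would
  conjugate modulo \<open>K\<close>.\<close>

lemma residually_finite_if_p_conjugacy_separable: "residually_finite (F\<^sub>1 Mod N\<^sub>1)"
  unfolding F\<^sub>1.residually_finite_Mod_iff[OF N\<^sub>1_normal]
proof
  fix x assume x: "x \<in> carrier F\<^sub>1 - N\<^sub>1"
  then obtain w where w: "(x, w) \<in> G" using lift_fst by blast
  note wc = closed[OF w]
  have "\<not> (\<exists>k::int. x [^]\<^bsub>F\<^sub>1\<^esub> (1 + int 0 * k) \<in> N\<^sub>1)" using x by simp
  then obtain c d n K where n: "n \<in> N\<^sub>2" "d = w [^]\<^bsub>F\<^sub>2\<^esub> (0::nat) \<otimes>\<^bsub>F\<^sub>2\<^esub> n" and cd: "(c, d) \<in> G"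
    and K: "pnormal p P K" and sepK: "\<And>g h. (g, h) \<in> G \<Longrightarrow>
      (inv\<^bsub>F\<^sub>1\<^esub> c \<otimes>\<^bsub>F\<^sub>1\<^esub> (g \<otimes>\<^bsub>F\<^sub>1\<^esub> c \<otimes>\<^bsub>F\<^sub>1\<^esub> inv\<^bsub>F\<^sub>1\<^esub> g),
       inv\<^bsub>F\<^sub>2\<^esub> (w \<otimes>\<^bsub>F\<^sub>2\<^esub> d \<otimes>\<^bsub>F\<^sub>2\<^esub> inv\<^bsub>F\<^sub>2\<^esub> w) \<otimes>\<^bsub>F\<^sub>2\<^esub> (h \<otimes>\<^bsub>F\<^sub>2\<^esub> d \<otimes>\<^bsub>F\<^sub>2\<^esub> inv\<^bsub>F\<^sub>2\<^esub> h)) \<notin> K"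
    using power_mem_or_separated[OF p sep nc ne w, of 0] by blast
  note cdc = closed[OF cd]
  have d: "(\<one>\<^bsub>F\<^sub>1\<^esub>, d) \<in> G" using n closed(2)[of "\<one>\<^bsub>F\<^sub>1\<^esub>" n] by (simp add: mem_N\<^sub>2)
  have nK: "K \<lhd> P" "finite (rcosets\<^bsub>P\<^esub> K)" using K by (auto simp: pnormal_def)
  note Km = normal_P_mem[OF nK(1)]
  have "x \<notin> fst_image K"
  proof
    assume "x \<in> fst_image K"
    then obtain m b where m: "m \<in> N\<^sub>1" "(x \<otimes>\<^bsub>F\<^sub>1\<^esub> m, b) \<in> K" unfolding fst_image_def by blast
    have mG: "(m, \<one>\<^bsub>F\<^sub>2\<^esub>) \<in> G" using m(1) by (simp add: mem_N\<^sub>1)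
    note mc = closed(1)[OF mG]
    have bG: "(x \<otimes>\<^bsub>F\<^sub>1\<^esub> m, b) \<in> G" using m(2) Km(1) by blast
    note bc = closed(2)[OF bG]
    let ?v = "inv\<^bsub>F\<^sub>2\<^esub> b \<otimes>\<^bsub>F\<^sub>2\<^esub> w"
    have "(inv\<^bsub>F\<^sub>1\<^esub> (x \<otimes>\<^bsub>F\<^sub>1\<^esub> m) \<otimes>\<^bsub>F\<^sub>1\<^esub> (x \<otimes>\<^bsub>F\<^sub>1\<^esub> m), inv\<^bsub>F\<^sub>2\<^esub> b \<otimes>\<^bsub>F\<^sub>2\<^esub> (w \<otimes>\<^bsub>F\<^sub>2\<^esub> \<one>\<^bsub>F\<^sub>2\<^esub>)) \<in> G"
      using mult_mem[OF inv_mem[OF bG] mult_mem[OF w mG]] .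
    then have vG: "(\<one>\<^bsub>F\<^sub>1\<^esub>, ?v) \<in> G" using wc mc by simp
    let ?d = "?v \<otimes>\<^bsub>F\<^sub>2\<^esub> d \<otimes>\<^bsub>F\<^sub>2\<^esub> inv\<^bsub>F\<^sub>2\<^esub> ?v"
    have vc: "?v \<in> carrier F\<^sub>2" using closed(2)[OF vG] .
    have dG: "(\<one>\<^bsub>F\<^sub>1\<^esub>, inv\<^bsub>F\<^sub>2\<^esub> ?d) \<in> G"
      using inv_mem[OF mult_mem[OF mult_mem[OF vG d] inv_mem[OF vG]]] by simp
    have "((x \<otimes>\<^bsub>F\<^sub>1\<^esub> m) \<otimes>\<^bsub>F\<^sub>1\<^esub> (\<one>\<^bsub>F\<^sub>1\<^esub> \<otimes>\<^bsub>F\<^sub>1\<^esub> inv\<^bsub>F\<^sub>1\<^esub> (x \<otimes>\<^bsub>F\<^sub>1\<^esub> m) \<otimes>\<^bsub>F\<^sub>1\<^esub> inv\<^bsub>F\<^sub>1\<^esub> \<one>\<^bsub>F\<^sub>1\<^esub>),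
        b \<otimes>\<^bsub>F\<^sub>2\<^esub> (inv\<^bsub>F\<^sub>2\<^esub> ?d \<otimes>\<^bsub>F\<^sub>2\<^esub> inv\<^bsub>F\<^sub>2\<^esub> b \<otimes>\<^bsub>F\<^sub>2\<^esub> inv\<^bsub>F\<^sub>2\<^esub> (inv\<^bsub>F\<^sub>2\<^esub> ?d))) \<in> K"
      using Km(3)[OF m(2) Km(5)[OF dG Km(4)[OF m(2)]]] .
    moreover have "(x \<otimes>\<^bsub>F\<^sub>1\<^esub> m) \<otimes>\<^bsub>F\<^sub>1\<^esub> (\<one>\<^bsub>F\<^sub>1\<^esub> \<otimes>\<^bsub>F\<^sub>1\<^esub> inv\<^bsub>F\<^sub>1\<^esub> (x \<otimes>\<^bsub>F\<^sub>1\<^esub> m) \<otimes>\<^bsub>F\<^sub>1\<^esub> inv\<^bsub>F\<^sub>1\<^esub> \<one>\<^bsub>F\<^sub>1\<^esub>)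
        = inv\<^bsub>F\<^sub>1\<^esub> c \<otimes>\<^bsub>F\<^sub>1\<^esub> (\<one>\<^bsub>F\<^sub>1\<^esub> \<otimes>\<^bsub>F\<^sub>1\<^esub> c \<otimes>\<^bsub>F\<^sub>1\<^esub> inv\<^bsub>F\<^sub>1\<^esub> \<one>\<^bsub>F\<^sub>1\<^esub>)"
      using wc mc cdc by simp
    moreover have "b \<otimes>\<^bsub>F\<^sub>2\<^esub> (inv\<^bsub>F\<^sub>2\<^esub> ?d \<otimes>\<^bsub>F\<^sub>2\<^esub> inv\<^bsub>F\<^sub>2\<^esub> b \<otimes>\<^bsub>F\<^sub>2\<^esub> inv\<^bsub>F\<^sub>2\<^esub> (inv\<^bsub>F\<^sub>2\<^esub> ?d))
        = inv\<^bsub>F\<^sub>2\<^esub> (w \<otimes>\<^bsub>F\<^sub>2\<^esub> d \<otimes>\<^bsub>F\<^sub>2\<^esub> inv\<^bsub>F\<^sub>2\<^esub> w) \<otimes>\<^bsub>F\<^sub>2\<^esub> (?v \<otimes>\<^bsub>F\<^sub>2\<^esub> d \<otimes>\<^bsub>F\<^sub>2\<^esub> inv\<^bsub>F\<^sub>2\<^esub> ?v)"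
      using wc bc cdc by (simp add: F\<^sub>2.m_assoc F\<^sub>2.inv_mult_group)
    ultimately show False using sepK[OF vG] by simp
  qed
  then show "\<exists>T. T \<lhd> F\<^sub>1 \<and> finite (rcosets\<^bsub>F\<^sub>1\<^esub> T) \<and> N\<^sub>1 \<subseteq> T \<and> x \<notin> T"
    using fst_image_normal[OF nK] by blast
qed

text \<open>Modulo any normal subgroup of \<open>p\<close>-power index an element is a power of its \<open>m\<close>-th power,
  so separability forces this to hold already in \<open>F\<^sub>1/N\<^sub>1\<close>.\<close>

lemma coprime_power_mem:
  assumes m: "coprime m p" "m \<noteq> 0" and x: "x \<in> carrier F\<^sub>1"
  shows "\<exists>k::int. x [^]\<^bsub>F\<^sub>1\<^esub> (1 + int m * k) \<in> N\<^sub>1"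
proof (rule ccontr)
  assume not: "\<not> ?thesis"
  obtain w where w: "(x, w) \<in> G" using lift_fst x by blast
  note wc = closed[OF w]
  obtain c d n K where n: "n \<in> N\<^sub>2" and dd: "d = w [^]\<^bsub>F\<^sub>2\<^esub> m \<otimes>\<^bsub>F\<^sub>2\<^esub> n" and cd: "(c, d) \<in> G"
    and K: "pnormal p P K" and sepK: "\<And>g h. (g, h) \<in> G \<Longrightarrow>
      (inv\<^bsub>F\<^sub>1\<^esub> c \<otimes>\<^bsub>F\<^sub>1\<^esub> (g \<otimes>\<^bsub>F\<^sub>1\<^esub> c \<otimes>\<^bsub>F\<^sub>1\<^esub> inv\<^bsub>F\<^sub>1\<^esub> g),
       inv\<^bsub>F\<^sub>2\<^esub> (w \<otimes>\<^bsub>F\<^sub>2\<^esub> d \<otimes>\<^bsub>F\<^sub>2\<^esub> inv\<^bsub>F\<^sub>2\<^esub> w) \<otimes>\<^bsub>F\<^sub>2\<^esub> (h \<otimes>\<^bsub>F\<^sub>2\<^esub> d \<otimes>\<^bsub>F\<^sub>2\<^esub> inv\<^bsub>F\<^sub>2\<^esub> h)) \<notin> K"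
    using power_mem_or_separated[OF p sep nc ne w, of m] not by blast
  note cdc = closed[OF cd]
  have nG: "(\<one>\<^bsub>F\<^sub>1\<^esub>, n) \<in> G" using n by (simp add: mem_N\<^sub>2)
  note ncl = closed(2)[OF nG]
  have nK: "K \<lhd> P" and sK: "subgroup K P" using K by (auto simp: pnormal_def normal_imp_subgroup)
  note Km = normal_P_mem[OF nK]
  obtain s :: nat where s: "(x, w) [^]\<^bsub>P\<^esub> (p ^ s) \<in> K" using K w by (auto simp: pnormal_def)
  \<comment> \<open>As \<open>m\<close> is prime to \<open>p\<close>, the gcd is 1. So
    \<open>m * j\<close> is one more than a multiple \<open>e\<close> of \<open>p ^ s\<close>, and
    the e-th power of (x, w) lies in \<open>K\<close>.\<close>
  obtain j t where jt: "m * j = p ^ s * t + gcd m (p ^ s)" using bezout_nat[OF m(2)] by blast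
  define e where "e = p ^ s * t"
  have mj: "m * j = Suc e" using jt m(1) by (simp add: e_def)
  have "(x, w) [^]\<^bsub>P\<^esub> e \<in> K"
    using P.pow_dvd_mem[OF sK _ s, of e] w by (simp add: e_def)
  then have eK: "(x [^]\<^bsub>F\<^sub>1\<^esub> e, w [^]\<^bsub>F\<^sub>2\<^esub> e) \<in> K" by (simp add: pow_P)
  let ?e = "w [^]\<^bsub>F\<^sub>2\<^esub> e" and ?m = "w [^]\<^bsub>F\<^sub>2\<^esub> m" and ?h = "w [^]\<^bsub>F\<^sub>2\<^esub> Suc e" and ?g = "c [^]\<^bsub>F\<^sub>1\<^esub> j"
  have cl: "?e \<in> carrier F\<^sub>2" "?m \<in> carrier F\<^sub>2" "?h \<in> carrier F\<^sub>2" "?g \<in> carrier F\<^sub>1"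
    "x [^]\<^bsub>F\<^sub>1\<^esub> e \<in> carrier F\<^sub>1" "d [^]\<^bsub>F\<^sub>2\<^esub> j \<in> carrier F\<^sub>2"
    using wc cdc by (simp_all del: F\<^sub>2.nat_pow_Suc)
  \<comment> \<open>Modulo \<open>N\<^sub>2\<close> the element d^j equals w^(m j) = w^(e + 1), so
    (c, d)^j stays in \<open>G\<close> when its second component is replaced by this power.\<close>
  have hG: "(?g, ?h) \<in> G"
  proof -
    have "inv\<^bsub>F\<^sub>2\<^esub> ?m \<otimes>\<^bsub>F\<^sub>2\<^esub> d \<in> N\<^sub>2" using cl ncl n by (simp add: dd)
    then have "inv\<^bsub>F\<^sub>2\<^esub> (?m [^]\<^bsub>F\<^sub>2\<^esub> j) \<otimes>\<^bsub>F\<^sub>2\<^esub> d [^]\<^bsub>F\<^sub>2\<^esub> j \<in> N\<^sub>2"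
      by (rule F\<^sub>2.normal_congruent_pow[OF N\<^sub>2_normal cl(2) cdc(2)])
    moreover have "?m [^]\<^bsub>F\<^sub>2\<^esub> j = ?h" using wc mj by (simp add: F\<^sub>2.nat_pow_pow del: F\<^sub>2.nat_pow_Suc)
    ultimately have "(\<one>\<^bsub>F\<^sub>1\<^esub>, inv\<^bsub>F\<^sub>2\<^esub> ?h \<otimes>\<^bsub>F\<^sub>2\<^esub> d [^]\<^bsub>F\<^sub>2\<^esub> j) \<in> G" by (simp add: mem_N\<^sub>2 del: F\<^sub>2.nat_pow_Suc)
    then have "(?g \<otimes>\<^bsub>F\<^sub>1\<^esub> inv\<^bsub>F\<^sub>1\<^esub> \<one>\<^bsub>F\<^sub>1\<^esub>, d [^]\<^bsub>F\<^sub>2\<^esub> j \<otimes>\<^bsub>F\<^sub>2\<^esub> inv\<^bsub>F\<^sub>2\<^esub> (inv\<^bsub>F\<^sub>2\<^esub> ?h \<otimes>\<^bsub>F\<^sub>2\<^esub> d [^]\<^bsub>F\<^sub>2\<^esub> j)) \<in> G"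
      using mult_mem[OF pow_mem[OF cd] inv_mem] by blast
    then show ?thesis using cl by (simp add: F\<^sub>2.inv_mult_group del: F\<^sub>2.nat_pow_Suc)
  qed
  \<comment> \<open>In the first component c^j commutes with \<open>c\<close>. In the second, w^(e +
    1) conjugates \<open>d\<close> to w d w^-1 up to the w-conjugate of a commutator of
    \<open>n\<close> with w^e; this commutator is now built inside \<open>K\<close>.\<close>
  have "(\<one>\<^bsub>F\<^sub>1\<^esub>, inv\<^bsub>F\<^sub>2\<^esub> n) \<in> G" using inv_mem[OF nG] by simp
  from Km(5)[OF this eK]
  have "(x [^]\<^bsub>F\<^sub>1\<^esub> e, inv\<^bsub>F\<^sub>2\<^esub> n \<otimes>\<^bsub>F\<^sub>2\<^esub> ?e \<otimes>\<^bsub>F\<^sub>2\<^esub> n) \<in> K" using cl ncl by simp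
  from Km(5)[OF w Km(3)[OF this Km(4)[OF eK]]]
  have "(\<one>\<^bsub>F\<^sub>1\<^esub>, w \<otimes>\<^bsub>F\<^sub>2\<^esub> (inv\<^bsub>F\<^sub>2\<^esub> n \<otimes>\<^bsub>F\<^sub>2\<^esub> ?e \<otimes>\<^bsub>F\<^sub>2\<^esub> n \<otimes>\<^bsub>F\<^sub>2\<^esub> inv\<^bsub>F\<^sub>2\<^esub> ?e) \<otimes>\<^bsub>F\<^sub>2\<^esub> inv\<^bsub>F\<^sub>2\<^esub> w) \<in> K"
    using cl wc by simp
  moreover have "\<one>\<^bsub>F\<^sub>1\<^esub> = inv\<^bsub>F\<^sub>1\<^esub> c \<otimes>\<^bsub>F\<^sub>1\<^esub> (?g \<otimes>\<^bsub>F\<^sub>1\<^esub> c \<otimes>\<^bsub>F\<^sub>1\<^esub> inv\<^bsub>F\<^sub>1\<^esub> ?g)"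
  proof -
    have "?g \<otimes>\<^bsub>F\<^sub>1\<^esub> c = c \<otimes>\<^bsub>F\<^sub>1\<^esub> ?g" using F\<^sub>1.nat_pow_Suc2[OF cdc(1), of j] by simp
    then show ?thesis using cl cdc by (simp add: F\<^sub>1.m_assoc)
  qed
  moreover have "w \<otimes>\<^bsub>F\<^sub>2\<^esub> (inv\<^bsub>F\<^sub>2\<^esub> n \<otimes>\<^bsub>F\<^sub>2\<^esub> ?e \<otimes>\<^bsub>F\<^sub>2\<^esub> n \<otimes>\<^bsub>F\<^sub>2\<^esub> inv\<^bsub>F\<^sub>2\<^esub> ?e) \<otimes>\<^bsub>F\<^sub>2\<^esub> inv\<^bsub>F\<^sub>2\<^esub> w
      = inv\<^bsub>F\<^sub>2\<^esub> (w \<otimes>\<^bsub>F\<^sub>2\<^esub> d \<otimes>\<^bsub>F\<^sub>2\<^esub> inv\<^bsub>F\<^sub>2\<^esub> w) \<otimes>\<^bsub>F\<^sub>2\<^esub> (?h \<otimes>\<^bsub>F\<^sub>2\<^esub> d \<otimes>\<^bsub>F\<^sub>2\<^esub> inv\<^bsub>F\<^sub>2\<^esub> ?h)"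
  proof -
    have h: "?h = w \<otimes>\<^bsub>F\<^sub>2\<^esub> ?e" using F\<^sub>2.nat_pow_Suc2[OF wc(2)] .
    have "?e \<otimes>\<^bsub>F\<^sub>2\<^esub> ?m = ?m \<otimes>\<^bsub>F\<^sub>2\<^esub> ?e" using wc by (simp add: F\<^sub>2.nat_pow_mult add.commute)
    then have "inv\<^bsub>F\<^sub>2\<^esub> ?m \<otimes>\<^bsub>F\<^sub>2\<^esub> (?e \<otimes>\<^bsub>F\<^sub>2\<^esub> ?m) \<otimes>\<^bsub>F\<^sub>2\<^esub> (n \<otimes>\<^bsub>F\<^sub>2\<^esub> (inv\<^bsub>F\<^sub>2\<^esub> ?e \<otimes>\<^bsub>F\<^sub>2\<^esub> inv\<^bsub>F\<^sub>2\<^esub> w))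
        = ?e \<otimes>\<^bsub>F\<^sub>2\<^esub> (n \<otimes>\<^bsub>F\<^sub>2\<^esub> (inv\<^bsub>F\<^sub>2\<^esub> ?e \<otimes>\<^bsub>F\<^sub>2\<^esub> inv\<^bsub>F\<^sub>2\<^esub> w))"
      using cl ncl wc by (simp add: F\<^sub>2.m_assoc del: F\<^sub>2.nat_pow_Suc)
    then show ?thesis
      unfolding h dd using cl(1,2) ncl wc by (simp add: F\<^sub>2.m_assoc F\<^sub>2.inv_mult_group)
  qed
  ultimately show False using sepK[OF hG] by (simp del: F\<^sub>2.nat_pow_Suc)
qed

text \<open>By \<open>coprime_power_mem\<close>, for each nonzero m prime to p the order of the
  class of \<open>x\<close> divides some 1 + m k. Infinite order, encoded as 0, is excluded by m = p
  + 1, as (p + 1) k = -1 has no solution. For finite order let m be its part prime to p; then m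
  divides the order, hence 1, and a power of p remains.\<close>

lemma p_group_if_p_conjugacy_separable: "p_group p (F\<^sub>1 Mod N\<^sub>1)"
  unfolding F\<^sub>1.p_group_Mod_iff[OF p N\<^sub>1_normal]
proof
  fix x assume x: "x \<in> carrier F\<^sub>1"
  interpret Q: group "F\<^sub>1 Mod N\<^sub>1" using N\<^sub>1_normal by (rule normal.factorgroup_is_group)
  have sg: "subgroup N\<^sub>1 F\<^sub>1" using N\<^sub>1_normal normal_imp_subgroup by blast
  let ?q = "N\<^sub>1 #>\<^bsub>F\<^sub>1\<^esub> x"
  have qc: "?q \<in> carrier (F\<^sub>1 Mod N\<^sub>1)" using x by (auto simp: carrier_FactGroup)
  have one: "N\<^sub>1 #>\<^bsub>F\<^sub>1\<^esub> z = N\<^sub>1 \<longleftrightarrow> z \<in> N\<^sub>1" if "z \<in> carrier F\<^sub>1" for z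
    using F\<^sub>1.rcos_eq_iff[OF sg that F\<^sub>1.one_closed] F\<^sub>1.coset_mult_one[OF subgroup.subset[OF sg]] that by simp
  have int: "int (Q.ord ?q) dvd i \<longleftrightarrow> x [^]\<^bsub>F\<^sub>1\<^esub> i \<in> N\<^sub>1" for i :: int
    using Q.int_pow_eq_id[OF qc, of i] normal.FactGroup_int_pow[OF N\<^sub>1_normal x, of i] one x by simp
  have dvd: "\<exists>k. int (Q.ord ?q) dvd 1 + int m * k" if "coprime m p" "m \<noteq> 0" for m
    using coprime_power_mem[OF that x] int by blast
  have p1: "p > 1" using p prime_gt_1_nat by blast
  have "Q.ord ?q > 0"
  proof (rule ccontr)
    assume "\<not> Q.ord ?q > 0"
    moreover obtain k where "int (Q.ord ?q) dvd 1 + int (Suc p) * k" using dvd[of "Suc p"] by auto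
    ultimately have "int (Suc p) * k = - 1" by simp
    then have "int (Suc p) dvd 1" by (metis dvd_minus_iff dvd_triv_left)
    then show False using p1 by simp
  qed
  then obtain s r where r: "\<not> p dvd r" "Q.ord ?q = r * p ^ s" using prime_power_canonical[OF p] by blast
  have "coprime r p" using prime_imp_coprime[OF p r(1)] by (simp add: coprime_commute)
  moreover have "r \<noteq> 0" using r(1) by (metis dvd_0_right)
  ultimately obtain k where "int (Q.ord ?q) dvd 1 + int r * k" using dvd by blast
  moreover have "int r dvd int (Q.ord ?q)" by (simp add: r(2))
  ultimately have "int r dvd 1 + int r * k" using dvd_trans by blast
  then have "int r dvd 1" using dvd_add_left_iff[of "int r" "int r * k" 1] by simp
  then have "Q.ord ?q = p ^ s" using r(2) by simp
  then have "x [^]\<^bsub>F\<^sub>1\<^esub> int (p ^ s) \<in> N\<^sub>1" using int[of "int (p ^ s)"] by simp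
  then show "\<exists>n::nat. x [^]\<^bsub>F\<^sub>1\<^esub> (p ^ n) \<in> N\<^sub>1" unfolding int_pow_int by blast
qed

end

end

theorem corollary1p7:
  fixes p :: nat
    and F\<^sub>1 :: "'a monoid" and F\<^sub>2 :: "'b monoid"
    and G :: "('a \<times> 'b) set" and N\<^sub>1 :: "'a set"
  assumes "Factorial_Ring.prime p"
    and "free_group F\<^sub>1" and "\<not> comm_group F\<^sub>1"
    and "free_group F\<^sub>2" and "\<not> comm_group F\<^sub>2"
    and "full_subdirect_product F\<^sub>1 F\<^sub>2 G"
    and "N\<^sub>1 = inter_fst F\<^sub>1 F\<^sub>2 G"
  shows "p_conjugacy_separable p ((F\<^sub>1 \<times>\<times> F\<^sub>2)\<lparr>carrier := G\<rparr>) \<longleftrightarrow>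
         p_group p (F\<^sub>1 Mod N\<^sub>1) \<and> residually_finite (F\<^sub>1 Mod N\<^sub>1)"
proof -
  obtain S\<^sub>1 S\<^sub>2 where "group F\<^sub>1" "free_basis F\<^sub>1 S\<^sub>1" "group F\<^sub>2" "free_basis F\<^sub>2 S\<^sub>2"
    using assms(2,4) by (auto simp: free_group_def)
  then interpret free_subdirect F\<^sub>1 S\<^sub>1 F\<^sub>2 S\<^sub>2 G
    using assms(6)
    by (simp add: free_subdirect_def based_free_group_def based_free_group_axioms_def
        subdirect_def subdirect_axioms_def full_subdirect_product_def)
  have "inter_fst F\<^sub>1 F\<^sub>2 G \<noteq> {\<one>\<^bsub>F\<^sub>1\<^esub>}" "inter_snd F\<^sub>1 F\<^sub>2 G \<noteq> {\<one>\<^bsub>F\<^sub>2\<^esub>}"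
    using assms(6) by (simp_all add: full_subdirect_product_def)
  then show ?thesis
    unfolding assms(7)
    using assms(1,3,5) p_conjugacy_separable_if_residually_finite_p_group
      p_group_if_p_conjugacy_separable residually_finite_if_p_conjugacy_separable
    by blast
qed

end
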